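(* Let $\mathbb{K}$ be an algebraically closed field of characteristic zero and let $X$ be a rigid affine variety over $\mathbb{K}$, with maximal torus $\mathbb{T}$ of $\mathrm{Aut}(X)$. Assume that the canonical grading on $\mathbb{K}[X]$ is pointed. Then $\mathrm{Aut}(X)$ is a finite extension of the torus $\mathbb{T}$, i.e. $\mathbb{T}$ is a normal subgroup of $\mathrm{Aut}(X)$ and the factor group $\mathrm{Aut}(X)/\mathbb{T}$ is finite.
   Context: $\mathrm{Aut}(X)$ is the group of all algebraic automorphisms of $X$. A subtorus of $\mathrm{Aut}(X)$ is a subgroup with a structure of an algebraic group isomorphic to $(\mathbb{K}^{\times})^s$ for some $s$ such that its action on $X$ is a morphism. An irreducible affine variety $X$ is rigid if it admits no nontrivial regular action of the additive group $(\mathbb{K},+)$. For a rigid affine variety $X$ there is a unique subtorus $\mathbb{T}$ of $\mathrm{Aut}(X)$ containing all other subtori, called the maximal torus. Let $M$ be the character lattice of $\mathbb{T}$. The canonical grading on $\mathbb{K}[X]$ is the $M$-grading $$\mathbb{K}[X]=\bigoplus_{u\in M}\mathbb{K}[X]_u,\qquad \mathbb{K}[X]_u=\{f\in\mathbb{K}[X] : t\cdot f=\chi^u(t)f \text{ for all } t\in\mathbb{T}\},$$ where $\chi^u$ is the character of $\mathbb{T}$ corresponding to $u\in M$. For a finitely generated abelian group $K$ and a finitely generated $K$-graded integral $\mathbb{K}$-algebra $A=\bigoplus_{w\in K}A_w$, the weight monoid is $S(A)=\{w\in K: A_w\neq 0\}$, and the weight cone $\omega(A)\subseteq K\otimes_{\mathbb{Z}}\mathbb{Q}$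 is the convex cone generated by $S(A)$. The grading is pointed if $\omega(A)$ contains no line and $A_0=\mathbb{K}$. *)

theory Defs
  imports
    "HOL-Analysis.Finite_Cartesian_Product"
    "HOL-Computational_Algebra.Polynomial"
    "HOL-Algebra.Coset"
    "HOL-Algebra.Bij"
    "HOL-Algebra.Group_Action"
begin

text \<open>
  The varieties that occur are sets \<open>Z\<close> of points together with a set \<open>G\<close> of functions that generates
  their algebra of regular functions: a closed subset of affine space with the coordinate functions,
  the torus with the coordinates and their inverses, and products of these.
\<close>

inductive_set fun_algebra :: "('z \<Rightarrow> 'a::field) set \<Rightarrow> ('z \<Rightarrow> 'a) set"
  for G :: "('z \<Rightarrow> 'a) set" where
  const: "(\<lambda>_. c) \<in> fun_algebra G"
| generator: "g \<in> G \<Longrightarrow> g \<in> fun_algebra G"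
| add: "f \<in> fun_algebra G \<Longrightarrow> g \<in> fun_algebra G \<Longrightarrow> (\<lambda>z. f z + g z) \<in> fun_algebra G"
| mult: "f \<in> fun_algebra G \<Longrightarrow> g \<in> fun_algebra G \<Longrightarrow> (\<lambda>z. f z * g z) \<in> fun_algebra G"

text \<open>Functions on \<open>Z\<close> are extensional, so that they are equal iff they agree on \<open>Z\<close>.\<close>

definition regular_functions :: "'z set \<Rightarrow> ('z \<Rightarrow> 'a::field) set \<Rightarrow> ('z \<Rightarrow> 'a) set" where
  "regular_functions Z G = (\<lambda>f. restrict f Z) ` fun_algebra G"

definition affine_coords :: "('a ^ 'n \<Rightarrow> 'a::field) set" where
  "affine_coords = range (\<lambda>i x. x $ i)"

definition prod_coords ::
    "('y \<Rightarrow> 'a::field) set \<Rightarrow> ('z \<Rightarrow> 'a) set \<Rightarrow> ('y \<times> 'z \<Rightarrow> 'a) set" where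
  "prod_coords G H = (\<lambda>g. g \<circ> fst) ` G \<union> (\<lambda>h. h \<circ> snd) ` H"

definition regular_map ::
    "'z set \<Rightarrow> ('z \<Rightarrow> 'a::field) set \<Rightarrow> ('a ^ 'n) set \<Rightarrow> ('z \<Rightarrow> 'a ^ 'n) \<Rightarrow> bool" where
  "regular_map Z G X f \<longleftrightarrow>
     f \<in> Z \<rightarrow> X \<and> (\<forall>i. (\<lambda>z\<in>Z. f z $ i) \<in> regular_functions Z G)"

text \<open>Over an infinite field, \<open>fun_algebra affine_coords\<close> is the polynomial ring.\<close>

definition zariski_closed :: "('a::field ^ 'n) set \<Rightarrow> bool" where
  "zariski_closed X \<longleftrightarrow> (\<exists>P \<subseteq> fun_algebra affine_coords. X = {x. \<forall>p\<in>P. p x = 0})"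

definition irreducible_affine_variety :: "('a::field ^ 'n) set \<Rightarrow> bool" where
  "irreducible_affine_variety X \<longleftrightarrow>
     zariski_closed X \<and> X \<noteq> {} \<and>
     (\<forall>Y Z. zariski_closed Y \<and> zariski_closed Z \<and> X = Y \<union> Z \<longrightarrow> X = Y \<or> X = Z)"

definition coordinate_ring :: "('a::field ^ 'n) set \<Rightarrow> ('a ^ 'n \<Rightarrow> 'a) set" where
  "coordinate_ring X = regular_functions X affine_coords"

definition automorphisms :: "('a::field ^ 'n) set \<Rightarrow> ('a ^ 'n \<Rightarrow> 'a ^ 'n) set" where
  "automorphisms X =
     {f \<in> Bij X. regular_map X affine_coords X f \<and> regular_map X affine_coords X (inv_into X f)}"

definition Aut :: "('a::field ^ 'n) set \<Rightarrow> ('a ^ 'n \<Rightarrow> 'a ^ 'n) monoid" where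
  "Aut X = BijGroup X \<lparr>carrier := automorphisms X\<rparr>"

definition Ga :: "'a::field monoid" where
  "Ga = \<lparr>carrier = UNIV, monoid.mult = (+), one = 0\<rparr>"

definition regular_Ga_action :: "('a::field ^ 'n) set \<Rightarrow> ('a \<Rightarrow> 'a ^ 'n \<Rightarrow> 'a ^ 'n) \<Rightarrow> bool" where
  "regular_Ga_action X \<alpha> \<longleftrightarrow>
     group_action Ga X \<alpha> \<and>
     regular_map (UNIV \<times> X) (prod_coords {\<lambda>a. a} affine_coords) X (\<lambda>(a, x). \<alpha> a x)"

definition rigid :: "('a::field ^ 'n) set \<Rightarrow> bool" where
  "rigid X \<longleftrightarrow> (\<forall>\<alpha>. regular_Ga_action X \<alpha> \<longrightarrow> (\<forall>a. \<forall>x\<in>X. \<alpha> a x = x))"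

definition Gm :: "'a::field monoid" where
  "Gm = \<lparr>carrier = UNIV - {0}, monoid.mult = (*), one = 1\<rparr>"

text \<open>The torus of dimension \<open>s\<close> consists of sequences whose entries beyond the first \<open>s\<close> are \<open>1\<close>.\<close>

definition torus :: "nat \<Rightarrow> (nat \<Rightarrow> 'a::field) monoid" where
  "torus s = \<lparr>carrier = {t. (\<forall>i<s. t i \<noteq> 0) \<and> (\<forall>i\<ge>s. t i = 1)},
              monoid.mult = (\<lambda>t u i. t i * u i), one = (\<lambda>_. 1)\<rparr>"

definition torus_coords :: "nat \<Rightarrow> ((nat \<Rightarrow> 'a::field) \<Rightarrow> 'a) set" where
  "torus_coords s = (\<lambda>i t. t i) ` {..<s} \<union> (\<lambda>i t. inverse (t i)) ` {..<s}"

text \<open>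
  A structure of an algebraic group isomorphic to a standard torus on a subgroup \<open>H\<close> of \<open>Aut X\<close> is
  given by the isomorphism \<open>\<phi>\<close>; the action of \<open>H\<close> on \<open>X\<close> is a morphism iff its pullback along \<open>\<phi>\<close> is.
\<close>

definition torus_structure ::
    "('a::field ^ 'n) set \<Rightarrow> ('a ^ 'n \<Rightarrow> 'a ^ 'n) set \<Rightarrow> nat
      \<Rightarrow> ((nat \<Rightarrow> 'a) \<Rightarrow> 'a ^ 'n \<Rightarrow> 'a ^ 'n) \<Rightarrow> bool" where
  "torus_structure X H s \<phi> \<longleftrightarrow>
     subgroup H (Aut X) \<and>
     \<phi> \<in> iso (torus s) (Aut X \<lparr>carrier := H\<rparr>) \<and>
     regular_map (carrier (torus s) \<times> X) (prod_coords (torus_coords s) affine_coords) X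
       (\<lambda>(t, x). \<phi> t x)"

definition subtorus :: "('a::field ^ 'n) set \<Rightarrow> ('a ^ 'n \<Rightarrow> 'a ^ 'n) set \<Rightarrow> bool" where
  "subtorus X H \<longleftrightarrow> (\<exists>s \<phi>. torus_structure X H s \<phi>)"

definition maximal_torus :: "('a::field ^ 'n) set \<Rightarrow> ('a ^ 'n \<Rightarrow> 'a ^ 'n) set \<Rightarrow> bool" where
  "maximal_torus X T \<longleftrightarrow> subtorus X T \<and> (\<forall>H. subtorus X H \<longrightarrow> H \<subseteq> T)"

text \<open>
  Characters of \<open>T\<close> are the homomorphisms of algebraic groups to the multiplicative group, where \<open>T\<close>
  carries the structure given by \<open>\<phi>\<close>. The character lattice is written multiplicatively, so that an
  element of it and the corresponding character are the same thing.
\<close>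

definition character_lattice ::
    "('a::field ^ 'n) set \<Rightarrow> ('a ^ 'n \<Rightarrow> 'a ^ 'n) set \<Rightarrow> nat
      \<Rightarrow> ((nat \<Rightarrow> 'a) \<Rightarrow> 'a ^ 'n \<Rightarrow> 'a ^ 'n) \<Rightarrow> (('a ^ 'n \<Rightarrow> 'a ^ 'n) \<Rightarrow> 'a) monoid" where
  "character_lattice X T s \<phi> =
     \<lparr>carrier = {\<xi> \<in> extensional T.
         \<xi> \<in> hom (Aut X \<lparr>carrier := T\<rparr>) Gm \<and>
         (\<lambda>t\<in>carrier (torus s). \<xi> (\<phi> t)) \<in> regular_functions (carrier (torus s)) (torus_coords s)},
      monoid.mult = (\<lambda>\<xi> \<eta>. \<lambda>t\<in>T. \<xi> t * \<eta> t), one = (\<lambda>t\<in>T. 1)\<rparr>"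

text \<open>Here \<open>t\<close> acts on functions by \<open>(t \<cdot> f) x = f (t\<^sup>-\<^sup>1 x)\<close>.\<close>

definition canonical_grading ::
    "('a::field ^ 'n) set \<Rightarrow> ('a ^ 'n \<Rightarrow> 'a ^ 'n) set \<Rightarrow> (('a ^ 'n \<Rightarrow> 'a ^ 'n) \<Rightarrow> 'a)
      \<Rightarrow> ('a ^ 'n \<Rightarrow> 'a) set" where
  "canonical_grading X T \<xi> =
     {f \<in> coordinate_ring X. \<forall>t\<in>T. \<forall>x\<in>X. f ((inv\<^bsub>Aut X\<^esub> t) x) = \<xi> t * f x}"

text \<open>
  For an abelian group \<open>K\<close>, written multiplicatively, \<open>K \<otimes>\<^sub>\<int> \<rat>\<close> is the localization of \<open>K\<close> at the
  positive integers. The class of \<open>(w, m)\<close> is \<open>w \<otimes> 1/m\<close>.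
\<close>

definition frac_rel :: "('k, 'b) monoid_scheme \<Rightarrow> (('k \<times> int) \<times> ('k \<times> int)) set" where
  "frac_rel K = {((v, m), (w, n)). v \<in> carrier K \<and> w \<in> carrier K \<and> 0 < m \<and> 0 < n \<and>
     (\<exists>k>0. v [^]\<^bsub>K\<^esub> (k * n) = w [^]\<^bsub>K\<^esub> (k * m))}"

definition frac :: "('k, 'b) monoid_scheme \<Rightarrow> 'k \<Rightarrow> int \<Rightarrow> ('k \<times> int) set" where
  "frac K w m = frac_rel K `` {(w, m)}"

definition rat_space :: "('k, 'b) monoid_scheme \<Rightarrow> ('k \<times> int) set set" where
  "rat_space K = (carrier K \<times> {0<..}) // frac_rel K"

definition rat_zero :: "('k, 'b) monoid_scheme \<Rightarrow> ('k \<times> int) set" where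
  "rat_zero K = frac K \<one>\<^bsub>K\<^esub> 1"

definition rat_add ::
    "('k, 'b) monoid_scheme \<Rightarrow> ('k \<times> int) set \<Rightarrow> ('k \<times> int) set \<Rightarrow> ('k \<times> int) set" where
  "rat_add K a b =
     (\<Union>(v, m)\<in>a. \<Union>(w, n)\<in>b. frac K (v [^]\<^bsub>K\<^esub> n \<otimes>\<^bsub>K\<^esub> w [^]\<^bsub>K\<^esub> m) (m * n))"

definition rat_scale ::
    "('k, 'b) monoid_scheme \<Rightarrow> rat \<Rightarrow> ('k \<times> int) set \<Rightarrow> ('k \<times> int) set" where
  "rat_scale K q a =
     (\<Union>(v, m)\<in>a. frac K (v [^]\<^bsub>K\<^esub> fst (quotient_of q)) (m * snd (quotient_of q)))"

inductive_set convex_cone_hull ::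
    "('k, 'b) monoid_scheme \<Rightarrow> ('k \<times> int) set set \<Rightarrow> ('k \<times> int) set set"
  for K :: "('k, 'b) monoid_scheme" and S :: "('k \<times> int) set set" where
  zero: "rat_zero K \<in> convex_cone_hull K S"
| incl: "a \<in> S \<Longrightarrow> a \<in> convex_cone_hull K S"
| add: "a \<in> convex_cone_hull K S \<Longrightarrow> b \<in> convex_cone_hull K S \<Longrightarrow>
    rat_add K a b \<in> convex_cone_hull K S"
| scale: "a \<in> convex_cone_hull K S \<Longrightarrow> 0 \<le> q \<Longrightarrow> rat_scale K q a \<in> convex_cone_hull K S"

definition contains_line :: "('k, 'b) monoid_scheme \<Rightarrow> ('k \<times> int) set set \<Rightarrow> bool" where
  "contains_line K C \<longleftrightarrow> (\<exists>a \<in> rat_space K. a \<noteq> rat_zero K \<and> (\<forall>q. rat_scale K q a \<in> C))"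

text \<open>\<open>A w\<close> is the homogeneous component of degree \<open>w\<close> of an algebra of functions on \<open>X\<close>.\<close>

definition weight_monoid ::
    "('k, 'b) monoid_scheme \<Rightarrow> 'x set \<Rightarrow> ('k \<Rightarrow> ('x \<Rightarrow> 'a::field) set) \<Rightarrow> 'k set" where
  "weight_monoid K X A = {w \<in> carrier K. A w \<noteq> {\<lambda>x\<in>X. 0}}"

definition weight_cone ::
    "('k, 'b) monoid_scheme \<Rightarrow> 'x set \<Rightarrow> ('k \<Rightarrow> ('x \<Rightarrow> 'a::field) set) \<Rightarrow> ('k \<times> int) set set" where
  "weight_cone K X A = convex_cone_hull K ((\<lambda>w. frac K w 1) ` weight_monoid K X A)"

definition pointed_grading ::
    "('k, 'b) monoid_scheme \<Rightarrow> 'x set \<Rightarrow> ('k \<Rightarrow> ('x \<Rightarrow> 'a::field) set) \<Rightarrow> bool" where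
  "pointed_grading K X A \<longleftrightarrow>
     \<not> contains_line K (weight_cone K X A) \<and> A \<one>\<^bsub>K\<^esub> = range (\<lambda>c. \<lambda>x\<in>X. c)"

end

theory Submission
  imports Defs "HOL-Library.Function_Algebras" "Jordan_Normal_Form.Determinant"
begin

text \<open>
  Conjugates of \<open>T\<close> are subtori, so \<open>T\<close> is normal and automorphisms permute the weight spaces of
  \<open>K[X]\<close>. As the grading is pointed, Dickson's lemma makes every weight space finite-dimensional and
  the set of indecomposable weights finite; an automorphism is determined by its action on the latter
  up to the subgroup \<open>G\<close> that fixes all weights, so \<open>G\<close> has finite index.

  Take a maximal linearly independent set of weights of generators and let \<open>G\<^sub>1 \<subseteq> G\<close> consist of the
  elements of determinant one on these weight spaces. Then \<open>G = T G\<^sub>1\<close>, and it suffices that \<open>G\<^sub>1\<close> is finite.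
  If it is not, it has a nonzero tangent vector at the identity, which is a derivation of \<open>K[X]\<close> of degree
  zero. Its nilpotent part exponentiates to an action of the additive group, hence vanishes by
  rigidity. Two eigenvalues on one weight space could be separated by a rational functional on \<open>K\<close>, which
  would give a one-dimensional subtorus acting on that weight space by distinct scalars although it
  lies in \<open>T\<close>. So the derivation acts on the weight space of degree \<open>u\<close> by a scalar additive in \<open>u\<close>,
  which is zero because the derivative of the determinants vanishes.
\<close>

text \<open>\<open>G\<close> is never given the structure of an algebraic group. All that the
  dichotomy between finiteness and a tangent vector sees is a set with finitely many functions, here
  matrix entries on weight spaces, that separate the identity and are permuted up to linear
  combinations by translations. Passing to \<open>G\<^sub>1\<close> is forced, since
  \<open>T\<close> lies in \<open>G\<close> and has tangent vectors of its own. Determinants are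
  multiplicative, so \<open>G\<^sub>1\<close> is a group, and their derivative at the identity is
  the trace, which for a scalar derivation is the dimension times the scalar; characteristic zero
  allows division by the dimension. Finite-dimensional weight spaces serve twice: they provide the
  matrix entries, and they make the derivation locally finite, so that it has a Jordan
  decomposition. The eigenvalues lie in the field and not in the integers, hence the detour over
  rational functionals. Finitely many eigenvalues generate all others, so a functional can be scaled
  to integer values with greatest common divisor one; this makes the resulting action of the
  multiplicative group faithful, as a subtorus has to be an isomorphic image of a standard
  torus.\<close>

no_notation vec_index (infixl "$" 100)

section \<open>Functions with values in a field\<close>

definition fscale :: "'a::field \<Rightarrow> ('z \<Rightarrow> 'a) \<Rightarrow> 'z \<Rightarrow> 'a" where
  "fscale c f = (\<lambda>z. c * f z)"

lemma fscale_apply: "fscale c f z = c * f z"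
  by (simp add: fscale_def)

global_interpretation fv: vector_space fscale
  by unfold_locales (auto simp: fun_eq_iff fscale_apply algebra_simps)

text \<open>Used over the ground field to construct a tangent vector, and over the rationals to
  obtain functionals dual to independent weights.\<close>

lemma ex_linear_functional:
  fixes B :: "('z \<Rightarrow> 'a::field) set"
  assumes "fv.independent B"
  shows "\<exists>d :: ('z \<Rightarrow> 'a) \<Rightarrow> 'a. (\<forall>f g. d (f + g) = d f + d g) \<and> (\<forall>c f. d (fscale c f) = c * d f) \<and>
    (\<forall>b\<in>B. d b = h b)"
proof -
  interpret p: vector_space_pair fscale "(*) :: 'a \<Rightarrow> 'a \<Rightarrow> 'a"
    by unfold_locales (auto simp: algebra_simps)
  obtain d where d: "Vector_Spaces.linear fscale (*) d" "\<forall>b\<in>B. d b = h b"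
    using p.linear_independent_extend[OF assms] by blast
  interpret d: Vector_Spaces.linear fscale "(*)" d by (rule d(1))
  show ?thesis using d(2) d.add d.scale by blast
qed

lemma sum_fun_apply: "(\<Sum>i\<in>I. f i) x = (\<Sum>i\<in>I. f i x)"
  by (induction I rule: infinite_finite_induct) auto

lemma prod_fun_apply: "(\<Prod>i\<in>I. f i) x = (\<Prod>i\<in>I. f i x)"
  by (induction I rule: infinite_finite_induct) auto

lemma power_fun_apply: "(f ^ n) x = f x ^ n" for f :: "'x \<Rightarrow> 'b::monoid_mult"
  by (induction n) auto

lemma diff_fun_apply: "(f - g) x = f x - g x" for f :: "'x \<Rightarrow> 'b::ab_group_add"
  by (simp add: fun_diff_def)

lemma fscale_mult_left: "fscale c f * g = fscale c (f * g)"
  by (auto simp: fun_eq_iff fscale_apply)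

lemma fscale_mult_right: "f * fscale c g = fscale c (f * g)"
  by (auto simp: fun_eq_iff fscale_apply)

subsection \<open>Regular functions on a set\<close>

text \<open>Values outside \<open>Z\<close> stay free, so that sums, products and compositions can
  be formed without restriction operators.\<close>

definition regular_on :: "'z set \<Rightarrow> ('z \<Rightarrow> 'a::field) set \<Rightarrow> ('z \<Rightarrow> 'a) \<Rightarrow> bool" where
  "regular_on Z G f \<longleftrightarrow> (\<exists>p\<in>fun_algebra G. \<forall>z\<in>Z. f z = p z)"

lemma restrict_regular_functions_iff:
  "(\<lambda>z\<in>Z. f z) \<in> regular_functions Z G \<longleftrightarrow> regular_on Z G f"
proof -
  have "restrict f Z = restrict p Z \<longleftrightarrow> (\<forall>z\<in>Z. f z = p z)" for p :: "'a \<Rightarrow> 'b"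
    unfolding fun_eq_iff restrict_def by auto
  then show ?thesis
    unfolding regular_functions_def regular_on_def image_iff by simp
qed

lemma regular_on_cong: "(\<And>z. z \<in> Z \<Longrightarrow> f z = g z) \<Longrightarrow> regular_on Z G f \<Longrightarrow> regular_on Z G g"
  unfolding regular_on_def by metis

lemma regular_on_const [intro, simp]: "regular_on Z G (\<lambda>_. c)"
  unfolding regular_on_def using fun_algebra.const by (intro bexI[of _ "\<lambda>_. c"]) auto

lemma regular_on_generator: "g \<in> G \<Longrightarrow> regular_on Z G g"
  unfolding regular_on_def using fun_algebra.generator by blast

lemma regular_on_algebra: "g \<in> fun_algebra G \<Longrightarrow> regular_on Z G g"
  unfolding regular_on_def by blast

lemma regular_on_add: 
  assumes "regular_on Z G f" "regular_on Z G g" shows "regular_on Z G (\<lambda>z. f z + g z)"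
proof -
  obtain p q where "p \<in> fun_algebra G" "q \<in> fun_algebra G" "\<forall>z\<in>Z. f z = p z" "\<forall>z\<in>Z. g z = q z"
    using assms unfolding regular_on_def by blast
  then show ?thesis unfolding regular_on_def
    by (intro bexI[of _ "\<lambda>z. p z + q z"]) (auto intro: fun_algebra.add)
qed

lemma regular_on_mult:
  assumes "regular_on Z G f" "regular_on Z G g" shows "regular_on Z G (\<lambda>z. f z * g z)"
proof -
  obtain p q where "p \<in> fun_algebra G" "q \<in> fun_algebra G" "\<forall>z\<in>Z. f z = p z" "\<forall>z\<in>Z. g z = q z"
    using assms unfolding regular_on_def by blast
  then show ?thesis unfolding regular_on_def
    by (intro bexI[of _ "\<lambda>z. p z * q z"]) (auto intro: fun_algebra.mult)
qed

lemma regular_on_scale: "regular_on Z G f \<Longrightarrow> regular_on Z G (\<lambda>z. c * f z)"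
  by (rule regular_on_mult) auto

lemma regular_on_diff: 
  assumes "regular_on Z G f" "regular_on Z G g" shows "regular_on Z G (\<lambda>z. f z - g z)"
  using regular_on_add[OF assms(1) regular_on_scale[OF assms(2), of "-1"]] by simp

lemma regular_on_sum:
  "(\<And>i. i \<in> I \<Longrightarrow> regular_on Z G (f i)) \<Longrightarrow> regular_on Z G (\<lambda>z. \<Sum>i\<in>I. f i z)"
  by (induction I rule: infinite_finite_induct) (auto intro: regular_on_add)

lemma regular_on_prod:
  "(\<And>i. i \<in> I \<Longrightarrow> regular_on Z G (f i)) \<Longrightarrow> regular_on Z G (\<lambda>z. \<Prod>i\<in>I. f i z)"
  by (induction I rule: infinite_finite_induct) (auto intro: regular_on_mult)

lemma regular_on_power:
  "regular_on Z G f \<Longrightarrow> regular_on Z G (\<lambda>z. f z ^ k)"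
  by (induction k) (auto intro: regular_on_mult)

lemma regular_on_comp:
  assumes "regular_on Y H f" "m \<in> Z \<rightarrow> Y" "\<And>h. h \<in> H \<Longrightarrow> regular_on Z G (\<lambda>z. h (m z))"
  shows "regular_on Z G (\<lambda>z. f (m z))"
proof -
  obtain p where p: "p \<in> fun_algebra H" "\<forall>y\<in>Y. f y = p y"
    using assms(1) unfolding regular_on_def by blast
  from p(1) have "regular_on Z G (\<lambda>z. p (m z))"
    by induction (auto intro: assms(3) regular_on_add regular_on_mult)
  then show ?thesis
    by (rule regular_on_cong[rotated]) (use p(2) assms(2) in \<open>auto simp: Pi_iff\<close>)
qed

lemma regular_on_trans:
  assumes "regular_on Z H f" "\<And>h. h \<in> H \<Longrightarrow> regular_on Z G h"
  shows "regular_on Z G f"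
  using regular_on_comp[OF assms(1), of "\<lambda>z. z" Z G] assms(2) by auto

lemma regular_map_iff:
  "regular_map Z G X f \<longleftrightarrow> f \<in> Z \<rightarrow> X \<and> (\<forall>i. regular_on Z G (\<lambda>z. f z $ i))"
  unfolding regular_map_def restrict_regular_functions_iff ..

lemma regular_on_comp_map:
  assumes "regular_on X affine_coords f" "regular_map Z G X m"
  shows "regular_on Z G (\<lambda>z. f (m z))"
  by (rule regular_on_comp[OF assms(1)]) (use assms(2) in \<open>auto simp: regular_map_iff affine_coords_def\<close>)

lemma regular_map_comp:
  assumes "regular_map X affine_coords Y f" "regular_map Z G X m"
  shows "regular_map Z G Y (\<lambda>z. f (m z))"
  using assms regular_on_comp_map[OF _ assms(2)]
  unfolding regular_map_iff by auto

lemma regular_map_cong: "(\<And>z. z \<in> Z \<Longrightarrow> f z = g z) \<Longrightarrow> regular_map Z G X f \<Longrightarrow> regular_map Z G X g"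
proof -
  assume fg: "\<And>z. z \<in> Z \<Longrightarrow> f z = g z" and f: "regular_map Z G X f"
  have "regular_on Z G (\<lambda>z. g z $ i)" for i
    by (rule regular_on_cong[of _ "\<lambda>z. f z $ i"]) (use fg f in \<open>auto simp: regular_map_iff\<close>)
  then show ?thesis
    using fg f unfolding regular_map_iff Pi_iff by auto
qed

subsection \<open>Monomials\<close>

text \<open>The unit element among the functions that vanish outside \<open>Z\<close>;
  multiplication by it cuts a function off.\<close>

definition cind :: "'z set \<Rightarrow> 'z \<Rightarrow> 'a::field" where
  "cind Z = (\<lambda>z. if z \<in> Z then 1 else 0)"

text \<open>The generating functions index their own exponents, so \<open>Y\<close> needs no
  enumeration.\<close>

definition monom_fun :: "'z set \<Rightarrow> ('z \<Rightarrow> 'a::field) set \<Rightarrow> (('z \<Rightarrow> 'a) \<Rightarrow> nat) \<Rightarrow> 'z \<Rightarrow> 'a" where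
  "monom_fun Z Y a = cind Z * (\<Prod>y\<in>Y. y ^ a y)"

definition exponents :: "'y set \<Rightarrow> ('y \<Rightarrow> nat) set" where
  "exponents Y = {a. \<forall>y. y \<notin> Y \<longrightarrow> a y = 0}"

lemma exponents_add: "a \<in> exponents Y \<Longrightarrow> b \<in> exponents Y \<Longrightarrow> a + b \<in> exponents Y"
  by (auto simp: exponents_def)

lemma zero_exponents [simp]: "0 \<in> exponents Y"
  by (auto simp: exponents_def)

lemma monom_fun_mult: "monom_fun Z Y a * monom_fun Z Y b = monom_fun Z Y (a + b)"
  by (auto simp: monom_fun_def fun_eq_iff cind_def prod_fun_apply power_fun_apply power_add prod.distrib)

lemma fv_span_mult:
  assumes "f \<in> fv.span S" "g \<in> fv.span S'" "\<And>x y. x \<in> S \<Longrightarrow> y \<in> S' \<Longrightarrow> x * y \<in> fv.span U"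
  shows "f * g \<in> fv.span U"
  using assms(1)
proof (induction rule: fv.span_induct_alt)
  case base
  then show ?case by (simp only: mult_zero_left fv.span_zero)
next
  case (step c x y)
  have xg: "x * g \<in> fv.span U"
    using assms(2)
  proof (induction rule: fv.span_induct_alt)
    case (step d x' y')
    have eq: "x * (fscale d x' + y') = fscale d (x * x') + x * y'"
      by (simp add: distrib_left fscale_mult_right)
    show "x * (fscale d x' + y') \<in> fv.span U"
      unfolding eq by (rule fv.span_add[OF fv.span_scale[OF assms(3)[OF \<open>x \<in> S\<close> step.hyps(1)]] step.IH])
  qed (simp only: mult_zero_right fv.span_zero)
  have eq: "(fscale c x + y) * g = fscale c (x * g) + y * g"
    by (simp add: distrib_right fscale_mult_left)
  show "(fscale c x + y) * g \<in> fv.span U"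
    unfolding eq by (rule fv.span_add[OF fv.span_scale[OF xg] step.IH])
qed

lemma regular_on_imp_span_monom:
  assumes "finite Y" "regular_on Z Y f" "\<And>z. z \<notin> Z \<Longrightarrow> f z = 0"
  shows "f \<in> fv.span (monom_fun Z Y ` exponents Y)"
proof -
  let ?S = "fv.span (monom_fun Z Y ` exponents Y)"
  obtain p where p: "p \<in> fun_algebra Y" "\<forall>z\<in>Z. f z = p z"
    using assms(2) unfolding regular_on_def by blast
  have f: "f = cind Z * p"
    using p(2) assms(3) by (auto simp: fun_eq_iff cind_def)
  from p(1) have "cind Z * p \<in> ?S"
  proof induction
    case (const c)
    have "monom_fun Z Y 0 = cind Z"
      by (auto simp: monom_fun_def fun_eq_iff prod_fun_apply)
    then have "cind Z \<in> monom_fun Z Y ` exponents Y"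
      by (intro image_eqI[OF _ zero_exponents]) simp
    then have "cind Z \<in> ?S" by (rule fv.span_base)
    have eq: "cind Z * (\<lambda>_. c) = fscale c (cind Z)"
      by (auto simp: fun_eq_iff fscale_apply)
    show "cind Z * (\<lambda>_. c) \<in> ?S"
      unfolding eq by (rule fv.span_scale) fact
  next
    case (generator g)
    define a where "a = (\<lambda>y. if y = g then 1 else 0 :: nat)"
    have "(\<Prod>y\<in>Y. y ^ a y) = (\<Prod>y\<in>Y. if y = g then g else 1)"
      by (rule prod.cong) (auto simp: a_def)
    also have "\<dots> = g" using generator assms(1) by (simp add: prod.delta)
    finally have "monom_fun Z Y a = cind Z * g" by (simp add: monom_fun_def)
    moreover have "a \<in> exponents Y" using generator by (auto simp: a_def exponents_def)
    ultimately have "cind Z * g \<in> monom_fun Z Y ` exponents Y"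
      by (intro image_eqI) simp_all
    then show ?case by (rule fv.span_base)
  next
    case (add f g)
    have eq: "cind Z * (\<lambda>z. f z + g z) = cind Z * f + cind Z * g"
      by (auto simp: fun_eq_iff algebra_simps)
    show "cind Z * (\<lambda>z. f z + g z) \<in> ?S"
      unfolding eq by (rule fv.span_add[OF add.IH])
  next
    case (mult f g)
    have "cind Z * (\<lambda>z. f z * g z) = (cind Z * f) * (cind Z * g)"
      by (auto simp: fun_eq_iff cind_def)
    also have "\<dots> \<in> ?S"
      by (rule fv_span_mult[OF mult.IH])
        (auto simp: monom_fun_mult intro!: fv.span_base imageI exponents_add)
    finally show ?case .
  qed
  then show ?thesis using f by simp
qed

subsection \<open>Isolated points and tangent vectors\<close>

text \<open>Nakayama's lemma by Gaussian elimination instead of determinants. The coefficient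
  \<open>u\<close> on the left, rather than 1, keeps the hypothesis stable: each elimination
  multiplies the remaining equations by a function that is 1 at \<open>e\<close>.\<close>

lemma nakayama_elimination:
  fixes z :: "'i \<Rightarrow> 'z \<Rightarrow> 'a::field"
  assumes "finite I"
    and "\<And>i. i \<in> I \<Longrightarrow> \<exists>u p. regular_on Z G u \<and> u e = 1 \<and>
      (\<forall>j\<in>I. regular_on Z G (p j) \<and> p j e = 0) \<and>
      (\<forall>g\<in>Z. u g * z i g = (\<Sum>j\<in>I. p j g * z j g))"
  shows "\<exists>h. regular_on Z G h \<and> h e = 1 \<and> (\<forall>i\<in>I. \<forall>g\<in>Z. h g * z i g = 0)"
  using assms
proof (induction I rule: finite_induct)
  case empty
  show ?case by (intro exI[of _ "\<lambda>_. 1"]) auto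
next
  case (insert x I)
  obtain u p where up: "regular_on Z G u" "u e = 1" 
      "\<And>j. j \<in> insert x I \<Longrightarrow> regular_on Z G (p j)" "\<And>j. j \<in> insert x I \<Longrightarrow> p j e = 0"
      "\<And>g. g \<in> Z \<Longrightarrow> u g * z x g = (\<Sum>j\<in>insert x I. p j g * z j g)"
    using insert.prems[of x] by blast
  \<comment> \<open>The pivot after moving the own term of \<open>z x\<close> to the left. It equals
    1 at \<open>e\<close>, so multiplying the other equations by it replaces the division.\<close>
  define w where "w = (\<lambda>g. u g - p x g)"
  have w: "regular_on Z G w" "w e = 1"
    unfolding w_def using up by (auto intro: regular_on_diff)
  have wx: "w g * z x g = (\<Sum>j\<in>I. p j g * z j g)" if "g \<in> Z" for g
    using up(5)[OF that] insert.hyps by (simp add: w_def algebra_simps)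
  have "\<exists>h. regular_on Z G h \<and> h e = 1 \<and> (\<forall>i\<in>I. \<forall>g\<in>Z. h g * z i g = 0)"
  proof (rule insert.IH)
    fix i assume i: "i \<in> I"
    obtain v q where vq: "regular_on Z G v" "v e = 1" 
      "\<And>j. j \<in> insert x I \<Longrightarrow> regular_on Z G (q j)" "\<And>j. j \<in> insert x I \<Longrightarrow> q j e = 0"
      "\<And>g. g \<in> Z \<Longrightarrow> v g * z i g = (\<Sum>j\<in>insert x I. q j g * z j g)"
      using insert.prems[of i] i by blast
    have "w g * v g * z i g = (\<Sum>j\<in>I. (w g * q j g + q x g * p j g) * z j g)" if "g \<in> Z" for g
    proof -
      have "w g * v g * z i g = q x g * (w g * z x g) + w g * (\<Sum>j\<in>I. q j g * z j g)"
      proof -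
        have "v g * z i g = q x g * z x g + (\<Sum>j\<in>I. q j g * z j g)"
          using vq(5)[OF that] insert.hyps by simp
        then have "w g * (v g * z i g) = w g * (q x g * z x g + (\<Sum>j\<in>I. q j g * z j g))" by simp
        then show ?thesis by (simp only: distrib_left ac_simps)
      qed
      also have "\<dots> = (\<Sum>j\<in>I. (w g * q j g + q x g * p j g) * z j g)"
        unfolding wx[OF that] by (simp add: sum_distrib_left sum.distrib[symmetric] algebra_simps)
      finally show ?thesis .
    qed
    then show "\<exists>u p. regular_on Z G u \<and> u e = 1 \<and>
      (\<forall>j\<in>I. regular_on Z G (p j) \<and> p j e = 0) \<and>
      (\<forall>g\<in>Z. u g * z i g = (\<Sum>j\<in>I. p j g * z j g))"
      by (intro exI[of _ "\<lambda>g. w g * v g"] exI[of _ "\<lambda>j g. w g * q j g + q x g * p j g"])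
        (use w up vq in \<open>auto intro!: regular_on_mult regular_on_add\<close>)
  qed
  then obtain h where h: "regular_on Z G h" "h e = 1" "\<And>i g. i \<in> I \<Longrightarrow> g \<in> Z \<Longrightarrow> h g * z i g = 0"
    by blast
  have "h g * w g * z x g = 0" if "g \<in> Z" for g
  proof -
    have "h g * w g * z x g = (\<Sum>j\<in>I. p j g * (h g * z j g))"
      using wx[OF that] by (simp add: sum_distrib_left mult.assoc mult.left_commute)
    also have "\<dots> = 0" using h(3)[OF _ that] by (intro sum.neutral ballI) (simp only: mult_zero_right)
    finally show ?thesis .
  qed
  moreover have "h g * w g * z i g = 0" if "g \<in> Z" "i \<in> I" for g i
    using h(3)[OF that(2,1)] by auto
  ultimately show ?case
    by (intro exI[of _ "\<lambda>g. h g * w g"]) (use h w in \<open>auto intro: regular_on_mult\<close>)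
qed

text \<open>A first-order Taylor formula: the differences \<open>d g - d e\<close> of the generators
  generate the ideal of functions vanishing at \<open>e\<close>. For a product,
  \<open>f h - f(e) h(e) = (f - f(e)) h + f(e) (h - h(e))\<close>.\<close>

lemma fun_algebra_difference:
  assumes "finite C" "f \<in> fun_algebra C"
  shows "\<exists>q. (\<forall>d\<in>C. regular_on Z C (q d)) \<and> (\<forall>g. f g - f e = (\<Sum>d\<in>C. q d g * (d g - d e)))"
  using assms(2)
proof induction
  case (const c)
  show ?case by (intro exI[of _ "\<lambda>_ _. 0"]) auto
next
  case (generator c)
  have "(\<Sum>d\<in>C. (if d = c then 1 else 0) * (d g - d e)) = c g - c e" for g
    using sum.delta[OF assms(1), of c "\<lambda>d. d g - d e"] generator by (simp add: if_distrib[of "\<lambda>x. x * _"] cong: if_cong)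
  then show ?case by (intro exI[of _ "\<lambda>d _. if d = c then 1 else 0"]) auto
next
  case (add f h)
  then obtain p q where pq: "\<forall>d\<in>C. regular_on Z C (p d)" "\<forall>g. f g - f e = (\<Sum>d\<in>C. p d g * (d g - d e))"
    "\<forall>d\<in>C. regular_on Z C (q d)" "\<forall>g. h g - h e = (\<Sum>d\<in>C. q d g * (d g - d e))" by blast
  have "f g + h g - (f e + h e) = (\<Sum>d\<in>C. (p d g + q d g) * (d g - d e))" for g
  proof -
    have "f g + h g - (f e + h e) = (f g - f e) + (h g - h e)" by simp
    then show ?thesis unfolding pq(2)[rule_format] pq(4)[rule_format] 
      by (simp add: sum.distrib[symmetric] distrib_right)
  qed
  then show ?case using pq by (intro exI[of _ "\<lambda>d g. p d g + q d g"]) (auto intro: regular_on_add)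
next
  case (mult f h)
  then obtain p q where pq: "\<forall>d\<in>C. regular_on Z C (p d)" "\<forall>g. f g - f e = (\<Sum>d\<in>C. p d g * (d g - d e))"
    "\<forall>d\<in>C. regular_on Z C (q d)" "\<forall>g. h g - h e = (\<Sum>d\<in>C. q d g * (d g - d e))" by blast
  have "f g * h g - (f e * h e) = (\<Sum>d\<in>C. (p d g * h g + f e * q d g) * (d g - d e))" for g
  proof -
    have "f g * h g - (f e * h e) = (f g - f e) * h g + f e * (h g - h e)" by (simp add: algebra_simps)
    then show ?thesis unfolding pq(2)[rule_format] pq(4)[rule_format] 
      by (simp add: sum.distrib[symmetric] distrib_right sum_distrib_left sum_distrib_right algebra_simps)
  qed
  moreover have "regular_on Z C (\<lambda>g. p d g * h g + f e * q d g)" if "d \<in> C" for d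
    by (rule regular_on_add[OF regular_on_mult regular_on_scale])
      (use that pq mult.hyps regular_on_algebra in blast)+
  ultimately show ?case
    by (intro exI[of _ "\<lambda>d g. p d g * h g + f e * q d g"]) simp
qed

lemma finite_if_isolated_point:
  fixes h :: "'z \<Rightarrow> 'a::field"
  assumes "finite C" "regular_on Z C h" "h e \<noteq> 0" "\<And>g. g \<in> Z \<Longrightarrow> g \<noteq> e \<Longrightarrow> h g = 0"
    and transl: "\<And>g0. g0 \<in> Z \<Longrightarrow> \<exists>\<tau>. \<tau> \<in> Z \<rightarrow> Z \<and> \<tau> g0 = e \<and> (\<forall>g\<in>Z. \<tau> g = e \<longrightarrow> g = g0) \<and>
      (\<forall>c\<in>C. \<exists>a. \<forall>g\<in>Z. c (\<tau> g) = (\<Sum>d\<in>C. a d * d g))"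
  shows "finite Z"
proof -
  \<comment> \<open>Words of length at most \<open>n\<close> in the generators; their span consists
    of the polynomials of degree at most \<open>n\<close>, cut off outside \<open>Z\<close>.\<close>
  define P where "P n = (\<lambda>l. cind Z * prod_list l) ` {l. set l \<subseteq> C \<and> length l \<le> n}" for n
  have fin: "finite (P n)" for n
    unfolding P_def by (intro finite_imageI finite_lists_length_le assms(1))
  have Pmono: "fv.span (P m) \<subseteq> fv.span (P n)" if "m \<le> n" for m n
    unfolding P_def by (intro fv.span_mono image_mono) (use that in auto)
  have Pmult: "f * g \<in> fv.span (P (m + n))" if "f \<in> fv.span (P m)" "g \<in> fv.span (P n)" for f g m n
  proof (rule fv_span_mult[OF that])
    fix x y assume "x \<in> P m" "y \<in> P n"
    then obtain k l where kl: "x = cind Z * prod_list k" "y = cind Z * prod_list l"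
      "set k \<subseteq> C" "length k \<le> m" "set l \<subseteq> C" "length l \<le> n" unfolding P_def by auto
    have "x * y = cind Z * prod_list (k @ l)"
      unfolding kl by (auto simp: fun_eq_iff cind_def)
    moreover have "k @ l \<in> {l. set l \<subseteq> C \<and> length l \<le> m + n}" using kl by auto
    ultimately have "x * y \<in> P (m + n)" unfolding P_def by blast
    then show "x * y \<in> fv.span (P (m + n))" by (rule fv.span_base)
  qed
  define good where "good \<tau> \<longleftrightarrow> \<tau> \<in> Z \<rightarrow> Z \<and> (\<forall>c\<in>C. \<exists>a. \<forall>g\<in>Z. c (\<tau> g) = (\<Sum>d\<in>C. a d * d g))" for \<tau> :: "'z \<Rightarrow> 'z"
  \<comment> \<open>The bound \<open>n\<close> is chosen before \<open>\<tau>\<close>: a translation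
    sends generators to linear combinations of generators and so cannot raise the degree.\<close>
  have filtered: "\<exists>n. \<forall>\<tau>. good \<tau> \<longrightarrow> cind Z * (\<lambda>g. f (\<tau> g)) \<in> fv.span (P n)" if "f \<in> fun_algebra C" for f
    using that
  proof induction
    case (const c)
    have "cind Z \<in> P 0" unfolding P_def by (auto simp: image_iff)
    then have "fscale c (cind Z) \<in> fv.span (P 0)" by (intro fv.span_scale fv.span_base)
    moreover have "fscale c (cind Z) = cind Z * (\<lambda>g. c)" by (auto simp: fun_eq_iff fscale_apply)
    ultimately have "cind Z * (\<lambda>g. c) \<in> fv.span (P 0)" by (simp only:)
    then show ?case by (intro exI[of _ 0] allI impI)
  next
    case (generator c)
    show ?case
    proof (intro exI[of _ 1] allI impI)
      fix \<tau> assume "good \<tau>"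
      then obtain a where a: "\<forall>g\<in>Z. c (\<tau> g) = (\<Sum>d\<in>C. a d * d g)"
        using generator unfolding good_def by blast
      have eq: "cind Z * (\<lambda>g. c (\<tau> g)) = (\<Sum>d\<in>C. fscale (a d) (cind Z * d))"
        using a by (auto simp: fun_eq_iff sum_fun_apply fscale_apply cind_def)
      have "cind Z * d \<in> P 1" if "d \<in> C" for d
        unfolding P_def by (rule image_eqI[of _ _ "[d]"]) (use that in auto)
      then show "cind Z * (\<lambda>g. c (\<tau> g)) \<in> fv.span (P 1)"
        unfolding eq by (intro fv.span_sum fv.span_scale fv.span_base)
    qed
  next
    case (add f g)
    then obtain m n where mn: "\<forall>\<tau>. good \<tau> \<longrightarrow> cind Z * (\<lambda>g. f (\<tau> g)) \<in> fv.span (P m)"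
      "\<forall>\<tau>. good \<tau> \<longrightarrow> cind Z * (\<lambda>x. g (\<tau> x)) \<in> fv.span (P n)" by blast
    show ?case
    proof (intro exI[of _ "max m n"] allI impI)
      fix \<tau> assume t: "good \<tau>"
      have eq: "cind Z * (\<lambda>x. f (\<tau> x) + g (\<tau> x)) = cind Z * (\<lambda>g. f (\<tau> g)) + cind Z * (\<lambda>x. g (\<tau> x))"
        by (auto simp: fun_eq_iff algebra_simps)
      show "cind Z * (\<lambda>x. f (\<tau> x) + g (\<tau> x)) \<in> fv.span (P (max m n))"
        unfolding eq using mn t Pmono[of m "max m n"] Pmono[of n "max m n"]
        by (intro fv.span_add) auto
    qed
  next
    case (mult f g)
    then obtain m n where mn: "\<forall>\<tau>. good \<tau> \<longrightarrow> cind Z * (\<lambda>g. f (\<tau> g)) \<in> fv.span (P m)"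
      "\<forall>\<tau>. good \<tau> \<longrightarrow> cind Z * (\<lambda>x. g (\<tau> x)) \<in> fv.span (P n)" by blast
    show ?case
    proof (intro exI[of _ "m + n"] allI impI)
      fix \<tau> assume t: "good \<tau>"
      have eq: "cind Z * (\<lambda>x. f (\<tau> x) * g (\<tau> x)) = (cind Z * (\<lambda>g. f (\<tau> g))) * (cind Z * (\<lambda>x. g (\<tau> x)))"
        by (auto simp: fun_eq_iff cind_def)
      show "cind Z * (\<lambda>x. f (\<tau> x) * g (\<tau> x)) \<in> fv.span (P (m + n))"
        unfolding eq using mn t by (intro Pmult) auto
    qed
  qed
  obtain h' where h': "h' \<in> fun_algebra C" "\<forall>g\<in>Z. h g = h' g"
    using assms(2) unfolding regular_on_def by blast
  obtain n where n: "\<And>\<tau>. good \<tau> \<Longrightarrow> cind Z * (\<lambda>g. h' (\<tau> g)) \<in> fv.span (P n)"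
    using filtered[OF h'(1)] by blast
  have delta: "cind {g0} \<in> fv.span (P n)" if g0: "g0 \<in> Z" for g0
  proof -
    obtain \<tau> where \<tau>: "\<tau> \<in> Z \<rightarrow> Z" "\<tau> g0 = e" "\<forall>g\<in>Z. \<tau> g = e \<longrightarrow> g = g0" "good \<tau>"
      using transl[OF g0] unfolding good_def by blast
    have "e \<in> Z" using \<tau>(1,2) g0 by auto
    then have e: "h' e = h e" using h'(2) by simp
    have "h' (\<tau> g) = 0" if "g \<in> Z" "g \<noteq> g0" for g
    proof -
      have "\<tau> g \<in> Z" "\<tau> g \<noteq> e" using \<tau> that by auto
      then show ?thesis using assms(4) h'(2) by metis
    qed
    \<comment> \<open>The translate of \<open>h\<close> is supported at \<open>g0\<close> alone,
      where its value is \<open>h e\<close>.\<close>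
    then have "cind {g0} = fscale (inverse (h e)) (cind Z * (\<lambda>g. h' (\<tau> g)))"
      using g0 \<tau>(2) assms(3) e by (auto simp: fun_eq_iff fscale_apply cind_def)
    then show ?thesis using fv.span_scale[OF n[OF \<tau>(4)]] by (simp only:)
  qed
  have ind: "fv.independent ((\<lambda>g. cind {g} :: 'z \<Rightarrow> 'a) ` Z)"
    unfolding fv.independent_explicit_module
  proof (intro allI impI)
    fix t u and v :: "'z \<Rightarrow> 'a"
    assume t: "finite t" "t \<subseteq> (\<lambda>g. cind {g}) ` Z" "(\<Sum>v\<in>t. fscale (u v) v) = 0" "v \<in> t"
    then obtain g where g: "v = cind {g}" by auto
    have "w g = 0" if w: "w \<in> t - {v}" for w
    proof -
      obtain k where "w = cind {k}" using w t(2) by auto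
      then show ?thesis using w g by (auto simp: cind_def)
    qed
    then have "(\<Sum>w\<in>t - {v}. u w * w g) = 0" by (intro sum.neutral) simp
    then have "u v * v g = 0"
      using arg_cong[OF t(3), of "\<lambda>f. f g"] t(1,4)
      by (simp add: sum_fun_apply fscale_apply sum.remove)
    then show "u v = 0" by (simp add: g cind_def)
  qed
  have inj: "inj_on (\<lambda>g. cind {g} :: 'z \<Rightarrow> 'a) Z"
  proof (rule inj_onI)
    fix g k assume "(cind {g} :: 'z \<Rightarrow> 'a) = cind {k}"
    from fun_cong[OF this, of g] show "g = k" by (simp add: cind_def split: if_splits)
  qed
  have "finite ((\<lambda>g. cind {g} :: 'z \<Rightarrow> 'a) ` Z)"
    using fv.independent_span_bound[OF fin ind] delta by blast
  then show ?thesis using inj by (rule finite_imageD)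
qed

text \<open>
  Without a tangent vector, the functions vanishing at \<open>e\<close> form an ideal equal to its square, and
  Nakayama's lemma makes \<open>e\<close> an isolated point. The translates of a function supported at \<open>e\<close> are
  linearly independent, but their degrees in the generators are bounded.
\<close>

lemma finite_or_tangent_vector:
  fixes C :: "('z \<Rightarrow> 'a::field) set"
  assumes "finite C" "e \<in> Z"
    and sep: "\<And>g. g \<in> Z \<Longrightarrow> (\<And>c. c \<in> C \<Longrightarrow> c g = c e) \<Longrightarrow> g = e"
    and transl: "\<And>g0. g0 \<in> Z \<Longrightarrow> \<exists>\<tau>. \<tau> \<in> Z \<rightarrow> Z \<and> \<tau> g0 = e \<and> (\<forall>g\<in>Z. \<tau> g = e \<longrightarrow> g = g0) \<and>
      (\<forall>c\<in>C. \<exists>a. \<forall>g\<in>Z. c (\<tau> g) = (\<Sum>d\<in>C. a d * d g))"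
    and infinite: "infinite Z"
  shows "\<exists>\<delta> :: ('z \<Rightarrow> 'a) \<Rightarrow> 'a. (\<forall>f g. \<delta> (f + g) = \<delta> f + \<delta> g) \<and> (\<forall>k f. \<delta> (fscale k f) = k * \<delta> f) \<and>
    (\<forall>f. (\<forall>g\<in>Z. f g = 0) \<longrightarrow> \<delta> f = 0) \<and> (\<forall>k. \<delta> (\<lambda>_. k) = 0) \<and>
    (\<forall>f g. regular_on Z C f \<longrightarrow> regular_on Z C g \<longrightarrow> \<delta> (f * g) = f e * \<delta> g + g e * \<delta> f) \<and>
    (\<exists>c\<in>C. \<delta> c \<noteq> 0)"
proof -
  define R where "R = {u. regular_on Z C u \<and> u e = 0}"
  define N where "N = {u :: 'z \<Rightarrow> 'a. \<forall>g\<in>Z. u g = 0}"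
  \<comment> \<open>The products span the square of the maximal ideal \<open>R\<close> of
    \<open>e\<close>. The set \<open>N\<close> is added because \<open>\<delta>\<close> will be
    defined on all functions and must not see values outside \<open>Z\<close>.\<close>
  define M where "M = {u * v | u v. u \<in> R \<and> v \<in> R} \<union> N"
  have Me: "f e = 0" if "f \<in> fv.span M" for f
    using that
  proof (induction rule: fv.span_induct_alt)
    case (step c x y)
    have "x e = 0" using step.hyps \<open>e \<in> Z\<close> by (auto simp: M_def R_def N_def)
    then show ?case using step.IH by (simp add: fscale_apply)
  qed simp
  \<comment> \<open>One factor of a product \<open>u * v\<close> is expanded in the differences
    \<open>d g - d e\<close>, the other supplies coefficients that vanish at \<open>e\<close>. This
    is the form in which elimination applies.\<close>
  have Mrep: "\<exists>p. (\<forall>d\<in>C. regular_on Z C (p d) \<and> p d e = 0) \<and>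
      (\<forall>g\<in>Z. f g = (\<Sum>d\<in>C. p d g * (d g - d e)))" if "f \<in> fv.span M" for f
    using that
  proof (induction rule: fv.span_induct_alt)
    case base
    show ?case by (intro exI[of _ "\<lambda>_ _. 0"]) auto
  next
    case (step c x y)
    obtain q where q: "\<forall>d\<in>C. regular_on Z C (q d) \<and> q d e = 0"
      "\<forall>g\<in>Z. y g = (\<Sum>d\<in>C. q d g * (d g - d e))" using step.IH by blast
    have "\<exists>p. (\<forall>d\<in>C. regular_on Z C (p d) \<and> p d e = 0) \<and>
      (\<forall>g\<in>Z. x g = (\<Sum>d\<in>C. p d g * (d g - d e)))"
    proof (cases "x \<in> N")
      case True
      then show ?thesis by (intro exI[of _ "\<lambda>_ _. 0"]) (auto simp: N_def)
    next
      case False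
      then obtain u v where uv: "x = u * v" "u \<in> R" "v \<in> R"
        using step.hyps unfolding M_def by auto
      obtain v' where v': "v' \<in> fun_algebra C" "\<forall>g\<in>Z. v g = v' g"
        using uv(3) unfolding R_def regular_on_def by blast
      obtain p where p: "\<forall>d\<in>C. regular_on Z C (p d)"
        "\<forall>g. v' g - v' e = (\<Sum>d\<in>C. p d g * (d g - d e))"
        using fun_algebra_difference[OF assms(1) v'(1), of Z e] by blast
      have "v' e = 0" using v'(2) uv(3) \<open>e \<in> Z\<close> by (auto simp: R_def)
      then have "x g = (\<Sum>d\<in>C. (u g * p d g) * (d g - d e))" if "g \<in> Z" for g
        using p(2)[rule_format, of g] v'(2) that
        by (simp add: uv(1) sum_distrib_left mult.assoc)
      then show ?thesis using uv(2) p(1)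
        by (intro exI[of _ "\<lambda>d g. u g * p d g"]) (auto simp: R_def intro: regular_on_mult)
    qed
    then obtain p where p: "\<forall>d\<in>C. regular_on Z C (p d) \<and> p d e = 0"
      "\<forall>g\<in>Z. x g = (\<Sum>d\<in>C. p d g * (d g - d e))" by blast
    have "(fscale c x + y) g = (\<Sum>d\<in>C. (c * p d g + q d g) * (d g - d e))" if "g \<in> Z" for g
      using p(2)[rule_format, OF that] q(2)[rule_format, OF that]
      by (simp add: fscale_apply sum_distrib_left distrib_right sum.distrib mult.assoc)
    then show ?case using p(1) q(1)
      by (intro exI[of _ "\<lambda>d g. c * p d g + q d g"]) (auto intro!: regular_on_add regular_on_scale)
  qed
  have "\<exists>c\<in>C. (\<lambda>g. c g - c e) \<notin> fv.span M"
  proof (rule ccontr)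
    assume "\<not> ?thesis"
    then have all: "(\<lambda>g. c g - c e) \<in> fv.span M" if "c \<in> C" for c using that by blast
    have "\<exists>h. regular_on Z C h \<and> h e = 1 \<and> (\<forall>c\<in>C. \<forall>g\<in>Z. h g * (c g - c e) = 0)"
    proof (rule nakayama_elimination[OF assms(1)])
      fix c assume "c \<in> C"
      from Mrep[OF all[OF this]] obtain p where "(\<forall>d\<in>C. regular_on Z C (p d) \<and> p d e = 0) \<and>
      (\<forall>g\<in>Z. c g - c e = (\<Sum>d\<in>C. p d g * (d g - d e)))" by blast
      then show "\<exists>u p. regular_on Z C u \<and> u e = 1 \<and> (\<forall>j\<in>C. regular_on Z C (p j) \<and> p j e = 0) \<and>
        (\<forall>g\<in>Z. u g * (c g - c e) = (\<Sum>j\<in>C. p j g * (j g - j e)))"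
        by (intro exI[of _ "\<lambda>_. 1"] exI[of _ p]) auto
    qed
    then obtain h where h: "regular_on Z C h" "h e = 1" "\<And>c g. c \<in> C \<Longrightarrow> g \<in> Z \<Longrightarrow> h g * (c g - c e) = 0"
      by blast
    have "finite Z"
    proof (rule finite_if_isolated_point[OF assms(1) h(1) _ _ transl])
      show "h g = 0" if g: "g \<in> Z" "g \<noteq> e" for g
      proof -
        obtain c where "c \<in> C" "c g \<noteq> c e" using sep[OF g(1)] g(2) by blast
        then show ?thesis using h(3)[OF _ g(1), of c] by simp
      qed
    qed (use h(2) in simp_all)
    with infinite show False by blast
  qed
  then obtain c where c: "c \<in> C" "(\<lambda>g. c g - c e) \<notin> fv.span M" by blast
  define z where "z = (\<lambda>g. c g - c e)"
  define one where "one = (\<lambda>_::'z. 1::'a)"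
  \<comment> \<open>Evaluation at \<open>e\<close> vanishes on \<open>z\<close> and on
    \<open>M\<close> but not on the constant 1, so adjoining constants cannot bring \<open>z\<close>
    into the span.\<close>
  have zM: "z \<notin> fv.span (insert one M)"
  proof
    assume "z \<in> fv.span (insert one M)"
    then obtain k where k: "z - fscale k one \<in> fv.span M"
      using fv.span_breakdown_eq by blast
    from Me[OF this] have "k = 0" by (simp add: z_def one_def fscale_apply diff_fun_apply)
    with k have "z \<in> fv.span M" by (simp only: fv.scale_zero_left diff_zero)
    with c(2) show False by (simp only: z_def)
  qed
  obtain B where B: "B \<subseteq> insert one M" "fv.independent B" "insert one M \<subseteq> fv.span B"
    by (rule fv.maximal_independent_subset)
  have "z \<notin> fv.span B" using zM B(1) fv.span_mono by blast
  then have "fv.independent (insert z B)" using B(2) by (rule fv.independent_insertI)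
  from ex_linear_functional[OF this, of "\<lambda>b. if b = z then 1 else 0"] obtain \<delta> where
    d: "\<forall>f g. \<delta> (f + g) = \<delta> f + \<delta> g" "\<forall>k f. \<delta> (fscale k f) = k * \<delta> f"
      "\<forall>b\<in>insert z B. \<delta> b = (if b = z then 1 else 0)" by blast
  have \<delta>: "\<And>f g. \<delta> (f + g) = \<delta> f + \<delta> g" "\<And>k f. \<delta> (fscale k f) = k * \<delta> f"
      "\<delta> z = 1" "\<And>b. b \<in> B \<Longrightarrow> b \<noteq> z \<Longrightarrow> \<delta> b = 0" using d by simp_all
  have \<delta>0: "\<delta> 0 = 0" using \<delta>(2)[of 0 0] by simp
  have spanB: "\<delta> f = 0" if "f \<in> fv.span B" for f
    using that
  proof (induction rule: fv.span_induct_alt)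
    case (step k x y)
    have "x \<noteq> z" using step.hyps \<open>z \<notin> fv.span B\<close> fv.span_base by blast
    then show "\<delta> (fscale k x + y) = 0" by (simp only: step \<delta> not_False_eq_True mult_zero_right add_0_right)
  qed (rule \<delta>0)
  have one: "\<delta> (\<lambda>_. k) = 0" for k
  proof -
    have "(\<lambda>_. k) = fscale k one" by (auto simp: one_def fscale_apply)
    moreover have "\<delta> one = 0" using spanB B(3) by blast
    ultimately show ?thesis by (simp only: \<delta>(2) mult_zero_right)
  qed
  have leibniz: "\<delta> (f * g) = f e * \<delta> g + g e * \<delta> f" if "regular_on Z C f" "regular_on Z C g" for f g
  proof -
    \<comment> \<open>Subtracting the values at \<open>e\<close> puts both factors into
      \<open>R\<close>; their product lies in \<open>M\<close>, where \<open>\<delta>\<close>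
      vanishes, and expanding it gives the product rule.\<close>
    define f' g' where "f' = (\<lambda>x. f x - f e)" and "g' = (\<lambda>x. g x - g e)"
    have "f' \<in> R" "g' \<in> R"
      unfolding R_def f'_def g'_def using that by (auto intro!: regular_on_diff)
    then have "f' * g' \<in> M" unfolding M_def by blast
    then have 0: "\<delta> (f' * g') = 0" using B(3) spanB by auto
    have "f * g = f' * g' + (fscale (f e) g + (fscale (g e) f + (\<lambda>_. - (f e * g e))))"
      by (auto simp: fun_eq_iff f'_def g'_def fscale_apply algebra_simps)
    then show ?thesis by (simp only: \<delta> 0 one) simp
  qed
  have "z = c + (\<lambda>_. - c e)" by (auto simp: z_def)
  then have "\<delta> z = \<delta> c + \<delta> (\<lambda>_. - c e)" using \<delta>(1) by (simp only:)
  then have "\<delta> c = 1" by (simp only: one \<delta>(3) add_0_right)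
  have N: "\<delta> f = 0" if "\<And>g. g \<in> Z \<Longrightarrow> f g = 0" for f
  proof -
    have "f \<in> insert one M" using that unfolding M_def N_def by blast
    then show ?thesis using spanB B(3) by blast
  qed
  have "\<delta> c \<noteq> 0" by (simp only: \<open>\<delta> c = 1\<close> one_neq_zero not_False_eq_True)
  show ?thesis
  proof (intro exI[of _ \<delta>] conjI allI impI)
    show "\<delta> (f + g) = \<delta> f + \<delta> g" for f g by (rule \<delta>(1))
    show "\<delta> (fscale k f) = k * \<delta> f" for k f by (rule \<delta>(2))
    show "\<delta> f = 0" if "\<forall>g\<in>Z. f g = 0" for f using that by (intro N) blast
    show "\<delta> (\<lambda>_. k) = 0" for k by (rule one)
    show "\<delta> (f * g) = f e * \<delta> g + g e * \<delta> f" if "regular_on Z C f" "regular_on Z C g" for f g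
      using that by (rule leibniz)
    show "\<exists>c\<in>C. \<delta> c \<noteq> 0" using \<open>\<delta> c \<noteq> 0\<close> c(1) by (rule bexI)
  qed
qed

section \<open>The coordinate ring\<close>

text \<open>
  Functions are extended by zero outside \<open>X\<close>: unlike extensional functions, they are closed under the
  pointwise operations on the function type.
\<close>

definition regular_ring :: "('a::field ^ 'n) set \<Rightarrow> ('a ^ 'n \<Rightarrow> 'a) set" where
  "regular_ring X = {f. regular_on X affine_coords f \<and> (\<forall>x. x \<notin> X \<longrightarrow> f x = 0)}"

definition coord_fun :: "('a::field ^ 'n) set \<Rightarrow> 'n \<Rightarrow> 'a ^ 'n \<Rightarrow> 'a" where
  "coord_fun X i = (\<lambda>x. if x \<in> X then x $ i else 0)"

lemma regular_ring_off: "f \<in> regular_ring X \<Longrightarrow> x \<notin> X \<Longrightarrow> f x = 0"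
  by (simp add: regular_ring_def)

lemma regular_ring_eqI:
  "f \<in> regular_ring X \<Longrightarrow> g \<in> regular_ring X \<Longrightarrow> (\<And>x. x \<in> X \<Longrightarrow> f x = g x) \<Longrightarrow> f = g"
  unfolding regular_ring_def fun_eq_iff by (metis (mono_tags, lifting) mem_Collect_eq)

lemma regular_ring_regular: "f \<in> regular_ring X \<Longrightarrow> regular_on X affine_coords f"
  by (simp add: regular_ring_def)

lemma regular_ringI: 
  assumes "regular_on X affine_coords p" "\<And>x. x \<in> X \<Longrightarrow> f x = p x" "\<And>x. x \<notin> X \<Longrightarrow> f x = 0"
  shows "f \<in> regular_ring X"
  unfolding regular_ring_def using assms(3) regular_on_cong[OF _ assms(1), of f] assms(2) by simp

lemma regular_ring_add: "f \<in> regular_ring X \<Longrightarrow> g \<in> regular_ring X \<Longrightarrow> f + g \<in> regular_ring X"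
  by (rule regular_ringI[of _ "\<lambda>x. f x + g x"]) (auto simp: regular_ring_def intro: regular_on_add)

lemma regular_ring_mult: "f \<in> regular_ring X \<Longrightarrow> g \<in> regular_ring X \<Longrightarrow> f * g \<in> regular_ring X"
  by (rule regular_ringI[of _ "\<lambda>x. f x * g x"]) (auto simp: regular_ring_def intro: regular_on_mult)

lemma regular_ring_scale: "f \<in> regular_ring X \<Longrightarrow> fscale c f \<in> regular_ring X"
  by (rule regular_ringI[of _ "\<lambda>x. c * f x"]) (auto simp: regular_ring_def fscale_apply intro: regular_on_scale)

lemma zero_regular_ring: "0 \<in> regular_ring X"
  by (rule regular_ringI[of _ "\<lambda>x. 0"]) auto

lemma cind_regular_ring: "cind X \<in> regular_ring X"
  by (rule regular_ringI[of _ "\<lambda>x. 1"]) (auto simp: cind_def)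

lemma subspace_regular_ring: "fv.subspace (regular_ring X)"
  by (intro fv.subspaceI zero_regular_ring regular_ring_add regular_ring_scale)

lemma coord_fun_regular_ring: "coord_fun X i \<in> regular_ring X"
  by (rule regular_ringI[of _ "\<lambda>x. x $ i"])
    (auto simp: coord_fun_def affine_coords_def intro: regular_on_generator)

lemma cind_mult: "f \<in> regular_ring X \<Longrightarrow> cind X * f = f"
  by (rule ext) (auto simp: cind_def regular_ring_off)

lemma cind_times_regular_ring: "regular_on X affine_coords p \<Longrightarrow> cind X * p \<in> regular_ring X"
  by (rule regular_ringI[of X p]) (auto simp: cind_def)

section \<open>Algebra endomorphisms and the self-maps of the variety dual to them\<close>

definition algebra_endo :: "('a::field ^ 'n) set \<Rightarrow> (('a ^ 'n \<Rightarrow> 'a) \<Rightarrow> 'a ^ 'n \<Rightarrow> 'a) \<Rightarrow> bool" where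
  "algebra_endo X \<psi> \<longleftrightarrow>
     (\<forall>f\<in>regular_ring X. \<psi> f \<in> regular_ring X) \<and> \<psi> (cind X) = cind X \<and>
     (\<forall>f\<in>regular_ring X. \<forall>g\<in>regular_ring X. \<psi> (f + g) = \<psi> f + \<psi> g \<and> \<psi> (f * g) = \<psi> f * \<psi> g) \<and>
     (\<forall>c. \<forall>f\<in>regular_ring X. \<psi> (fscale c f) = fscale c (\<psi> f))"

definition dual_map :: "('a::field ^ 'n) set \<Rightarrow> (('a ^ 'n \<Rightarrow> 'a) \<Rightarrow> 'a ^ 'n \<Rightarrow> 'a) \<Rightarrow> 'a ^ 'n \<Rightarrow> 'a ^ 'n" where
  "dual_map X \<psi> = (\<lambda>x\<in>X. \<chi> i. \<psi> (coord_fun X i) x)"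

text \<open>The coordinates of the dual point are the values of \<open>\<psi>\<close> on the
  coordinate functions, and both sides are compatible with sums and products, so the identity
  spreads to all polynomials.\<close>

lemma dual_map_polynomial:
  assumes "algebra_endo X \<psi>" "x \<in> X" "p \<in> fun_algebra affine_coords"
  shows "p (dual_map X \<psi> x) = \<psi> (cind X * p) x"
  using assms(3)
proof induction
  case (const c)
  have "\<psi> (fscale c (cind X)) = fscale c (cind X)"
    using assms(1) cind_regular_ring[of X] by (simp add: algebra_endo_def)
  moreover have "cind X * (\<lambda>_. c) = fscale c (cind X)" by (auto simp: fun_eq_iff fscale_apply)
  ultimately have "\<psi> (cind X * (\<lambda>_. c)) = fscale c (cind X)" by (simp only:)
  then have "\<psi> (cind X * (\<lambda>_. c)) x = c" using assms(2) by (simp only: fscale_apply) (simp add: cind_def)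
  then show ?case by (rule sym)
next
  case (generator g)
  then obtain i where g: "g = (\<lambda>x. x $ i)" by (auto simp: affine_coords_def)
  then have "cind X * g = coord_fun X i" by (auto simp: fun_eq_iff cind_def coord_fun_def)
  then show ?case using assms(2) by (simp add: dual_map_def g)
next
  case (add f g)
  have eq: "cind X * (\<lambda>z. f z + g z) = cind X * f + cind X * g"
    by (auto simp: fun_eq_iff algebra_simps)
  have "cind X * f \<in> regular_ring X" "cind X * g \<in> regular_ring X"
    using add.hyps by (simp_all add: cind_times_regular_ring regular_on_algebra)
  then have "\<psi> (cind X * (\<lambda>z. f z + g z)) = \<psi> (cind X * f) + \<psi> (cind X * g)"
    unfolding eq using assms(1) by (simp add: algebra_endo_def)
  then have "\<psi> (cind X * (\<lambda>z. f z + g z)) x = \<psi> (cind X * f) x + \<psi> (cind X * g) x"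
    by (simp only: plus_fun_apply)
  then show ?case by (simp only: add.IH)
next
  case (mult f g)
  have eq: "cind X * (\<lambda>z. f z * g z) = (cind X * f) * (cind X * g)"
    by (auto simp: fun_eq_iff cind_def)
  have "cind X * f \<in> regular_ring X" "cind X * g \<in> regular_ring X"
    using mult.hyps by (simp_all add: cind_times_regular_ring regular_on_algebra)
  then have "\<psi> (cind X * (\<lambda>z. f z * g z)) = \<psi> (cind X * f) * \<psi> (cind X * g)"
    unfolding eq using assms(1) by (simp add: algebra_endo_def)
  then have "\<psi> (cind X * (\<lambda>z. f z * g z)) x = \<psi> (cind X * f) x * \<psi> (cind X * g) x"
    by (simp only: times_fun_apply)
  then show ?case by (simp only: mult.IH)
qed

text \<open>A defining equation of \<open>X\<close> is the zero element of the ring, which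
  \<open>\<psi>\<close> preserves; hence the dual point satisfies it.\<close>

lemma dual_map_mem:
  assumes "zariski_closed X" "algebra_endo X \<psi>" "x \<in> X"
  shows "dual_map X \<psi> x \<in> X"
proof -
  obtain P where P: "P \<subseteq> fun_algebra affine_coords" "X = {x. \<forall>p\<in>P. p x = 0}"
    using assms(1) unfolding zariski_closed_def by blast
  have "\<psi> 0 = 0"
    using assms(2) zero_regular_ring[of X] fv.scale_zero_left unfolding algebra_endo_def by metis
  have "p (dual_map X \<psi> x) = 0" if "p \<in> P" for p
  proof -
    have "cind X * p = 0" using that P(2) by (auto simp: fun_eq_iff cind_def)
    then show ?thesis using dual_map_polynomial[OF assms(2,3), of p] that P(1) \<open>\<psi> 0 = 0\<close> by (auto simp del: zero_fun_apply simp: subset_iff) simp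
  qed
  then show ?thesis by (subst P(2)) simp
qed

lemma dual_map_apply:
  assumes "zariski_closed X" "algebra_endo X \<psi>" "x \<in> X" "f \<in> regular_ring X"
  shows "f (dual_map X \<psi> x) = \<psi> f x"
proof -
  obtain p where p: "p \<in> fun_algebra affine_coords" "\<forall>x\<in>X. f x = p x"
    using assms(4) unfolding regular_ring_def regular_on_def by blast
  have f: "cind X * p = f"
    using p(2) assms(4) by (auto simp: fun_eq_iff cind_def regular_ring_off)
  have "f (dual_map X \<psi> x) = p (dual_map X \<psi> x)"
    using p(2) dual_map_mem[OF assms(1-3)] by blast
  then show ?thesis
    unfolding dual_map_polynomial[OF assms(2,3) p(1)] f .
qed

lemma coord_fun_apply: "x \<in> X \<Longrightarrow> coord_fun X i x = x $ i"
  by (simp add: coord_fun_def)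

text \<open>Duality is contravariant, so the endomorphisms are applied in the opposite order. Only
  the values of \<open>\<theta>\<close> on the ring enter.\<close>

lemma dual_map_compose:
  assumes X: "zariski_closed X" and \<psi>: "algebra_endo X \<psi>" "algebra_endo X \<psi>'"
    and \<theta>: "\<And>f. f \<in> regular_ring X \<Longrightarrow> \<theta> f = \<psi>' (\<psi> f)"
  shows "compose X (dual_map X \<psi>) (dual_map X \<psi>') = dual_map X \<theta>"
proof (rule ext)
  fix x
  show "compose X (dual_map X \<psi>) (dual_map X \<psi>') x = dual_map X \<theta> x"
  proof (cases "x \<in> X")
    case True
    have m: "dual_map X \<psi>' x \<in> X" by (rule dual_map_mem[OF X \<psi>(2) True])
    have "dual_map X \<psi> (dual_map X \<psi>' x) $ i = dual_map X \<theta> x $ i" for i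
    proof -
      have "dual_map X \<psi> (dual_map X \<psi>' x) $ i = \<psi> (coord_fun X i) (dual_map X \<psi>' x)"
        using m by (simp add: dual_map_def)
      also have "\<dots> = \<psi>' (\<psi> (coord_fun X i)) x"
        by (rule dual_map_apply[OF X \<psi>(2) True]) (use \<psi>(1) coord_fun_regular_ring in \<open>auto simp: algebra_endo_def\<close>)
      also have "\<dots> = dual_map X \<theta> x $ i"
        using True by (simp add: dual_map_def \<theta>[OF coord_fun_regular_ring])
      finally show ?thesis .
    qed
    then show ?thesis using True by (simp add: compose_def Finite_Cartesian_Product.vec_eq_iff)
  qed (simp add: compose_def dual_map_def)
qed

lemma dual_map_id:
  assumes "\<And>f. f \<in> regular_ring X \<Longrightarrow> \<psi> f = f"
  shows "dual_map X \<psi> = (\<lambda>x\<in>X. x)"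
  by (rule ext) (simp add: dual_map_def assms[OF coord_fun_regular_ring] coord_fun_apply Finite_Cartesian_Product.vec_eq_iff restrict_def)

lemma regular_map_dual_map:
  assumes "zariski_closed X" "algebra_endo X \<psi>"
  shows "regular_map X affine_coords X (dual_map X \<psi>)"
  unfolding regular_map_iff
proof (intro conjI allI)
  fix i
  have "\<psi> (coord_fun X i) \<in> regular_ring X"
    using assms(2) coord_fun_regular_ring unfolding algebra_endo_def by blast
  then show "regular_on X affine_coords (\<lambda>z. dual_map X \<psi> z $ i)"
    by (rule regular_on_cong[OF _ regular_ring_regular, rotated]) (simp add: dual_map_def)
qed (use dual_map_mem[OF assms] in auto)

lemma bij_betw_of_compose:
  assumes "f \<in> X \<rightarrow> X" "g \<in> X \<rightarrow> X" "compose X g f = (\<lambda>x\<in>X. x)" "compose X f g = (\<lambda>x\<in>X. x)"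
  shows "bij_betw f X X" "\<And>x. x \<in> X \<Longrightarrow> inv_into X f x = g x"
proof -
  have gf: "g (f x) = x" "f (g x) = x" if "x \<in> X" for x
    using fun_cong[OF assms(3), of x] fun_cong[OF assms(4), of x] that by (simp_all add: compose_def)
  show "bij_betw f X X"
    by (rule bij_betw_byWitness[of _ g]) (use gf assms(1,2) in auto)
  then show "inv_into X f x = g x" if "x \<in> X" for x
    using gf that assms(2) by (metis PiE bij_betw_inv_into_left)
qed

lemma dual_map_automorphism:
  assumes X: "zariski_closed X" and \<psi>: "algebra_endo X \<psi>" "algebra_endo X \<psi>'"
    and inv: "\<And>f. f \<in> regular_ring X \<Longrightarrow> \<psi>' (\<psi> f) = f" "\<And>f. f \<in> regular_ring X \<Longrightarrow> \<psi> (\<psi>' f) = f"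
  shows "dual_map X \<psi> \<in> automorphisms X"
proof -
  have c: "compose X (dual_map X \<psi>) (dual_map X \<psi>') = (\<lambda>x\<in>X. x)"
    "compose X (dual_map X \<psi>') (dual_map X \<psi>) = (\<lambda>x\<in>X. x)"
    using dual_map_compose[OF X \<psi>, of id] dual_map_compose[OF X \<psi>(2,1), of id] inv dual_map_id[of X id]
    by simp_all
  have m: "dual_map X \<psi> \<in> X \<rightarrow> X" "dual_map X \<psi>' \<in> X \<rightarrow> X"
    using dual_map_mem[OF X \<psi>(1)] dual_map_mem[OF X \<psi>(2)] by auto
  note b = bij_betw_of_compose[OF m c(2,1)]
  have "dual_map X \<psi> \<in> extensional X" by (simp add: dual_map_def)
  moreover have "regular_map X affine_coords X (inv_into X (dual_map X \<psi>))"
    by (rule regular_map_cong[OF _ regular_map_dual_map[OF X \<psi>(2)]]) (simp add: b(2))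
  ultimately show ?thesis
    using b(1) regular_map_dual_map[OF X \<psi>(1)] by (simp add: automorphisms_def Bij_def)
qed

subsection \<open>Locally nilpotent derivations\<close>

definition derivation_on :: "('a::field ^ 'n) set \<Rightarrow> (('a ^ 'n \<Rightarrow> 'a) \<Rightarrow> 'a ^ 'n \<Rightarrow> 'a) \<Rightarrow> bool" where
  "derivation_on X D \<longleftrightarrow>
     (\<forall>f\<in>regular_ring X. D f \<in> regular_ring X) \<and>
     (\<forall>f\<in>regular_ring X. \<forall>g\<in>regular_ring X. D (f + g) = D f + D g \<and> D (f * g) = D f * g + f * D g) \<and>
     (\<forall>c. \<forall>f\<in>regular_ring X. D (fscale c f) = fscale c (D f))"

locale nilpotent_derivation =
  fixes X :: "('a::field_char_0 ^ 'n) set" and N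
  assumes closed: "zariski_closed X"
    and derivation: "derivation_on X N"
    and nilpotent: "\<And>f. f \<in> regular_ring X \<Longrightarrow> \<exists>k. (N ^^ k) f = 0"
begin

lemma N_mem: "f \<in> regular_ring X \<Longrightarrow> N f \<in> regular_ring X"
  and N_add: "f \<in> regular_ring X \<Longrightarrow> g \<in> regular_ring X \<Longrightarrow> N (f + g) = N f + N g"
  and N_mult: "f \<in> regular_ring X \<Longrightarrow> g \<in> regular_ring X \<Longrightarrow> N (f * g) = N f * g + f * N g"
  and N_scale: "f \<in> regular_ring X \<Longrightarrow> N (fscale c f) = fscale c (N f)"
  using derivation unfolding derivation_on_def by blast+

lemma pow_mem: "f \<in> regular_ring X \<Longrightarrow> (N ^^ k) f \<in> regular_ring X"
  by (induction k) (auto intro: N_mem)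

lemma pow_add: "f \<in> regular_ring X \<Longrightarrow> g \<in> regular_ring X \<Longrightarrow> (N ^^ k) (f + g) = (N ^^ k) f + (N ^^ k) g"
  by (induction k) (auto simp: N_add pow_mem)

lemma pow_scale: "f \<in> regular_ring X \<Longrightarrow> (N ^^ k) (fscale c f) = fscale c ((N ^^ k) f)"
  by (induction k) (auto simp: N_scale pow_mem)

lemma N_zero: "N 0 = 0"
  using N_scale[OF zero_regular_ring, of 0] by (simp only: fv.scale_zero_left)

lemma pow_zero: "(N ^^ k) 0 = 0"
  using pow_scale[OF zero_regular_ring, of k 0] by (simp only: fv.scale_zero_left)

lemma N_cind: "N (cind X) = 0"
proof -
  have "N (cind X * cind X) = N (cind X) * cind X + cind X * N (cind X)"
    by (rule N_mult) (rule cind_regular_ring)+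
  then have "N (cind X) = N (cind X) + N (cind X)"
    using cind_mult[OF cind_regular_ring, of X] cind_mult[OF N_mem[OF cind_regular_ring]]
    by (simp add: mult.commute)
  then show ?thesis by (metis add_cancel_right_right)
qed

text \<open>The coefficient of \<open>c ^ k\<close> in the value at \<open>x\<close> of the
  exponential of \<open>c\<close> times \<open>N\<close>, applied to \<open>f\<close>.\<close>

definition term_coeff :: "('a ^ 'n \<Rightarrow> 'a) \<Rightarrow> 'a ^ 'n \<Rightarrow> nat \<Rightarrow> 'a" where
  "term_coeff f x k = (N ^^ k) f x / fact k"

text \<open>The Leibniz rule for divided powers, by induction on \<open>k\<close>. Applying
  \<open>N\<close> to the identity for \<open>k\<close> produces the factor \<open>k + 1\<close> on
  both sides, which cancels in characteristic zero.\<close>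

lemma term_coeff_mult:
  assumes "f \<in> regular_ring X" "g \<in> regular_ring X"
  shows "term_coeff (f * g) x k = (\<Sum>i\<le>k. term_coeff f x i * term_coeff g x (k - i))"
proof -
  define a where "a h i = fscale (1 / fact i) ((N ^^ i) h)" for h and i :: nat
  have aA: "a h i \<in> regular_ring X" if "h \<in> regular_ring X" for h i
    unfolding a_def using that by (intro regular_ring_scale pow_mem)
  have aN: "N (a h i) = fscale (of_nat (Suc i)) (a h (Suc i))" if "h \<in> regular_ring X" for h i
    unfolding a_def using that by (simp add: N_scale pow_mem fact_Suc field_simps del: of_nat_Suc)
  have "a (f * g) k = (\<Sum>i\<le>k. a f i * a g (k - i))"
  proof (induction k)
    case 0
    show ?case by (simp add: a_def)
  next
    case (Suc k)
    have sumN: "N (\<Sum>i\<in>I. h i) = (\<Sum>i\<in>I. N (h i)) \<and> (\<Sum>i\<in>I. h i) \<in> regular_ring X"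
      if "\<And>i. i \<in> I \<Longrightarrow> h i \<in> regular_ring X" "finite I" for I :: "nat set" and h
      using that(2,1) by (induction I rule: finite_induct) (auto simp: N_zero N_add zero_regular_ring regular_ring_add)
    have "fscale (of_nat (Suc k)) (a (f * g) (Suc k)) = N (a (f * g) k)"
      by (rule aN[symmetric]) (intro regular_ring_mult assms)
    also have "\<dots> = (\<Sum>i\<le>k. N (a f i * a g (k - i)))"
      unfolding Suc.IH using sumN[of "{..k}" "\<lambda>i. a f i * a g (k - i)"] by (auto intro: regular_ring_mult aA assms)
    also have "\<dots> = (\<Sum>i\<le>k. N (a f i) * a g (k - i) + a f i * N (a g (k - i)))"
      by (intro sum.cong refl N_mult aA assms)
    also have "\<dots> = (\<Sum>i\<le>k. fscale (of_nat (Suc i)) (a f (Suc i) * a g (k - i))) +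
        (\<Sum>i\<le>k. fscale (of_nat (Suc k - i)) (a f i * a g (Suc k - i)))"
      unfolding sum.distrib[symmetric]
    proof (intro sum.cong refl)
      fix i assume "i \<in> {..k}"
      then have "Suc (k - i) = Suc k - i" by auto
      then show "N (a f i) * a g (k - i) + a f i * N (a g (k - i)) =
         fscale (of_nat (Suc i)) (a f (Suc i) * a g (k - i)) + fscale (of_nat (Suc k - i)) (a f i * a g (Suc k - i))"
        using aN[OF assms(1)] aN[OF assms(2)] by (simp add: fscale_mult_left fscale_mult_right del: of_nat_Suc)
    qed
    \<comment> \<open>Both sums are extended to \<open>Suc k\<close>: the term that is added carries
      the scalar 0 each time. Afterwards the scalars \<open>i\<close> and \<open>Suc k - i\<close>
      add up to \<open>Suc k\<close>.\<close>
    also have "(\<Sum>i\<le>k. fscale (of_nat (Suc i)) (a f (Suc i) * a g (k - i))) =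
        (\<Sum>i\<le>Suc k. fscale (of_nat i) (a f i * a g (Suc k - i)))"
      by (subst sum.atMost_Suc_shift) simp
    also have "(\<Sum>i\<le>k. fscale (of_nat (Suc k - i)) (a f i * a g (Suc k - i))) =
        (\<Sum>i\<le>Suc k. fscale (of_nat (Suc k - i)) (a f i * a g (Suc k - i)))"
      by simp
    also have "(\<Sum>i\<le>Suc k. fscale (of_nat i) (a f i * a g (Suc k - i))) +
        (\<Sum>i\<le>Suc k. fscale (of_nat (Suc k - i)) (a f i * a g (Suc k - i))) =
        (\<Sum>i\<le>Suc k. fscale (of_nat (Suc k)) (a f i * a g (Suc k - i)))"
      unfolding sum.distrib[symmetric]
    proof (intro sum.cong refl)
      fix i assume "i \<in> {..Suc k}"
      then have "of_nat i + of_nat (Suc k - i) = (of_nat (Suc k) :: 'a)" 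
        unfolding of_nat_add[symmetric] by (intro arg_cong[of _ _ of_nat]) auto
      then show "fscale (of_nat i) (a f i * a g (Suc k - i)) + fscale (of_nat (Suc k - i)) (a f i * a g (Suc k - i)) =
         fscale (of_nat (Suc k)) (a f i * a g (Suc k - i))"
        by (metis fv.scale_left_distrib)
    qed
    also have "\<dots> = fscale (of_nat (Suc k)) (\<Sum>i\<le>Suc k. a f i * a g (Suc k - i))"
      by (rule fv.scale_sum_right[symmetric])
    finally have "a (f * g) (Suc k) = (\<Sum>i\<le>Suc k. a f i * a g (Suc k - i)) \<or> (of_nat (Suc k) :: 'a) = 0"
      by (simp only: fv.scale_cancel_left)
    then show ?case by (simp only: of_nat_eq_0_iff nat.distinct simp_thms)
  qed
  then have "a (f * g) k x = (\<Sum>i\<le>k. a f i x * a g (k - i) x)" by (simp add: sum_fun_apply)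
  then show ?thesis by (simp add: a_def term_coeff_def fscale_apply)
qed

text \<open>Recording the exponential as a polynomial in the time parameter turns its
  multiplicativity into the rule for the coefficients of a product. By \<open>coeff_exp_poly\<close>
  the coefficients do not depend on where the sum is cut off.\<close>

definition exp_poly :: "('a ^ 'n \<Rightarrow> 'a) \<Rightarrow> 'a ^ 'n \<Rightarrow> 'a poly" where
  "exp_poly f x = (\<Sum>k<(LEAST k. (N ^^ k) f = 0). Polynomial.monom (term_coeff f x k) k)"

lemma pow_vanish: 
  assumes "(N ^^ m) f = 0" "m \<le> k" shows "(N ^^ k) f = 0"
proof -
  have "(N ^^ k) f = (N ^^ (k - m)) ((N ^^ m) f)"
    using assms(2) by (simp flip: funpow_add o_apply[of "N ^^ _" "N ^^ _"])
  then show ?thesis unfolding assms(1) pow_zero .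
qed

lemma coeff_exp_poly: 
  assumes "f \<in> regular_ring X" shows "coeff (exp_poly f x) k = term_coeff f x k"
proof -
  let ?m = "LEAST k. (N ^^ k) f = 0"
  have m: "(N ^^ ?m) f = 0" using nilpotent[OF assms] by (rule LeastI_ex)
  have "coeff (exp_poly f x) k = (if k < ?m then term_coeff f x k else 0)"
    by (simp add: exp_poly_def coeff_sum)
  moreover have "term_coeff f x k = 0" if "\<not> k < ?m"
    using pow_vanish[OF m, of k] that by (simp add: term_coeff_def)
  ultimately show ?thesis by simp
qed

definition exp_map :: "'a \<Rightarrow> ('a ^ 'n \<Rightarrow> 'a) \<Rightarrow> 'a ^ 'n \<Rightarrow> 'a" where
  "exp_map c f x = poly (exp_poly f x) c"

lemma exp_map_sum:
  assumes "f \<in> regular_ring X" "(N ^^ m) f = 0"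
  shows "exp_map c f = (\<Sum>k<m. fscale (c ^ k / fact k) ((N ^^ k) f))"
proof (rule ext)
  fix x
  have "exp_poly f x = (\<Sum>k<m. Polynomial.monom (term_coeff f x k) k)"
  proof (rule poly_eqI)
    fix k
    have "term_coeff f x k = 0" if "\<not> k < m"
      using pow_vanish[OF assms(2), of k] that by (simp add: term_coeff_def)
    then show "coeff (exp_poly f x) k = coeff (\<Sum>k<m. Polynomial.monom (term_coeff f x k) k) k"
      by (simp add: coeff_exp_poly[OF assms(1)] coeff_sum)
  qed
  then show "exp_map c f x = (\<Sum>k<m. fscale (c ^ k / fact k) ((N ^^ k) f)) x"
    by (simp add: exp_map_def sum_fun_apply poly_sum poly_monom fscale_apply term_coeff_def mult.commute)
qed

lemma algebra_endo_exp_map: "algebra_endo X (exp_map c)"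
  unfolding algebra_endo_def
proof (intro conjI ballI allI)
  fix f g assume f: "f \<in> regular_ring X" and g: "g \<in> regular_ring X"
  obtain m where "(N ^^ m) f = 0" using nilpotent[OF f] by blast
  from exp_map_sum[OF f this] show "exp_map c f \<in> regular_ring X"
    by (auto intro!: fv.subspace_sum[OF subspace_regular_ring] regular_ring_scale pow_mem f)
  have "exp_poly (f + g) x = exp_poly f x + exp_poly g x" for x
    by (rule poly_eqI)
      (simp add: coeff_exp_poly f g regular_ring_add term_coeff_def pow_add add_divide_distrib)
  then show "exp_map c (f + g) = exp_map c f + exp_map c g"
    by (intro ext) (simp add: exp_map_def)
  have "exp_poly (f * g) x = exp_poly f x * exp_poly g x" for x
    by (rule poly_eqI) 
      (simp add: coeff_mult coeff_exp_poly f g regular_ring_mult term_coeff_mult)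
  then show "exp_map c (f * g) = exp_map c f * exp_map c g"
    by (intro ext) (simp add: exp_map_def)
  have "exp_poly (fscale d f) x = Polynomial.smult d (exp_poly f x)" for x d
    by (rule poly_eqI)
      (simp add: coeff_exp_poly f regular_ring_scale term_coeff_def pow_scale fscale_apply)
  then show "exp_map c (fscale d f) = fscale d (exp_map c f)" for d
    by (intro ext) (simp add: exp_map_def fscale_apply)
next
  have "(N ^^ 1) (cind X) = 0" by (simp add: N_cind)
  from exp_map_sum[OF cind_regular_ring this] show "exp_map c (cind X) = cind X" by simp
qed

lemma exp_map_exp_map:
  assumes f: "f \<in> regular_ring X"
  shows "exp_map c (exp_map d f) = exp_map (c + d) f"
proof (rule ext)
  fix x
  obtain m where m: "(N ^^ m) f = 0" using nilpotent[OF f] by blast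
  have linear: "exp_map c (\<Sum>k\<in>K. h k) = (\<Sum>k\<in>K. exp_map c (h k)) \<and> (\<Sum>k\<in>K. h k) \<in> regular_ring X"
    if "finite K" "\<And>k. k \<in> K \<Longrightarrow> h k \<in> regular_ring X" for K :: "nat set" and h
    using that
  proof (induction K rule: finite_induct)
    case empty
    have "exp_map c 0 = 0" using exp_map_sum[OF zero_regular_ring, of 0 c] by simp
    then show ?case by (simp only: sum.empty zero_regular_ring simp_thms)
  next
    case (insert k K)
    have "h k \<in> regular_ring X" "sum h K \<in> regular_ring X" using insert by auto
    then have "exp_map c (h k + sum h K) = exp_map c (h k) + exp_map c (sum h K) \<and> h k + sum h K \<in> regular_ring X"
      using algebra_endo_exp_map[of c] by (simp add: algebra_endo_def regular_ring_add)
    then show ?case using insert by (simp only: sum.insert insert_iff simp_thms)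
  qed
  have pw: "(N ^^ m) ((N ^^ k) f) = 0" for k
    using pow_vanish[OF m, of "m + k"] by (simp add: funpow_add)
  define F where "F i j = c ^ i / fact i * (d ^ j / fact j) * (N ^^ (i + j)) f x" for i j
  have F0: "F i j = 0" if "\<not> (i < m \<and> j < m)" for i j
    using pow_vanish[OF m, of "i + j"] that by (auto simp: F_def not_less)
  have eq: "exp_map c (exp_map d f) = (\<Sum>j<m. fscale (d ^ j / fact j) (exp_map c ((N ^^ j) f)))"
    unfolding exp_map_sum[OF f m, of d]
    using linear[of "{..<m}" "\<lambda>j. fscale (d ^ j / fact j) ((N ^^ j) f)"] algebra_endo_exp_map[of c]
    by (simp add: algebra_endo_def pow_mem f regular_ring_scale)
  have "exp_map c (exp_map d f) x = (\<Sum>j<m. \<Sum>i<m. F i j)"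
    unfolding eq by (simp add: sum_fun_apply fscale_apply exp_map_sum[OF pow_mem[OF f] pw] F_def sum_distrib_left
        funpow_add mult_ac)
  also have "\<dots> = (\<Sum>i<m. \<Sum>j<m. F i j)" by (rule sum.swap)
  also have "\<dots> = (\<Sum>(i, j)\<in>{..<m} \<times> {..<m}. F i j)" by (rule sum.cartesian_product)
  \<comment> \<open>The triangle contains the square of side \<open>m\<close>, and \<open>F\<close>
    vanishes on the rest; in the triangle the diagonals can be summed by the binomial
    theorem.\<close>
  also have "\<dots> = (\<Sum>(i, j)\<in>{(i, j). i + j < 2 * m}. F i j)"
  proof (rule sum.mono_neutral_left)
    show "finite {(i, j). i + j < 2 * m}"
      by (rule finite_subset[of _ "{..2*m} \<times> {..2*m}"]) auto
  qed (auto intro: F0)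
  also have "\<dots> = (\<Sum>k<2*m. \<Sum>i\<le>k. F i (k - i))"
    by (rule sum.triangle_reindex)
  also have "\<dots> = (\<Sum>k<2*m. (c + d) ^ k / fact k * (N ^^ k) f x)"
  proof (intro sum.cong refl)
    fix k
    have "(\<Sum>i\<le>k. F i (k - i)) = (\<Sum>i\<le>k. of_nat (k choose i) * c ^ i * d ^ (k - i) / fact k * (N ^^ k) f x)"
    proof (intro sum.cong refl)
      fix i assume "i \<in> {..k}"
      then show "F i (k - i) = of_nat (k choose i) * c ^ i * d ^ (k - i) / fact k * (N ^^ k) f x"
        by (simp add: F_def binomial_fact field_simps)
    qed
    also have "\<dots> = (c + d) ^ k / fact k * (N ^^ k) f x"
      by (simp add: binomial_ring sum_distrib_right sum_divide_distrib)
    finally show "(\<Sum>i\<le>k. F i (k - i)) = (c + d) ^ k / fact k * (N ^^ k) f x" .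
  qed
  also have "\<dots> = exp_map (c + d) f x"
    using exp_map_sum[OF f pow_vanish[OF m, of "2 * m"]] by (simp add: sum_fun_apply fscale_apply)
  finally show "exp_map c (exp_map d f) x = exp_map (c + d) f x" .
qed

lemma exp_map_zero: 
  assumes f: "f \<in> regular_ring X" shows "exp_map 0 f = f"
proof -
  have "coeff (exp_poly f x) 0 = f x" for x
    by (simp add: coeff_exp_poly[OF f] term_coeff_def)
  then show ?thesis by (intro ext) (simp add: exp_map_def poly_0_coeff_0)
qed

lemma exp_action: "regular_Ga_action X (\<lambda>c. dual_map X (exp_map c))"
proof -
  have inv: "exp_map (- c) (exp_map c f) = f" "exp_map c (exp_map (- c) f) = f" if "f \<in> regular_ring X" for c f
    using that by (simp_all add: exp_map_exp_map exp_map_zero)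
  have auto: "dual_map X (exp_map c) \<in> Bij X" for c
    using dual_map_automorphism[OF closed algebra_endo_exp_map algebra_endo_exp_map inv(1) inv(2), of c]
    by (simp add: automorphisms_def)
  have "group (Ga :: 'a monoid)"
    by (rule groupI) (auto simp: Ga_def intro: exI[of _ "- _"] add.left_inverse)
  moreover have "(\<lambda>c. dual_map X (exp_map c)) \<in> hom Ga (BijGroup X)"
  proof (rule homI)
    fix c d :: 'a
    \<comment> \<open>Duality reverses the order of composition, which is harmless because addition
      is commutative.\<close>
    show "dual_map X (exp_map (c \<otimes>\<^bsub>Ga\<^esub> d)) = dual_map X (exp_map c) \<otimes>\<^bsub>BijGroup X\<^esub> dual_map X (exp_map d)"
      using dual_map_compose[OF closed algebra_endo_exp_map algebra_endo_exp_map, of "exp_map (c + d)" d c] auto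
      by (simp add: BijGroup_def Ga_def exp_map_exp_map add.commute)
  qed (use auto in \<open>simp add: BijGroup_def\<close>)
  ultimately have "group_action Ga X (\<lambda>c. dual_map X (exp_map c))"
    by (simp add: group_action_def group_hom_def group_hom_axioms_def group_BijGroup)
  moreover have "regular_map (UNIV \<times> X) (prod_coords {\<lambda>a. a} affine_coords) X (\<lambda>(a, x). dual_map X (exp_map a) x)"
    unfolding regular_map_iff
  proof (intro conjI allI)
    show "(\<lambda>(a, x). dual_map X (exp_map a) x) \<in> UNIV \<times> X \<rightarrow> X"
      using dual_map_mem[OF closed algebra_endo_exp_map] by auto
    fix i
    let ?G = "prod_coords {\<lambda>a. a} affine_coords :: ('a \<times> ('a ^ 'n) \<Rightarrow> 'a) set"
    obtain m where m: "(N ^^ m) (coord_fun X i) = 0"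
      using nilpotent[OF coord_fun_regular_ring] by blast
    have "regular_on (UNIV \<times> X) ?G (\<lambda>z. \<Sum>k<m. fst z ^ k / fact k * (N ^^ k) (coord_fun X i) (snd z))"
    proof (intro regular_on_sum regular_on_mult)
      fix k
      have "fst \<in> ?G" by (force simp: prod_coords_def o_def)
      then show "regular_on (UNIV \<times> X) ?G (\<lambda>z. fst z ^ k / fact k)"
        using regular_on_scale[OF regular_on_power[OF regular_on_generator], of fst ?G "UNIV \<times> X" "1 / fact k" k] by simp
      show "regular_on (UNIV \<times> X) ?G (\<lambda>z. (N ^^ k) (coord_fun X i) (snd z))"
        by (rule regular_on_comp[OF regular_ring_regular[OF pow_mem[OF coord_fun_regular_ring]]])
          (auto simp: prod_coords_def o_def image_iff intro!: regular_on_generator)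
    qed
    then show "regular_on (UNIV \<times> X) ?G (\<lambda>z. (case z of (a, x) \<Rightarrow> dual_map X (exp_map a) x) $ i)"
      by (rule regular_on_cong[rotated])
        (auto simp: dual_map_def exp_map_sum[OF coord_fun_regular_ring m] sum_fun_apply fscale_apply)
  qed
  ultimately show ?thesis by (simp add: regular_Ga_action_def)
qed

text \<open>Triviality of the exponential action makes \<open>exp_poly f x\<close> constant on an
  infinite field, hence a constant polynomial; its linear coefficient is
  \<open>N f x\<close>.\<close>

lemma rigid_imp_zero:
  assumes "rigid X" and f: "f \<in> regular_ring X"
  shows "N f = 0"
proof (rule ext)
  fix x
  show "N f x = 0 x"
  proof (cases "x \<in> X")
    case True
    have "poly (exp_poly f x) c = f x" for c
    proof -
      have "dual_map X (exp_map c) x = x"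
        using assms(1) exp_action True unfolding rigid_def by blast
      then show ?thesis
        using dual_map_apply[OF closed algebra_endo_exp_map True f, of c] by (simp add: exp_map_def)
    qed
    then have "poly (exp_poly f x - [:f x:]) c = 0" for c by simp
    then have "exp_poly f x - [:f x:] = 0"
      using poly_all_0_iff_0 by blast
    then have "exp_poly f x = [:f x:]" by simp
    then have "coeff (exp_poly f x) 1 = 0" by simp
    then show ?thesis by (simp add: coeff_exp_poly[OF f] term_coeff_def)
  next
    case False
    then show ?thesis using regular_ring_off[OF N_mem[OF f]] by simp
  qed
qed

end

text \<open>
  Induction leaves eta-expanded functions in the goal, in which these rules would be applied under the
  abstraction.
\<close>

declare zero_fun_apply [simp del] plus_fun_apply [simp del] times_fun_apply [simp del]
  minus_apply [simp del] uminus_apply [simp del]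

lemmas fun_simps = zero_fun_apply plus_fun_apply times_fun_apply one_fun_apply fscale_apply
  sum_fun_apply prod_fun_apply power_fun_apply minus_apply uminus_apply

section \<open>Direct sums and generalized eigenspaces\<close>

definition direct_sum :: "('x \<Rightarrow> 'a::field) set \<Rightarrow> ('i \<Rightarrow> ('x \<Rightarrow> 'a) set) \<Rightarrow> bool" where
  "direct_sum A W \<longleftrightarrow>
     (\<forall>i. fv.subspace (W i) \<and> W i \<subseteq> A) \<and>
     (\<forall>f\<in>A. \<exists>F h. finite F \<and> (\<forall>i\<in>F. h i \<in> W i) \<and> f = sum h F) \<and>
     (\<forall>F h. finite F \<longrightarrow> (\<forall>i\<in>F. h i \<in> W i) \<longrightarrow> sum h F = 0 \<longrightarrow> (\<forall>i\<in>F. h i = 0))"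

lemma direct_sumD:
  assumes "direct_sum A W"
  shows "fv.subspace (W i)" "W i \<subseteq> A"
    "f \<in> A \<Longrightarrow> \<exists>F h. finite F \<and> (\<forall>i\<in>F. h i \<in> W i) \<and> f = sum h F"
    "finite F \<Longrightarrow> (\<And>i. i \<in> F \<Longrightarrow> h i \<in> W i) \<Longrightarrow> sum h F = 0 \<Longrightarrow> i \<in> F \<Longrightarrow> h i = 0"
  using assms unfolding direct_sum_def by blast+

lemma direct_sum_unique:
  assumes W: "direct_sum A W" and F: "finite F" "\<And>i. i \<in> F \<Longrightarrow> h i \<in> W i"
    and G: "finite G" "\<And>i. i \<in> G \<Longrightarrow> k i \<in> W i" and eq: "sum h F = sum k G"
  shows "(if i \<in> F then h i else 0) = (if i \<in> G then k i else 0)"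
proof -
  define h' where "h' = (\<lambda>i. if i \<in> F then h i else 0)"
  define k' where "k' = (\<lambda>i. if i \<in> G then k i else 0)"
  have "sum h' (F \<union> G) = sum h F" "sum k' (F \<union> G) = sum k G"
    unfolding h'_def k'_def using F(1) G(1) by (auto intro!: sum.mono_neutral_cong_right)
  then have 0: "(\<Sum>i\<in>F \<union> G. h' i - k' i) = 0" using eq by (simp add: sum_subtractf)
  have m: "h' i - k' i \<in> W i" for i
    unfolding h'_def k'_def using F(2) G(2) direct_sumD(1)[OF W]
    by (intro fv.subspace_diff) (auto intro: fv.subspace_0)
  have "h' i - k' i = 0"
  proof (cases "i \<in> F \<union> G")
    case True
    show ?thesis by (rule direct_sumD(4)[OF W _ m 0 True]) (use F(1) G(1) in simp)
  qed (simp add: h'_def k'_def)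
  then show ?thesis unfolding h'_def k'_def by (simp only: right_minus_eq)
qed

lemma direct_sum_induct:
  assumes W: "direct_sum A W" and "f \<in> A"
    and "\<And>i f. f \<in> W i \<Longrightarrow> P f" and "\<And>f g. f \<in> A \<Longrightarrow> g \<in> A \<Longrightarrow> P f \<Longrightarrow> P g \<Longrightarrow> P (f + g)"
    and A: "fv.subspace A"
  shows "P f"
proof -
  obtain F h where F: "finite F" "\<forall>i\<in>F. h i \<in> W i" "f = sum h F"
    using direct_sumD(3)[OF W \<open>f \<in> A\<close>] by blast
  have "P (sum h F) \<and> sum h F \<in> A"
    using F(1,2)
  proof (induction F rule: finite_induct)
    case empty
    have "0 \<in> W undefined" by (rule fv.subspace_0[OF direct_sumD(1)[OF W]])
    then have "P 0 \<and> 0 \<in> A" using assms(3) direct_sumD(2)[OF W] by blast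
    then show ?case by (simp only: sum.empty)
  next
    case (insert i F)
    then have "h i \<in> W i" "h i \<in> A" using direct_sumD(2)[OF W] by blast+
    then have "P (h i + sum h F) \<and> h i + sum h F \<in> A"
      using insert assms(3)[OF \<open>h i \<in> W i\<close>] assms(4)[of "h i" "sum h F"] fv.subspace_add[OF A] by simp
    then show ?case using insert.hyps by (simp only: sum.insert not_False_eq_True)
  qed
  then show ?thesis using F(3) by simp
qed

text \<open>Uniqueness of components makes the value independent of the decomposition picked by the
  choice operator. The construction yields both the semisimple part of a derivation and the elements
  of a torus.\<close>

lemma direct_sum_multiplier:
  assumes W: "direct_sum A W" and A: "fv.subspace A"
  obtains \<psi> where "\<And>f. f \<in> A \<Longrightarrow> \<psi> f \<in> A" 
    "\<And>f g. f \<in> A \<Longrightarrow> g \<in> A \<Longrightarrow> \<psi> (f + g) = \<psi> f + \<psi> g"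
    "\<And>c f. f \<in> A \<Longrightarrow> \<psi> (fscale c f) = fscale c (\<psi> f)"
    "\<And>i f. f \<in> W i \<Longrightarrow> \<psi> f = fscale (\<sigma> i) f"
proof -
  define Q where "Q f F h \<longleftrightarrow> finite F \<and> (\<forall>i\<in>F. h i \<in> W i) \<and> f = sum h F" for f F h
  define \<psi> where "\<psi> f = (SOME g. \<exists>F h. Q f F h \<and> g = (\<Sum>i\<in>F. fscale (\<sigma> i) (h i)))" for f
  have key: "\<psi> f = (\<Sum>i\<in>F. fscale (\<sigma> i) (h i))" if "Q f F h" for f F h
  proof -
    have "\<exists>g. \<exists>F h. Q f F h \<and> g = (\<Sum>i\<in>F. fscale (\<sigma> i) (h i))" using that by blast
    from someI_ex[OF this] obtain G k where G: "Q f G k" "\<psi> f = (\<Sum>i\<in>G. fscale (\<sigma> i) (k i))"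
      unfolding \<psi>_def by blast
    have u: "(if i \<in> F then h i else 0) = (if i \<in> G then k i else 0)" for i
      by (rule direct_sum_unique[OF W]) (use that G(1) in \<open>auto simp: Q_def\<close>)
    have "(\<Sum>i\<in>F. fscale (\<sigma> i) (h i)) = (\<Sum>i\<in>F \<union> G. fscale (\<sigma> i) (if i \<in> F then h i else 0))"
      using that G(1) by (intro sum.mono_neutral_cong_left) (auto simp: Q_def)
    also have "\<dots> = (\<Sum>i\<in>F \<union> G. fscale (\<sigma> i) (if i \<in> G then k i else 0))"
      unfolding u ..
    also have "\<dots> = (\<Sum>i\<in>G. fscale (\<sigma> i) (k i))"
      using that G(1) by (intro sum.mono_neutral_cong_right) (auto simp: Q_def)
    finally show ?thesis using G(2) by simp
  qed
  have ex: "\<exists>F h. Q f F h" if "f \<in> A" for f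
    using direct_sumD(3)[OF W that] unfolding Q_def .
  have sub: "W i \<subseteq> A" and W0: "0 \<in> W i" for i
    using direct_sumD(2)[OF W] fv.subspace_0[OF direct_sumD(1)[OF W]] by auto
  show ?thesis
  proof (rule that[of \<psi>])
    fix f assume f: "f \<in> A"
    then obtain F h where Q: "Q f F h" using ex by blast
    show "\<psi> f \<in> A"
      unfolding key[OF Q] using Q sub by (intro fv.subspace_sum[OF A] fv.subspace_scale[OF A]) (auto simp: Q_def)
    show "\<psi> (fscale c f) = fscale c (\<psi> f)" for c
    proof -
      have "Q (fscale c f) F (\<lambda>i. fscale c (h i))"
        using Q direct_sumD(1)[OF W] unfolding Q_def
        by (auto simp: fv.scale_sum_right intro: fv.subspace_scale)
      from key[OF this] show ?thesis
        unfolding key[OF Q] by (simp add: fv.scale_sum_right mult.commute)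
    qed
    fix g assume g: "g \<in> A"
    then obtain G k where Q': "Q g G k" using ex by blast
    define h' where "h' = (\<lambda>i. if i \<in> F then h i else 0)"
    define k' where "k' = (\<lambda>i. if i \<in> G then k i else 0)"
    have hW: "h' i \<in> W i" "k' i \<in> W i" for i
      unfolding h'_def k'_def using Q Q' W0 by (auto simp: Q_def)
    have "sum h' (F \<union> G) = sum h F" "sum k' (F \<union> G) = sum k G"
      unfolding h'_def k'_def using Q Q' by (auto simp: Q_def intro!: sum.mono_neutral_cong_right)
    then have "Q f (F \<union> G) h'" "Q g (F \<union> G) k'" "Q (f + g) (F \<union> G) (\<lambda>i. h' i + k' i)"
      using Q Q' hW direct_sumD(1)[OF W] unfolding Q_def by (auto simp: sum.distrib intro: fv.subspace_add)
    then show "\<psi> (f + g) = \<psi> f + \<psi> g"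
      by (simp add: key sum.distrib[symmetric] fv.scale_right_distrib)
  next
    fix i f assume "f \<in> W i"
    then have "Q f {i} (\<lambda>_. f)" by (simp add: Q_def)
    from key[OF this] show "\<psi> f = fscale (\<sigma> i) f" by simp
  qed
qed

section \<open>Generalized eigenspaces of an operator on a space of functions\<close>

locale linear_operator =
  fixes A :: "('x \<Rightarrow> 'a::field) set" and D
  assumes A: "fv.subspace A"
    and D_mem: "f \<in> A \<Longrightarrow> D f \<in> A"
    and D_add: "f \<in> A \<Longrightarrow> g \<in> A \<Longrightarrow> D (f + g) = D f + D g"
    and D_scale: "f \<in> A \<Longrightarrow> D (fscale c f) = fscale c (D f)"
begin

definition shift :: "'a \<Rightarrow> ('x \<Rightarrow> 'a) \<Rightarrow> 'x \<Rightarrow> 'a" where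
  "shift \<nu> f = D f - fscale \<nu> f"

text \<open>The generalized eigenspace: the exponent may depend on \<open>f\<close>, because the
  operator will be locally finite without being bounded in this sense.\<close>

definition eigen :: "'a \<Rightarrow> ('x \<Rightarrow> 'a) set" where
  "eigen \<nu> = {f \<in> A. \<exists>k. (shift \<nu> ^^ k) f = 0}"

lemma D_diff: "f \<in> A \<Longrightarrow> g \<in> A \<Longrightarrow> D (f - g) = D f - D g"
  using D_add[of f "fscale (- 1) g"] D_scale[of g "-1"] fv.subspace_scale[OF A, of g "-1"]
  by simp

lemma D_zero: "D 0 = 0"
  using D_scale[OF fv.subspace_0[OF A], of 0] by (simp only: fv.scale_zero_left)

lemma shift_mem: "f \<in> A \<Longrightarrow> shift \<nu> f \<in> A"
  unfolding shift_def by (intro fv.subspace_diff[OF A] fv.subspace_scale[OF A] D_mem)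

lemma shift_add: "f \<in> A \<Longrightarrow> g \<in> A \<Longrightarrow> shift \<nu> (f + g) = shift \<nu> f + shift \<nu> g"
  by (simp add: shift_def D_add fv.scale_right_distrib)

lemma shift_scale: "f \<in> A \<Longrightarrow> shift \<nu> (fscale c f) = fscale c (shift \<nu> f)"
  by (simp add: shift_def D_scale fv.scale_right_diff_distrib fv.scale_left_commute)

lemma shift_commute: "f \<in> A \<Longrightarrow> shift \<nu> (shift \<mu> f) = shift \<mu> (shift \<nu> f)"
  unfolding shift_def
  by (simp add: D_diff D_scale D_mem fv.subspace_scale[OF A] fv.scale_right_diff_distrib fv.scale_left_commute)

lemma pow_mem: "f \<in> A \<Longrightarrow> (shift \<nu> ^^ k) f \<in> A"
  by (induction k) (auto intro: shift_mem)

lemma pow_add: "f \<in> A \<Longrightarrow> g \<in> A \<Longrightarrow> (shift \<nu> ^^ k) (f + g) = (shift \<nu> ^^ k) f + (shift \<nu> ^^ k) g"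
  by (induction k) (auto simp: shift_add pow_mem)

lemma pow_scale: "f \<in> A \<Longrightarrow> (shift \<nu> ^^ k) (fscale c f) = fscale c ((shift \<nu> ^^ k) f)"
  by (induction k) (auto simp: shift_scale pow_mem)

lemma pow_zero: "(shift \<nu> ^^ k) 0 = 0"
  using pow_scale[OF fv.subspace_0[OF A], of k \<nu> 0] by (simp only: fv.scale_zero_left)

lemma pow_commute: "f \<in> A \<Longrightarrow> (shift \<nu> ^^ k) (shift \<mu> f) = shift \<mu> ((shift \<nu> ^^ k) f)"
  by (induction k) (auto simp: shift_commute pow_mem)

lemma pow_vanish: 
  assumes "(shift \<nu> ^^ m) f = 0" "m \<le> k" shows "(shift \<nu> ^^ k) f = 0"
proof -
  have "(shift \<nu> ^^ k) f = (shift \<nu> ^^ (k - m)) ((shift \<nu> ^^ m) f)"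
    using assms(2) by (simp flip: funpow_add o_apply[of "shift \<nu> ^^ _" "shift \<nu> ^^ _"])
  then show ?thesis unfolding assms(1) pow_zero .
qed

lemma eigen_subset: "eigen \<nu> \<subseteq> A"
  by (auto simp: eigen_def)

lemma subspace_eigen: "fv.subspace (eigen \<nu>)"
proof (rule fv.subspaceI)
  show "0 \<in> eigen \<nu>"
    using fv.subspace_0[OF A] pow_zero[of 0 \<nu>] unfolding eigen_def by blast
  fix f g c assume f: "f \<in> eigen \<nu>"
  then obtain m where m: "f \<in> A" "(shift \<nu> ^^ m) f = 0" by (auto simp: eigen_def)
  have "(shift \<nu> ^^ m) (fscale c f) = 0" unfolding pow_scale[OF m(1)] m(2) by (rule fv.scale_zero_right)
  then show "fscale c f \<in> eigen \<nu>"
    using fv.subspace_scale[OF A m(1)] unfolding eigen_def by blast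
  assume "g \<in> eigen \<nu>"
  then obtain n where n: "g \<in> A" "(shift \<nu> ^^ n) g = 0" by (auto simp: eigen_def)
  have "(shift \<nu> ^^ (max m n)) (f + g) = 0"
    unfolding pow_add[OF m(1) n(1)] pow_vanish[OF m(2) max.cobounded1] pow_vanish[OF n(2) max.cobounded2]
    by (rule add_0)
  then show "f + g \<in> eigen \<nu>"
    using fv.subspace_add[OF A m(1) n(1)] unfolding eigen_def by blast
qed

lemma shift_eigen: 
  assumes "f \<in> eigen \<mu>" shows "shift \<nu> f \<in> eigen \<mu>"
proof -
  obtain m where m: "f \<in> A" "(shift \<mu> ^^ m) f = 0" using assms by (auto simp: eigen_def)
  have "shift \<nu> 0 = 0" using pow_zero[of 1 \<nu>] by simp
  then have "(shift \<mu> ^^ m) (shift \<nu> f) = 0" unfolding pow_commute[OF m(1)] m(2) .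
  then show ?thesis using shift_mem[OF m(1)] unfolding eigen_def by blast
qed

text \<open>Induction on the exponent for \<open>\<nu>\<close> reduces to a true eigenvector of
  \<open>\<nu>\<close>. There \<open>shift \<mu>\<close> is multiplication by the nonzero scalar
  \<open>\<nu> - \<mu>\<close>, none of whose powers can annihilate a nonzero vector.\<close>

lemma eigen_inter:
  assumes "\<nu> \<noteq> \<mu>" "f \<in> eigen \<nu>" "f \<in> eigen \<mu>"
  shows "f = 0"
proof -
  obtain m where m: "(shift \<nu> ^^ m) f = 0" using assms(2) by (auto simp: eigen_def)
  from m assms(2,3) show ?thesis
  proof (induction m arbitrary: f)
    case 0
    then show ?case by simp
  next
    case (Suc m)
    have fA: "f \<in> A" using Suc.prems by (auto simp: eigen_def)
    have "(shift \<nu> ^^ m) (shift \<nu> f) = 0" using Suc.prems(1) by (simp add: funpow_Suc_right del: funpow.simps)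
    then have 0: "shift \<nu> f = 0"
      using Suc.IH[of "shift \<nu> f"] shift_eigen Suc.prems(2,3) by blast
    have s: "shift \<mu> f = fscale (\<nu> - \<mu>) f"
      using 0 unfolding shift_def by (simp add: fv.scale_left_diff_distrib)
    have p: "(shift \<mu> ^^ k) f = fscale ((\<nu> - \<mu>) ^ k) f" for k
    proof (induction k)
      case (Suc k)
      have "(shift \<mu> ^^ Suc k) f = shift \<mu> (fscale ((\<nu> - \<mu>) ^ k) f)" using Suc.IH by simp
      also have "\<dots> = fscale ((\<nu> - \<mu>) ^ k) (shift \<mu> f)" by (rule shift_scale[OF fA])
      also have "\<dots> = fscale ((\<nu> - \<mu>) ^ Suc k) f" unfolding s by (simp add: mult.commute)
      finally show ?case .
    qed simp
    obtain n where "(shift \<mu> ^^ n) f = 0" using Suc.prems(3) by (auto simp: eigen_def)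
    then have "fscale ((\<nu> - \<mu>) ^ n) f = 0" using p by (simp only:)
    then have "(\<nu> - \<mu>) ^ n = 0 \<or> f = 0" by (simp only: fv.scale_eq_0_iff)
    then show ?case using assms(1) by (simp only: power_eq_0_iff right_minus_eq simp_thms)
  qed
qed

text \<open>A power of \<open>shift \<mu>\<close> that kills the summand for \<open>\<mu>\<close>
  leaves a shorter relation. By induction it kills every other summand too, so these lie in two
  different eigenspaces.\<close>

lemma eigen_independent:
  assumes "finite F" "\<And>i. i \<in> F \<Longrightarrow> h i \<in> eigen i" "sum h F = 0" "i \<in> F"
  shows "h i = 0"
  using assms
proof (induction F arbitrary: h i rule: finite_induct)
  case (insert \<mu> F)
  have hA: "h j \<in> A" if "j \<in> insert \<mu> F" for j using insert.prems(1)[OF that] eigen_subset by blast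
  obtain m where m: "(shift \<mu> ^^ m) (h \<mu>) = 0" using insert.prems(1)[of \<mu>] by (auto simp: eigen_def)
  have sum: "(shift \<mu> ^^ m) (sum h G) = (\<Sum>j\<in>G. (shift \<mu> ^^ m) (h j)) \<and> sum h G \<in> A"
    if "finite G" "G \<subseteq> insert \<mu> F" for G
    using that
  proof (induction G rule: finite_induct)
    case empty
    show ?case by (simp only: sum.empty pow_zero fv.subspace_0[OF A] simp_thms)
  next
    case (insert j G)
    have "h j \<in> A" "sum h G \<in> A" using hA insert by auto
    then have "(shift \<mu> ^^ m) (h j + sum h G) = (shift \<mu> ^^ m) (h j) + (shift \<mu> ^^ m) (sum h G) \<and> h j + sum h G \<in> A"
      using pow_add fv.subspace_add[OF A] by simp
    then show ?case using insert by (simp only: sum.insert insert_subset simp_thms)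
  qed
  have "(\<Sum>j\<in>insert \<mu> F. (shift \<mu> ^^ m) (h j)) = 0"
    using sum[of "insert \<mu> F"] insert.hyps(1) insert.prems(2) pow_zero by simp
  then have "(\<Sum>j\<in>F. (shift \<mu> ^^ m) (h j)) = 0" using insert.hyps m by simp
  moreover have "(shift \<mu> ^^ m) (h j) \<in> eigen j" if "j \<in> F" for j
  proof -
    have "(shift \<mu> ^^ k) (h j) \<in> eigen j" for k
      by (induction k) (use insert.prems(1) that in \<open>auto intro: shift_eigen\<close>)
    then show ?thesis .
  qed
  ultimately have F0: "(shift \<mu> ^^ m) (h j) = 0" if "j \<in> F" for j
    using insert.IH[of "\<lambda>j. (shift \<mu> ^^ m) (h j)" j] that by blast
  have hF: "h j = 0" if "j \<in> F" for j
  proof (rule eigen_inter[of \<mu> j])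
    show "\<mu> \<noteq> j" using that insert.hyps by blast
    show "h j \<in> eigen \<mu>" using F0[OF that] hA[of j] that by (auto simp: eigen_def)
    show "h j \<in> eigen j" using insert.prems(1) that by blast
  qed
  then have "h \<mu> = 0" using insert.prems(2) insert.hyps by simp
  then show ?case using hF insert.prems(3) by blast
qed simp

text \<open>\<open>D - \<nu>\<close> is surjective on the generalized eigenspace of any
  \<open>\<mu>\<close> different from \<open>\<nu>\<close>, with no growth of the exponent.\<close>

lemma shift_solve:
  assumes "\<nu> \<noteq> \<mu>" "(shift \<mu> ^^ k) f = 0" "f \<in> A"
  shows "\<exists>g\<in>A. (shift \<mu> ^^ k) g = 0 \<and> shift \<nu> g = f"
  using assms(2,3)
proof (induction k arbitrary: f)
  case 0
  have "shift \<nu> 0 = 0" using pow_zero[of 1 \<nu>] by simp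
  then have "0 \<in> A \<and> (shift \<mu> ^^ 0) 0 = 0 \<and> shift \<nu> 0 = f" using 0 fv.subspace_0[OF A] by (simp del: zero_fun_apply)
  then show ?case by blast
next
  case (Suc k)
  have "(shift \<mu> ^^ k) (shift \<mu> f) = 0" using Suc.prems(1) by (simp add: funpow_Suc_right del: funpow.simps)
  then obtain g where g: "g \<in> A" "(shift \<mu> ^^ k) g = 0" "shift \<nu> g = shift \<mu> f"
    using Suc.IH[OF _ shift_mem[OF Suc.prems(2)]] by blast
  \<comment> \<open>As \<open>shift \<nu> f - shift \<mu> f\<close> is \<open>\<mu> - \<nu>\<close>
    times \<open>f\<close>, and \<open>g\<close> solves the equation with right side
    \<open>shift \<mu> f\<close>, the difference \<open>f - g\<close> solves it up to the factor
    \<open>\<mu> - \<nu>\<close>.\<close>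
  define d where "d = inverse (\<mu> - \<nu>)"
  define g' where "g' = fscale d (f + fscale (- 1) g)"
  have m: "fscale (- 1) g \<in> A" "f + fscale (- 1) g \<in> A"
    using g(1) Suc.prems(2) fv.subspace_add[OF A] fv.subspace_scale[OF A] by blast+
  have "(shift \<mu> ^^ Suc k) g = 0" using pow_vanish[OF g(2), of "Suc k"] by simp
  then have "(shift \<mu> ^^ Suc k) g' = 0"
    unfolding g'_def pow_scale[OF m(2)] pow_add[OF Suc.prems(2) m(1)] pow_scale[OF g(1)] Suc.prems(1)
    by (simp only: fv.scale_zero_right add_0)
  moreover have "shift \<nu> g' = f"
  proof -
    have "shift \<nu> g' = fscale d (shift \<nu> f - shift \<mu> f)"
      unfolding g'_def shift_scale[OF m(2)] shift_add[OF Suc.prems(2) m(1)] shift_scale[OF g(1)] g(3) by simp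
    also have "shift \<nu> f - shift \<mu> f = fscale (\<mu> - \<nu>) f" by (simp add: shift_def fv.scale_left_diff_distrib)
    finally show ?thesis using assms(1) by (simp add: d_def)
  qed
  moreover have "g' \<in> A" unfolding g'_def by (rule fv.subspace_scale[OF A m(2)])
  ultimately show ?case by blast
qed

definition eval_poly :: "'a poly \<Rightarrow> ('x \<Rightarrow> 'a) \<Rightarrow> 'x \<Rightarrow> 'a" where
  "eval_poly p f = (\<Sum>k\<le>degree p. fscale (coeff p k) ((D ^^ k) f))"

lemma D_pow_mem: "f \<in> A \<Longrightarrow> (D ^^ k) f \<in> A"
  by (induction k) (auto intro: D_mem)

lemma eval_poly_ge: "degree p \<le> n \<Longrightarrow> eval_poly p f = (\<Sum>k\<le>n. fscale (coeff p k) ((D ^^ k) f))"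
  unfolding eval_poly_def by (rule sum.mono_neutral_left) (auto simp: coeff_eq_0)

text \<open>The factor is peeled off next to \<open>f\<close>, so that a polynomial annihilating
  \<open>f\<close> yields one of smaller degree annihilating \<open>shift x f\<close>.\<close>

lemma eval_poly_linear_factor:
  assumes "f \<in> A"
  shows "eval_poly ([:- x, 1:] * q) f = eval_poly q (shift x f)"
proof -
  let ?n = "degree q"
  have D_lin: "(D ^^ k) (shift x f) = (D ^^ Suc k) f - fscale x ((D ^^ k) f)" for k
  proof (induction k)
    case 0
    show ?case by (simp add: shift_def)
  next
    case (Suc k)
    have "(D ^^ Suc k) (shift x f) = D ((D ^^ Suc k) f - fscale x ((D ^^ k) f))" using Suc.IH by simp
    also have "\<dots> = D ((D ^^ Suc k) f) - D (fscale x ((D ^^ k) f))"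
      by (rule D_diff[OF D_pow_mem[OF assms] fv.subspace_scale[OF A D_pow_mem[OF assms]]])
    also have "D (fscale x ((D ^^ k) f)) = fscale x (D ((D ^^ k) f))"
      by (rule D_scale[OF D_pow_mem[OF assms]])
    finally show ?case by simp
  qed
  have c: "coeff ([:- x, 1:] * q) k = (case k of 0 \<Rightarrow> 0 | Suc j \<Rightarrow> coeff q j) - x * coeff q k" for k
    by (cases k) (simp_all add: mult_pCons_left coeff_pCons)
  have "degree ([:- x, 1:] * q) \<le> Suc ?n"
    using degree_mult_le[of "[:- x, 1:]" q] by simp
  then have "eval_poly ([:- x, 1:] * q) f = (\<Sum>k\<le>Suc ?n. fscale (coeff ([:- x, 1:] * q) k) ((D ^^ k) f))"
    by (rule eval_poly_ge)
  also have "\<dots> = (\<Sum>k\<le>Suc ?n. fscale (case k of 0 \<Rightarrow> 0 | Suc j \<Rightarrow> coeff q j) ((D ^^ k) f)) -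
      (\<Sum>k\<le>Suc ?n. fscale (x * coeff q k) ((D ^^ k) f))"
    unfolding sum_subtractf[symmetric]
    unfolding c fv.scale_left_diff_distrib ..
  also have "(\<Sum>k\<le>Suc ?n. fscale (case k of 0 \<Rightarrow> 0 | Suc j \<Rightarrow> coeff q j) ((D ^^ k) f)) =
      (\<Sum>k\<le>?n. fscale (coeff q k) ((D ^^ Suc k) f))"
    by (subst sum.atMost_Suc_shift) simp
  also have "(\<Sum>k\<le>Suc ?n. fscale (x * coeff q k) ((D ^^ k) f)) = (\<Sum>k\<le>?n. fscale (x * coeff q k) ((D ^^ k) f))"
    by (simp add: coeff_eq_0)
  also have "(\<Sum>k\<le>?n. fscale (coeff q k) ((D ^^ Suc k) f)) - (\<Sum>k\<le>?n. fscale (x * coeff q k) ((D ^^ k) f)) =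
      (\<Sum>k\<le>?n. fscale (coeff q k) ((D ^^ k) (shift x f)))"
    unfolding sum_subtractf[symmetric]
    unfolding D_lin fv.scale_right_diff_distrib fv.scale_scale mult.commute[of x] ..
  finally show ?thesis unfolding eval_poly_def .
qed

end

text \<open>The vectors form a sequence and not a set: a repetition is already a relation, and
  otherwise the infinite range exceeds the dimension.\<close>

lemma linear_relation:
  fixes v :: "nat \<Rightarrow> 'x \<Rightarrow> 'a::field"
  assumes "finite B" "\<And>k. v k \<in> fv.span B"
  shows "\<exists>c n. (\<exists>k\<le>n. c k \<noteq> 0) \<and> (\<Sum>k\<le>n. fscale (c k) (v k)) = 0"
proof (cases "inj v")
  case False
  then obtain i j where ij: "i < j" "v i = v j" unfolding inj_def by (metis linorder_neqE_nat)
  let ?c = "\<lambda>k. if k = i then 1 else if k = j then - 1 else 0 :: 'a"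
  have "(\<Sum>k\<le>j. fscale (?c k) (v k)) = (\<Sum>k\<in>{i, j}. fscale (?c k) (v k))"
    using ij by (intro sum.mono_neutral_right) auto
  also have "\<dots> = 0" using ij by simp
  finally show ?thesis using ij by (intro exI[of _ ?c] exI[of _ j]) auto
next
  case True
  have "\<not> fv.independent (range v)"
    using fv.independent_span_bound[OF assms(1), of "range v"] assms(2) range_inj_infinite[OF True] by blast
  then obtain S u x where S: "finite S" "S \<subseteq> range v" "(\<Sum>y\<in>S. fscale (u y) y) = 0" "x \<in> S" "u x \<noteq> 0"
    unfolding fv.independent_explicit_module by blast
  define K where "K = v -` S"
  have K: "finite K" "v ` K = S" "inj_on v K"
    using finite_vimageI[OF S(1) True] S(2) True by (auto simp: K_def inj_on_def inj_def)
  obtain n where n: "K \<subseteq> {..n}" using K(1) finite_nat_set_iff_bounded_le by auto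
  let ?c = "\<lambda>k. if k \<in> K then u (v k) else 0"
  have "(\<Sum>k\<le>n. fscale (?c k) (v k)) = (\<Sum>k\<in>K. fscale (u (v k)) (v k))"
    using n by (intro sum.mono_neutral_cong_right) auto
  also have "\<dots> = (\<Sum>y\<in>S. fscale (u y) y)"
    unfolding K(2)[symmetric] using K(3) by (simp add: sum.reindex)
  finally have "(\<Sum>k\<le>n. fscale (?c k) (v k)) = 0" using S(3) by simp
  moreover obtain k where "k \<in> K" "v k = x" using S(4) K(2) by blast
  ultimately show ?thesis using n S(5) by (intro exI[of _ ?c] exI[of _ n]) auto
qed

text \<open>Induction on the degree of the annihilating polynomial. After removal of a root
  \<open>x\<close>, the vector \<open>shift x f\<close> decomposes; its components for eigenvalues
  other than \<open>x\<close> have preimages under \<open>shift x\<close>, and subtracting these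
  from \<open>f\<close> leaves an element of \<open>eigen x\<close>. Existence of roots is a
  hypothesis since the locale allows an arbitrary field.\<close>

lemma (in linear_operator) eigen_decomposition_of_annihilator:
  assumes "f \<in> A" "p \<noteq> 0" "eval_poly p f = 0" and alg: "\<And>p :: 'a poly. degree p > 0 \<Longrightarrow> \<exists>x. poly p x = 0"
  shows "\<exists>F h. finite F \<and> (\<forall>i\<in>F. h i \<in> eigen i) \<and> f = sum h F"
  using assms(1-3)
proof (induction "degree p" arbitrary: p f)
  case 0
  then obtain c where c: "p = [:c:]" by (metis degree_eq_zeroE)
  then have "fscale c f = 0" using 0 by (simp add: eval_poly_def)
  then have "f = 0" using c 0 by (simp only: fv.scale_eq_0_iff pCons_eq_0_iff simp_thms)
  then show ?case by (intro exI[of _ "{}"]) simp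
next
  case (Suc n)
  then obtain x where "poly p x = 0" using alg[of p] by auto
  then obtain q where q: "p = [:- x, 1:] * q" unfolding poly_eq_0_iff_dvd by (elim dvdE)
  then have "q \<noteq> 0" using Suc.prems by auto
  then have "degree p = Suc (degree q)" unfolding q by (subst degree_mult_eq) auto
  then have "n = degree q" using Suc.hyps by simp
  moreover have "eval_poly q (shift x f) = 0"
    using Suc.prems(3) unfolding q eval_poly_linear_factor[OF Suc.prems(1)] .
  ultimately obtain F h where F: "finite F" "\<forall>i\<in>F. h i \<in> eigen i" "shift x f = sum h F"
    using Suc.hyps(1)[OF _ shift_mem[OF Suc.prems(1)] \<open>q \<noteq> 0\<close>] by blast
  have "\<exists>g. g \<in> eigen i \<and> shift x g = h i" if i: "i \<in> F - {x}" for i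
  proof -
    obtain k where "(shift i ^^ k) (h i) = 0" "h i \<in> A" using F(2) i by (auto simp: eigen_def)
    from shift_solve[OF _ this, of x] show ?thesis using i by (auto simp: eigen_def)
  qed
  then obtain g where g: "\<And>i. i \<in> F - {x} \<Longrightarrow> g i \<in> eigen i" "\<And>i. i \<in> F - {x} \<Longrightarrow> shift x (g i) = h i"
    by metis
  have gA: "g i \<in> A" if "i \<in> F - {x}" for i using g(1)[OF that] eigen_subset by blast
  have sum: "shift x (sum g G) = (\<Sum>j\<in>G. h j) \<and> sum g G \<in> A" if "finite G" "G \<subseteq> F - {x}" for G
    using that
  proof (induction G rule: finite_induct)
    case empty
    have "shift x 0 = 0" using pow_zero[of 1 x] by simp
    then show ?case by (simp only: sum.empty fv.subspace_0[OF A] simp_thms)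
  next
    case (insert j G)
    then have "g j \<in> A" "sum g G \<in> A" "shift x (g j) = h j" using gA g(2) by auto
    then have "shift x (g j + sum g G) = h j + shift x (sum g G) \<and> g j + sum g G \<in> A"
      using shift_add fv.subspace_add[OF A] by simp
    then show ?case using insert by (simp only: sum.insert insert_subset simp_thms)
  qed
  define r where "r = f - sum g (F - {x})"
  have sA: "sum g (F - {x}) \<in> A" "shift x (sum g (F - {x})) = sum h (F - {x})"
    using sum[of "F - {x}"] F(1) by auto
  have rA: "r \<in> A" unfolding r_def by (rule fv.subspace_diff[OF A Suc.prems(1) sA(1)])
  have "f = r + sum g (F - {x})" by (simp add: r_def)
  then have "shift x f = shift x r + sum h (F - {x})" using shift_add[OF rA sA(1), of x] sA(2) by simp
  then have sr: "shift x r = sum h F - sum h (F - {x})" using F(3) by simp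
  \<comment> \<open>Only the component for \<open>x\<close> survives in \<open>shift x r\<close>, or
    nothing when \<open>x\<close> is not in \<open>F\<close>.\<close>
  have "shift x r \<in> eigen x"
  proof (cases "x \<in> F")
    case True
    then have "shift x r = h x" using sr F(1) by (simp add: sum.remove)
    then show ?thesis using F(2) True by simp
  next
    case False
    then have "shift x r = 0" using sr by simp
    then show ?thesis using fv.subspace_0[OF subspace_eigen] by (simp only:)
  qed
  then obtain k where "(shift x ^^ k) (shift x r) = 0" by (auto simp: eigen_def)
  then have "(shift x ^^ Suc k) r = 0" by (simp add: funpow_Suc_right del: funpow.simps)
  then have "r \<in> eigen x" using rA unfolding eigen_def by blast
  define h' where "h' = (\<lambda>i. if i = x then r else g i)"
  have "sum h' (insert x F) = r + sum h' (F - {x})"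
    using F(1) sum.remove[of "insert x F" x h'] by (simp add: h'_def)
  also have "sum h' (F - {x}) = sum g (F - {x})" by (rule sum.cong) (auto simp: h'_def)
  finally have "f = sum h' (insert x F)" by (simp add: r_def)
  moreover have "\<forall>i\<in>insert x F. h' i \<in> eigen i" using \<open>r \<in> eigen x\<close> g(1) by (auto simp: h'_def)
  ultimately show ?case using F(1) by (intro exI[of _ "insert x F"] exI[of _ h']) simp
qed

text \<open>The iterates of \<open>f\<close> stay in a finite-dimensional space, and a linear
  relation between them is an annihilating polynomial.\<close>

lemma (in linear_operator) eigen_decomposition:
  assumes "finite B" "A \<subseteq> fv.span B" "f \<in> A" and alg: "\<And>p :: 'a poly. degree p > 0 \<Longrightarrow> \<exists>x. poly p x = 0"
  shows "\<exists>F h. finite F \<and> (\<forall>i\<in>F. h i \<in> eigen i) \<and> f = sum h F"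
proof -
  have m: "(D ^^ k) f \<in> fv.span B" for k
    using D_pow_mem[OF assms(3), of k] assms(2) by (rule subsetD[rotated])
  have "\<exists>c n. (\<exists>k\<le>n. c k \<noteq> 0) \<and> (\<Sum>k\<le>n. fscale (c k) ((D ^^ k) f)) = 0"
    by (rule linear_relation[of B "\<lambda>k. (D ^^ k) f", OF assms(1) m])
  then obtain c n where cn: "(\<exists>k\<le>n. c k \<noteq> 0) \<and> (\<Sum>k\<le>n. fscale (c k) ((D ^^ k) f)) = 0"
    by (elim exE)
  note c = conjunct1[OF cn] conjunct2[OF cn]
  define p where "p = (\<Sum>k\<le>n. Polynomial.monom (c k) k)"
  have cf: "coeff p k = (if k \<le> n then c k else 0)" for k by (simp add: p_def coeff_sum)
  then have "p \<noteq> 0" using c(1) by (metis coeff_0)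
  moreover have "degree p \<le> n" using cf by (auto intro: degree_le)
  then have "eval_poly p f = 0" unfolding eval_poly_ge[OF \<open>degree p \<le> n\<close>] using c(2) cf by simp
  ultimately show ?thesis using eigen_decomposition_of_annihilator[OF assms(3) _ _ alg] by blast
qed

section \<open>Gradings and one-parameter subtori\<close>

lemma two_power_int_eq: 
  assumes "(2 :: 'a::field_char_0) powi a = 2 powi b" shows "a = b"
proof -
  have aux: "m = 0" if "(2 :: 'a) powi int m = 1" for m :: nat
  proof -
    have "of_nat (2 ^ m) = (of_nat 1 :: 'a)" using that by simp
    then have "(2 :: nat) ^ m = 1" by (simp only: of_nat_eq_iff)
    then show "m = 0" by simp
  qed
  have 1: "(2 :: 'a) powi (a - b) = 1" "(2 :: 'a) powi (b - a) = 1"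
    using assms by (simp_all add: power_int_diff)
  show ?thesis
  proof (cases "a \<ge> b")
    case True
    then show ?thesis using aux[of "nat (a - b)"] 1 by simp
  next
    case False
    then show ?thesis using aux[of "nat (b - a)"] 1 by simp
  qed
qed

lemma power_int_Gcd:
  fixes c :: "'a::field"
  assumes "c \<noteq> 0" "finite F" "\<And>n. n \<in> F \<Longrightarrow> c powi n = 1"
  shows "c powi (Gcd F) = 1"
  using assms(2,3)
proof (induction F rule: finite_induct)
  case (insert a F)
  obtain u v where uv: "u * a + v * Gcd F = gcd a (Gcd F)" using bezout_int by blast
  have "c powi (u * a + v * Gcd F) = 1"
    using insert assms(1) by (simp add: power_int_add power_int_mult mult.commute[of _ a] mult.commute[of _ "Gcd F"])
  then show ?case using uv by simp
qed simp

inductive_set nat_span :: "'a::comm_monoid_add set \<Rightarrow> 'a set" for S where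
  zero: "0 \<in> nat_span S"
| base: "a \<in> S \<Longrightarrow> a \<in> nat_span S"
| add: "a \<in> nat_span S \<Longrightarrow> b \<in> nat_span S \<Longrightarrow> a + b \<in> nat_span S"

text \<open>The field is regarded as a vector space over its prime field.\<close>

lemma ex_rational_functional:
  fixes x :: "'a::field_char_0"
  assumes "x \<noteq> 0"
  shows "\<exists>m :: 'a \<Rightarrow> rat. (\<forall>a b. m (a + b) = m a + m b) \<and> m x \<noteq> 0"
proof -
  interpret p: vector_space_pair "\<lambda>q (x::'a). of_rat q * x" "(*) :: rat \<Rightarrow> rat \<Rightarrow> rat"
    by unfold_locales (auto simp: algebra_simps of_rat_add of_rat_mult)
  have "p.vs1.independent {x}" using assms by (simp add: p.vs1.dependent_single)
  from p.linear_independent_extend[OF this, of "\<lambda>_. 1"] obtain m where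
    m: "Vector_Spaces.linear (\<lambda>q (x::'a). of_rat q * x) (*) m" "m x = 1" by auto
  interpret m: Vector_Spaces.linear "\<lambda>q (x::'a). of_rat q * x" "(*)" m by (rule m(1))
  show ?thesis using m(2) m.add by (intro exI[of _ m]) simp
qed

lemma common_denominator:
  assumes "finite Q" shows "\<exists>N :: int. N > 0 \<and> (\<forall>q\<in>Q. \<exists>z. of_int N * (q :: rat) = of_int z)"
  using assms
proof (induction Q rule: finite_induct)
  case (insert q Q)
  then obtain N :: int where N: "N > 0" "\<forall>q\<in>Q. \<exists>z. of_int N * q = of_int z" by blast
  obtain p d where pd: "quotient_of q = (p, d)" by (cases "quotient_of q")
  have d: "d > 0" "q = of_int p / of_int d"
    using quotient_of_denom_pos[OF pd] quotient_of_div[OF pd] by auto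
  have "of_int (N * d) * q = of_int (N * p)" using d by simp
  then have "\<exists>z. of_int (N * d) * q = of_int z" by blast
  moreover have "\<exists>z. of_int (N * d) * q' = of_int z" if q': "q' \<in> Q" for q' :: rat
  proof -
    obtain z where "of_int N * q' = of_int z" using N(2) q' by blast
    then have "of_int (N * d) * q' = of_int (d * z)" by (simp add: mult_ac)
    then show ?thesis by blast
  qed
  ultimately have "\<forall>q'\<in>insert q Q. \<exists>z. of_int (N * d) * q' = of_int z" by blast
  moreover have "N * d > 0" using N(1) d(1) by simp
  ultimately show ?case by blast
qed (intro exI[of _ 1], simp)

text \<open>A rational functional that is nonzero on \<open>a - b\<close> is multiplied by a common
  denominator of its values on \<open>S\<close> and divided by their greatest common divisor.
  Integrality holds only on the monoid generated by \<open>S\<close>, so additivity is claimed only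
  there.\<close>

lemma separating_integer_functional:
  fixes S :: "'a::field_char_0 set"
  assumes "finite S" "a \<in> nat_span S" "b \<in> nat_span S" "a \<noteq> b"
  shows "\<exists>\<rho> :: 'a \<Rightarrow> int. \<rho> 0 = 0 \<and> \<rho> a \<noteq> \<rho> b \<and> Gcd (\<rho> ` S) = 1 \<and>
    (\<forall>x\<in>nat_span S. \<forall>y\<in>nat_span S. \<rho> (x + y) = \<rho> x + \<rho> y)"
proof -
  obtain m :: "'a \<Rightarrow> rat" where m: "\<And>x y. m (x + y) = m x + m y" "m (a - b) \<noteq> 0"
    using ex_rational_functional[of "a - b"] assms(4) by auto
  have m0: "m 0 = 0" using m(1)[of 0 0] by simp
  have mab: "m a \<noteq> m b" using m(1)[of "a - b" b] m(2) by simp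
  obtain N :: int where N: "N > 0" "\<forall>q\<in>m ` S. \<exists>z. of_int N * q = of_int z"
    using common_denominator[OF finite_imageI[OF assms(1)]] by blast
  have NS: "of_int N * m x \<in> \<int>" if "x \<in> S" for x
    using N(2) that by (auto simp: Ints_def)
  \<comment> \<open>The floor merely makes the function total; on \<open>nat_span S\<close> its
    argument is an integer.\<close>
  define r where "r x = \<lfloor>of_int N * m x\<rfloor>" for x
  have r: "of_int (r x) = of_int N * m x" if "x \<in> nat_span S" for x
  proof -
    from that have "of_int N * m x \<in> \<int>"
      by induction (auto simp: m0 m NS distrib_left)
    then show ?thesis unfolding r_def by (simp add: of_int_floor_cancel)
  qed
  have radd: "r (x + y) = r x + r y" if "x \<in> nat_span S" "y \<in> nat_span S" for x y
  proof -
    have "(of_int (r (x + y)) :: rat) = of_int (r x + r y)"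
      using r[OF that(1)] r[OF that(2)] r[OF nat_span.add[OF that]] m(1) by (simp add: distrib_left)
    then show ?thesis by (simp only: of_int_eq_iff)
  qed
  have r0: "r 0 = 0" by (simp add: r_def m0)
  define d where "d = Gcd (r ` S)"
  have dS: "d dvd r x" if "x \<in> nat_span S" for x
    using that by induction (auto simp: r0 radd d_def)
  have "(of_int (r a) :: rat) \<noteq> of_int (r b)"
    using r[OF assms(2)] r[OF assms(3)] mab N(1) by simp
  then have rab: "r a \<noteq> r b" by simp
  \<comment> \<open>Were \<open>d\<close> zero, \<open>r\<close> would vanish on the whole monoid
    and could not separate \<open>a\<close> from \<open>b\<close>.\<close>
  then have "d \<noteq> 0" using dS[OF assms(2)] dS[OF assms(3)] by auto
  define \<rho> where "\<rho> x = r x div d" for x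
  have \<rho>: "r x = d * \<rho> x" if "x \<in> nat_span S" for x
    using dS[OF that] by (simp add: \<rho>_def)
  define e where "e = Gcd (\<rho> ` S)"
  have "d * e dvd r x" if "x \<in> S" for x
    using \<rho>[OF nat_span.base[OF that]] that by (simp add: e_def Gcd_dvd)
  then have "d * e dvd d" unfolding d_def by (intro Gcd_greatest) auto
  then have "e dvd 1" using \<open>d \<noteq> 0\<close> by (simp add: dvd_mult_cancel_left mult_dvd_mono)
  moreover have "e \<ge> 0" by (simp add: e_def)
  ultimately have "e = 1" by simp
  show ?thesis
  proof (intro exI[of _ \<rho>] conjI)
    show "\<rho> a \<noteq> \<rho> b" using rab \<rho>[OF assms(2)] \<rho>[OF assms(3)] by auto
    show "\<forall>x\<in>nat_span S. \<forall>y\<in>nat_span S. \<rho> (x + y) = \<rho> x + \<rho> y"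
    proof (intro ballI)
      fix x y assume that: "x \<in> nat_span S" "y \<in> nat_span S"
      have "d * \<rho> (x + y) = d * (\<rho> x + \<rho> y)"
        using \<rho>[OF that(1)] \<rho>[OF that(2)] \<rho>[OF nat_span.add[OF that]] radd[OF that] by (simp add: distrib_left)
      then show "\<rho> (x + y) = \<rho> x + \<rho> y" using \<open>d \<noteq> 0\<close> by simp
    qed
  qed (use \<open>e = 1\<close> in \<open>auto simp: \<rho>_def r0 e_def\<close>)
qed

section \<open>Automorphisms and one-dimensional subtori defined by gradings\<close>

lemma regular_ring_induct:
  assumes "f \<in> regular_ring X" "\<And>c. P (fscale c (cind X))" "\<And>i. P (coord_fun X i)"
    "\<And>f g. f \<in> regular_ring X \<Longrightarrow> g \<in> regular_ring X \<Longrightarrow> P f \<Longrightarrow> P g \<Longrightarrow> P (f + g)"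
    "\<And>f g. f \<in> regular_ring X \<Longrightarrow> g \<in> regular_ring X \<Longrightarrow> P f \<Longrightarrow> P g \<Longrightarrow> P (f * g)"
  shows "P f"
proof -
  obtain p where p: "p \<in> fun_algebra affine_coords" "\<forall>x\<in>X. f x = p x"
    using assms(1) unfolding regular_ring_def regular_on_def by blast
  have f: "cind X * p = f"
    using p(2) assms(1) by (auto simp: fun_eq_iff cind_def regular_ring_off fun_simps)
  from p(1) have "P (cind X * p)"
  proof induction
    case (const c)
    have "cind X * (\<lambda>_. c) = fscale c (cind X)" by (auto simp: fun_eq_iff fun_simps)
    then show ?case using assms(2)[of c] by (simp only:)
  next
    case (generator g)
    then obtain i where g: "g = (\<lambda>x. x $ i)" by (auto simp: affine_coords_def)
    then have "cind X * g = coord_fun X i" by (auto simp: fun_eq_iff cind_def coord_fun_def fun_simps)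
    then show ?case using assms(3)[of i] by (simp only:)
  next
    case (add f g)
    have eq: "cind X * (\<lambda>z. f z + g z) = cind X * f + cind X * g"
      by (auto simp: fun_eq_iff fun_simps algebra_simps)
    show ?case unfolding eq
      by (rule assms(4)[OF _ _ add.IH]) (use add.hyps in \<open>simp_all add: cind_times_regular_ring regular_on_algebra\<close>)
  next
    case (mult f g)
    have eq: "cind X * (\<lambda>z. f z * g z) = (cind X * f) * (cind X * g)"
      by (auto simp: fun_eq_iff cind_def fun_simps)
    show ?case unfolding eq
      by (rule assms(5)[OF _ _ mult.IH]) (use mult.hyps in \<open>simp_all add: cind_times_regular_ring regular_on_algebra\<close>)
  qed
  then show ?thesis unfolding f .
qed

text \<open>Multiplicativity of \<open>\<sigma>\<close> is asked only for degrees that occur,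
  because the exponents it will be built from are additive only on the monoid of these
  degrees.\<close>

lemma algebra_endo_multiplier:
  fixes E :: "'k::comm_monoid_add \<Rightarrow> ('a::field ^ 'n \<Rightarrow> 'a) set"
  assumes E: "direct_sum (regular_ring X) E"
    and mult: "\<And>i j f g. f \<in> E i \<Longrightarrow> g \<in> E j \<Longrightarrow> f * g \<in> E (i + j)" and one: "cind X \<in> E 0"
    and \<sigma>: "\<sigma> 0 = 1" "\<And>i j. E i \<noteq> {0} \<Longrightarrow> E j \<noteq> {0} \<Longrightarrow> \<sigma> (i + j) = \<sigma> i * \<sigma> j"
  obtains \<psi> where "algebra_endo X \<psi>" "\<And>i f. f \<in> E i \<Longrightarrow> \<psi> f = fscale (\<sigma> i) f"
proof -
  let ?R = "regular_ring X"
  obtain \<psi> where \<psi>: "\<And>f. f \<in> ?R \<Longrightarrow> \<psi> f \<in> ?R" 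
    "\<And>f g. f \<in> ?R \<Longrightarrow> g \<in> ?R \<Longrightarrow> \<psi> (f + g) = \<psi> f + \<psi> g"
    "\<And>c f. f \<in> ?R \<Longrightarrow> \<psi> (fscale c f) = fscale c (\<psi> f)"
    "\<And>i f. f \<in> E i \<Longrightarrow> \<psi> f = fscale (\<sigma> i) f"
    using direct_sum_multiplier[OF E subspace_regular_ring] by blast
  have EX: "f \<in> ?R" if "f \<in> E i" for f i using direct_sumD(2)[OF E] that by blast
  have hom: "\<psi> (f * g) = \<psi> f * \<psi> g" if f: "f \<in> E i" and g: "g \<in> E j" for f g i j
  proof (cases "f = 0 \<or> g = 0")
    case True
    then have "f * g = 0" by auto
    then have "\<psi> (f * g) = 0" "\<psi> f * \<psi> g = 0"
      using True \<psi>(4)[OF f] \<psi>(4)[OF g] \<psi>(4)[OF mult[OF f g]] by auto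
    then show ?thesis by simp
  next
    case False
    then have "\<sigma> (i + j) = \<sigma> i * \<sigma> j" using f g by (intro \<sigma>(2)) auto
    then show ?thesis
      using \<psi>(4)[OF f] \<psi>(4)[OF g] \<psi>(4)[OF mult[OF f g]] by (simp add: fscale_mult_left fscale_mult_right)
  qed
  have hom1: "\<psi> (f * g) = \<psi> f * \<psi> g" if "f \<in> E i" "g \<in> ?R" for f g i
    by (rule direct_sum_induct[OF E \<open>g \<in> ?R\<close> _ _ subspace_regular_ring])
      (use that(1) hom EX[OF that(1)] in \<open>auto simp: distrib_left \<psi>(2) regular_ring_mult\<close>)
  have hom2: "\<psi> (f * g) = \<psi> f * \<psi> g" if "f \<in> ?R" "g \<in> ?R" for f g
    by (rule direct_sum_induct[OF E \<open>f \<in> ?R\<close> _ _ subspace_regular_ring])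
      (use that(2) hom1 in \<open>auto simp: distrib_right \<psi>(2) regular_ring_mult\<close>)
  have "algebra_endo X \<psi>"
    unfolding algebra_endo_def using \<psi> hom2 \<psi>(4)[OF one] \<sigma>(1) by simp
  then show ?thesis using \<psi>(4) that by blast
qed

lemma group_torus: "group (torus s :: (nat \<Rightarrow> 'a::field) monoid)"
proof (rule groupI)
  fix t assume t: "t \<in> carrier (torus s :: (nat \<Rightarrow> 'a) monoid)"
  have "t i \<noteq> 0" for i using t by (cases "i < s") (auto simp: torus_def)
  with t show "\<exists>u\<in>carrier (torus s). u \<otimes>\<^bsub>torus s\<^esub> t = \<one>\<^bsub>torus s\<^esub>"
    by (intro bexI[of _ "\<lambda>i. inverse (t i)"]) (auto simp: torus_def fun_eq_iff) 
qed (auto simp: torus_def fun_eq_iff)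

lemma torus_coord_power:
  assumes "i < s"
  shows "regular_on (carrier (torus s)) (torus_coords s) (\<lambda>t :: nat \<Rightarrow> 'a::field. t i powi n)"
proof -
  have 1: "regular_on (carrier (torus s)) (torus_coords s) (\<lambda>t :: nat \<Rightarrow> 'a. t i)"
    "regular_on (carrier (torus s)) (torus_coords s) (\<lambda>t :: nat \<Rightarrow> 'a. inverse (t i))"
    using assms by (auto intro!: regular_on_generator simp: torus_coords_def)
  show ?thesis
    using regular_on_power[OF 1(1), of "nat n"] regular_on_power[OF 1(2), of "nat (- n)"]
    by (cases "n \<ge> 0") (auto simp: power_int_def)
qed

lemma regular_on_fst:
  "regular_on Y G f \<Longrightarrow> regular_on (Y \<times> Z) (prod_coords G H) (\<lambda>z. f (fst z))"
  by (erule regular_on_comp) (auto simp: prod_coords_def o_def image_iff intro!: regular_on_generator)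

lemma regular_on_snd:
  "regular_on Z H f \<Longrightarrow> regular_on (Y \<times> Z) (prod_coords G H) (\<lambda>z. f (snd z))"
  by (erule regular_on_comp) (auto simp: prod_coords_def o_def image_iff intro!: regular_on_generator)

lemma group_Aut: "group (Aut X)" and subgroup_automorphisms: "subgroup (automorphisms X) (BijGroup X)"
proof -
  interpret B: group "BijGroup X" by (rule group_BijGroup)
  have comp: "compose X f g \<in> automorphisms X" if f: "f \<in> automorphisms X" and g: "g \<in> automorphisms X" for f g
  proof -
    have b: "f \<in> Bij X" "g \<in> Bij X" and
      r: "regular_map X affine_coords X f" "regular_map X affine_coords X g"
      "regular_map X affine_coords X (inv_into X f)" "regular_map X affine_coords X (inv_into X g)"
      using f g by (auto simp: automorphisms_def)
    have bb: "bij_betw f X X" "bij_betw g X X" using b by (auto simp: Bij_def)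
    have i: "inv_into X (compose X f g) x = inv_into X g (inv_into X f x)" if "x \<in> X" for x
    proof (rule inv_into_f_eq)
      have 1: "inv_into X f x \<in> X" by (rule Bij_inv_into_mem[OF b(1) that])
      have "inv_into X g (inv_into X f x) \<in> X" by (rule Bij_inv_into_mem[OF b(2) 1])
      with 1 show "inv_into X g (inv_into X f x) \<in> X" "compose X f g (inv_into X g (inv_into X f x)) = x"
        using that bb by (auto simp: compose_def bij_betw_inv_into_right)
      show "inj_on (compose X f g) X" using compose_Bij[OF b] by (simp add: Bij_def bij_betw_def)
    qed
    show ?thesis
      unfolding automorphisms_def
    proof (intro CollectI conjI compose_Bij b)
      show "regular_map X affine_coords X (compose X f g)"
        by (rule regular_map_cong[OF _ regular_map_comp[OF r(1,2)]]) (simp add: compose_def)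
      show "regular_map X affine_coords X (inv_into X (compose X f g))"
        by (rule regular_map_cong[OF _ regular_map_comp[OF r(4,3)]]) (simp add: i)
    qed
  qed
  show s: "subgroup (automorphisms X) (BijGroup X)"
  proof (rule B.subgroupI)
    show "automorphisms X \<subseteq> carrier (BijGroup X)" by (auto simp: automorphisms_def BijGroup_def)
    have "regular_map X affine_coords X (\<lambda>x. x)"
      unfolding regular_map_iff by (auto simp: affine_coords_def intro!: regular_on_generator)
    then have "regular_map X affine_coords X (\<lambda>x\<in>X. x)" "regular_map X affine_coords X (inv_into X (\<lambda>x\<in>X. x))"
    proof -
      assume r: "regular_map X affine_coords X (\<lambda>x. x)"
      show "regular_map X affine_coords X (\<lambda>x\<in>X. x)" by (rule regular_map_cong[OF _ r]) simp
      show "regular_map X affine_coords X (inv_into X (\<lambda>x\<in>X. x))"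
        by (rule regular_map_cong[OF _ r]) (auto intro!: inv_into_f_eq[symmetric] inj_onI)
    qed
    then have "(\<lambda>x\<in>X. x) \<in> automorphisms X" using id_Bij by (simp add: automorphisms_def)
    then show "automorphisms X \<noteq> {}" by blast
  next
    fix f assume f: "f \<in> automorphisms X"
    then have b: "f \<in> Bij X" "bij_betw f X X" and r: "regular_map X affine_coords X f" "regular_map X affine_coords X (inv_into X f)"
      by (auto simp: automorphisms_def Bij_def)
    let ?g = "\<lambda>x\<in>X. inv_into X f x"
    have "regular_map X affine_coords X ?g" by (rule regular_map_cong[OF _ r(2)]) simp
    moreover have "inv_into X ?g x = f x" if "x \<in> X" for x
    proof (rule inv_into_f_eq)
      show "inj_on ?g X" using restrict_inv_into_Bij[OF b(1)] by (simp add: Bij_def bij_betw_def)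
      show "f x \<in> X" using that b(2) by (auto simp: bij_betw_def)
      then show "?g (f x) = x" using that b(2) by (simp add: bij_betw_inv_into_left)
    qed
    then have "regular_map X affine_coords X (inv_into X ?g)"
      by (intro regular_map_cong[OF _ r(1)]) simp
    ultimately show "inv\<^bsub>BijGroup X\<^esub> f \<in> automorphisms X"
      using restrict_inv_into_Bij[OF b(1)] by (simp add: inv_BijGroup[OF b(1)] automorphisms_def)
  next
    fix f g assume "f \<in> automorphisms X" "g \<in> automorphisms X"
    moreover then have "f \<in> Bij X" "g \<in> Bij X" by (auto simp: automorphisms_def)
    ultimately show "f \<otimes>\<^bsub>BijGroup X\<^esub> g \<in> automorphisms X"
      using comp by (simp add: BijGroup_def)
  qed
  show "group (Aut X)"
    unfolding Aut_def by (rule B.subgroup_imp_group[OF s])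
qed

lemma carrier_Aut: "carrier (Aut X) = automorphisms X"
  by (simp add: Aut_def)

lemma mult_Aut: "f \<in> automorphisms X \<Longrightarrow> g \<in> automorphisms X \<Longrightarrow> f \<otimes>\<^bsub>Aut X\<^esub> g = compose X f g"
  by (simp add: Aut_def BijGroup_def automorphisms_def)

lemma one_Aut: "\<one>\<^bsub>Aut X\<^esub> = (\<lambda>x\<in>X. x)"
  by (simp add: Aut_def BijGroup_def)

lemma inv_Aut: 
  assumes "f \<in> automorphisms X" shows "inv\<^bsub>Aut X\<^esub> f = (\<lambda>x\<in>X. inv_into X f x)"
proof -
  interpret B: group "BijGroup X" by (rule group_BijGroup)
  have "inv\<^bsub>Aut X\<^esub> f = inv\<^bsub>BijGroup X\<^esub> f"
    unfolding Aut_def by (rule B.m_inv_consistent[OF subgroup_automorphisms assms])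
  then show ?thesis using assms by (simp add: inv_BijGroup automorphisms_def)
qed

lemma torus_one_iff: "t \<in> carrier (torus (Suc 0)) \<longleftrightarrow> t 0 \<noteq> 0 \<and> (\<forall>i\<ge>Suc 0. t i = 1)"
  by (auto simp: torus_def)

text \<open>A nonzero \<open>c\<close> acts on the component of degree \<open>i\<close> by
  \<open>c powi \<rho> i\<close>. The greatest common divisor 1 makes this action faithful, so the
  image is isomorphic to the one-dimensional torus and not to a proper quotient of it.\<close>

lemma grading_subtorus:
  fixes X :: "('a::field ^ 'n) set"
    and E :: "'k::comm_monoid_add \<Rightarrow> ('a ^ 'n \<Rightarrow> 'a) set"
  assumes X: "zariski_closed X" and E: "direct_sum (regular_ring X) E"
    and mult: "\<And>i j f g. f \<in> E i \<Longrightarrow> g \<in> E j \<Longrightarrow> f * g \<in> E (i + j)" and one: "cind X \<in> E 0"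
    and \<rho>: "\<rho> 0 = (0::int)" "\<And>i j. E i \<noteq> {0} \<Longrightarrow> E j \<noteq> {0} \<Longrightarrow> \<rho> (i + j) = \<rho> i + \<rho> j"
    and \<Lambda>: "finite \<Lambda>" "\<And>i. i \<in> \<Lambda> \<Longrightarrow> E i \<noteq> {0}" "Gcd (\<rho> ` \<Lambda>) = 1"
  obtains H where "subtorus X H"
    "\<forall>c. c \<noteq> 0 \<longrightarrow> (\<exists>t\<in>H. \<forall>i. \<forall>f\<in>E i. \<forall>x\<in>X. f (t x) = c powi \<rho> i * f x)"
proof -
  let ?R = "regular_ring X"
  have EX: "f \<in> ?R" if "f \<in> E i" for f i using direct_sumD(2)[OF E] that by blast
  have "\<exists>\<psi>. algebra_endo X \<psi> \<and> (\<forall>i. \<forall>f\<in>E i. \<psi> f = fscale (c powi \<rho> i) f)" if "c \<noteq> 0" for c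
    by (rule algebra_endo_multiplier[OF E mult one, of "\<lambda>i. c powi \<rho> i"])
      (use \<rho> that in \<open>auto simp: power_int_add\<close>)
  then obtain \<psi> where \<psi>: "\<And>c. c \<noteq> 0 \<Longrightarrow> algebra_endo X (\<psi> c)" 
    "\<And>c i f. c \<noteq> 0 \<Longrightarrow> f \<in> E i \<Longrightarrow> \<psi> c f = fscale (c powi \<rho> i) f" by metis
  have comp: "\<psi> d (\<psi> c f) = \<psi> (c * d) f" if "c \<noteq> 0" "d \<noteq> 0" "f \<in> ?R" for c d f
  proof (rule direct_sum_induct[OF E \<open>f \<in> ?R\<close> _ _ subspace_regular_ring])
    have cd: "c * d \<noteq> 0" using that by simp
    show "\<psi> d (\<psi> c f) = \<psi> (c * d) f" if "f \<in> E i" for f i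
      using \<psi>(1)[OF \<open>d \<noteq> 0\<close>] \<psi>(2)[OF \<open>c \<noteq> 0\<close> that] \<psi>(2)[OF \<open>d \<noteq> 0\<close> that] \<psi>(2)[OF cd that] EX[OF that]
      by (simp add: algebra_endo_def power_int_mult_distrib)
    show "\<psi> d (\<psi> c (f + g)) = \<psi> (c * d) (f + g)" 
      if "f \<in> ?R" "g \<in> ?R" "\<psi> d (\<psi> c f) = \<psi> (c * d) f" "\<psi> d (\<psi> c g) = \<psi> (c * d) g" for f g
      using that \<psi>(1)[OF \<open>d \<noteq> 0\<close>] \<psi>(1)[OF \<open>c \<noteq> 0\<close>] \<psi>(1)[OF cd] unfolding algebra_endo_def by metis
  qed
  have id: "\<psi> 1 f = f" if "f \<in> ?R" for f
  proof (rule direct_sum_induct[OF E that _ _ subspace_regular_ring])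
    show "\<psi> 1 f = f" if "f \<in> E i" for f i using \<psi>(2)[of 1, OF _ that] by simp
    show "\<psi> 1 (f + g) = f + g" if "f \<in> ?R" "g \<in> ?R" "\<psi> 1 f = f" "\<psi> 1 g = g" for f g
      using that \<psi>(1)[of 1] unfolding algebra_endo_def by simp
  qed
  have aut: "dual_map X (\<psi> c) \<in> automorphisms X" if "c \<noteq> 0" for c
    by (rule dual_map_automorphism[OF X \<psi>(1) \<psi>(1), of _ "inverse c"])
      (use that comp id in simp_all)
  define \<phi> where "\<phi> t = dual_map X (\<psi> (t 0))" for t :: "nat \<Rightarrow> 'a"
  interpret A: group "Aut X" by (rule group_Aut)
  have hom: "\<phi> \<in> hom (torus (Suc 0)) (Aut X)"
  proof (rule homI)
    fix t u :: "nat \<Rightarrow> 'a" assume "t \<in> carrier (torus (Suc 0))" "u \<in> carrier (torus (Suc 0))"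
    then have tu: "t 0 \<noteq> 0" "u 0 \<noteq> 0" unfolding torus_one_iff by blast+
    have "\<phi> (t \<otimes>\<^bsub>torus (Suc 0)\<^esub> u) = dual_map X (\<psi> (t 0 * u 0))"
      by (simp add: \<phi>_def torus_def)
    also have "\<dots> = compose X (\<phi> t) (\<phi> u)"
      unfolding \<phi>_def using dual_map_compose[OF X \<psi>(1)[OF tu(1)] \<psi>(1)[OF tu(2)], of "\<psi> (t 0 * u 0)"] comp[OF tu] by simp
    also have "\<dots> = \<phi> t \<otimes>\<^bsub>Aut X\<^esub> \<phi> u"
      unfolding \<phi>_def by (rule mult_Aut[symmetric]) (rule aut, rule tu)+
    finally show "\<phi> (t \<otimes>\<^bsub>torus (Suc 0)\<^esub> u) = \<phi> t \<otimes>\<^bsub>Aut X\<^esub> \<phi> u" .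
  qed (use aut in \<open>auto simp: \<phi>_def carrier_Aut torus_one_iff\<close>)
  interpret h: group_hom "torus (Suc 0)" "Aut X" \<phi>
    by (rule group_hom.intro[OF group_torus group_Aut]) (simp add: group_hom_axioms_def hom)
  define H where "H = \<phi> ` carrier (torus (Suc 0))"
  have sub: "subgroup H (Aut X)" unfolding H_def by (rule h.img_is_subgroup)
  have inj: "inj_on \<phi> (carrier (torus (Suc 0)))"
  proof (rule inj_onI)
    fix t u :: "nat \<Rightarrow> 'a" assume tu: "t \<in> carrier (torus (Suc 0))" "u \<in> carrier (torus (Suc 0))" "\<phi> t = \<phi> u"
    then have nz: "t 0 \<noteq> 0" "u 0 \<noteq> 0" unfolding torus_one_iff by blast+
    \<comment> \<open>Comparing the two equal automorphisms on a nonzero function of degree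
      \<open>i\<close>, at a point where it does not vanish.\<close>
    have "(t 0 / u 0) powi \<rho> i = 1" if i: "i \<in> \<Lambda>" for i
    proof -
      obtain f where f: "f \<in> E i" "f \<noteq> 0"
        using \<Lambda>(2)[OF i] fv.subspace_0[OF direct_sumD(1)[OF E, of i]] by blast
      then obtain x where x: "f x \<noteq> 0" by (auto simp: fun_eq_iff fun_simps)
      then have "x \<in> X" using regular_ring_off[OF EX[OF f(1)]] by blast
      then have "f (\<phi> t x) = (t 0) powi \<rho> i * f x" "f (\<phi> u x) = (u 0) powi \<rho> i * f x"
        unfolding \<phi>_def using dual_map_apply[OF X \<psi>(1) _ EX[OF f(1)]] \<psi>(2)[OF _ f(1)] nz
        by (simp_all add: fscale_apply)
      then have "(t 0) powi \<rho> i = (u 0) powi \<rho> i" using tu(3) x by simp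
      then show ?thesis using nz by (simp add: power_int_divide_distrib)
    qed
    then have "(t 0 / u 0) powi Gcd (\<rho> ` \<Lambda>) = 1"
      using nz \<Lambda>(1) by (intro power_int_Gcd) auto
    then have "t 0 = u 0" using nz \<Lambda>(3) by simp
    then have "t i = u i" for i using tu(1,2) unfolding torus_one_iff by (cases i) auto
    then show "t = u" by blast
  qed
  have "regular_map (carrier (torus (Suc 0)) \<times> X) (prod_coords (torus_coords (Suc 0)) affine_coords) X (\<lambda>(t, x). \<phi> t x)"
    unfolding regular_map_iff
  proof (intro conjI allI)
    show "(\<lambda>(t, x). \<phi> t x) \<in> carrier (torus (Suc 0)) \<times> X \<rightarrow> X"
      unfolding \<phi>_def using dual_map_mem[OF X \<psi>(1)] by (auto simp: torus_one_iff)
    fix k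
    let ?G = "prod_coords (torus_coords (Suc 0)) affine_coords :: ((nat \<Rightarrow> 'a) \<times> ('a ^ 'n) \<Rightarrow> 'a) set"
    obtain F h where F: "finite F" "\<forall>i\<in>F. h i \<in> E i" "coord_fun X k = sum h F"
      using direct_sumD(3)[OF E coord_fun_regular_ring, of k] by blast
    have \<psi>sum: "\<psi> c (sum h G) = (\<Sum>i\<in>G. fscale (c powi \<rho> i) (h i)) \<and> sum h G \<in> ?R" if "finite G" "G \<subseteq> F" "c \<noteq> 0" for c G
      using that
    proof (induction G rule: finite_induct)
      case empty
      have "\<psi> c 0 = 0" 
        using \<psi>(2)[OF \<open>c \<noteq> 0\<close>, of 0 0] fv.subspace_0[OF direct_sumD(1)[OF E]] by simp
      then show ?case by (simp only: sum.empty zero_regular_ring simp_thms)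
    next
      case (insert i G)
      then have "h i \<in> E i" "h i \<in> ?R" "sum h G \<in> ?R" using F(2) EX by blast+
      then have "\<psi> c (h i + sum h G) = fscale (c powi \<rho> i) (h i) + \<psi> c (sum h G) \<and> h i + sum h G \<in> ?R"
        using \<psi>(1)[OF \<open>c \<noteq> 0\<close>] \<psi>(2)[OF \<open>c \<noteq> 0\<close>] by (simp add: algebra_endo_def regular_ring_add)
      then show ?case using insert by (simp only: sum.insert insert_subset simp_thms)
    qed
    \<comment> \<open>A coordinate function has finitely many components, so its pullback is a
      Laurent polynomial in the torus coordinate with coefficients in the ring.\<close>
    have "regular_on (carrier (torus (Suc 0)) \<times> X) ?G (\<lambda>z. \<Sum>i\<in>F. (fst z 0) powi \<rho> i * h i (snd z))"
      using F(2) EX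
      by (intro regular_on_sum regular_on_mult regular_on_fst[OF torus_coord_power] regular_on_snd regular_ring_regular)
        auto
    then show "regular_on (carrier (torus (Suc 0)) \<times> X) ?G (\<lambda>z. (case z of (t, x) \<Rightarrow> \<phi> t x) $ k)"
      by (rule regular_on_cong[rotated])
        (auto simp: \<phi>_def dual_map_def torus_one_iff F(3) \<psi>sum[OF F(1) subset_refl] fun_simps)
  qed
  moreover have "\<phi> \<in> iso (torus (Suc 0)) (Aut X\<lparr>carrier := H\<rparr>)"
    using hom inj by (auto simp: iso_def hom_def bij_betw_def H_def)
  ultimately have "subtorus X H"
    unfolding subtorus_def torus_structure_def using sub by blast
  moreover have "\<exists>t\<in>H. \<forall>i. \<forall>f\<in>E i. \<forall>x\<in>X. f (t x) = c powi \<rho> i * f x" if "c \<noteq> 0" for c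
  proof (rule bexI)
    let ?t = "\<lambda>i::nat. if i = 0 then c else 1"
    show "\<phi> ?t \<in> H" unfolding H_def by (rule imageI) (use that in \<open>auto simp: torus_one_iff\<close>)
    show "\<forall>i. \<forall>f\<in>E i. \<forall>x\<in>X. f (\<phi> ?t x) = c powi \<rho> i * f x"
      using dual_map_apply[OF X \<psi>(1)[OF that] _ EX] \<psi>(2)[OF that] by (simp add: \<phi>_def fscale_apply)
  qed
  ultimately show ?thesis using that by blast
qed

text \<open>The degrees that occur in the coordinate functions generate all others: the components
  with degree in the generated monoid span a subalgebra that contains the constants and the
  coordinates, hence everything.\<close>

lemma direct_sum_component_nat_span:
  fixes E :: "'k::comm_monoid_add \<Rightarrow> ('a::field ^ 'n::finite \<Rightarrow> 'a) set"
  assumes E: "direct_sum (regular_ring X) E"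
    and mult: "\<And>i j f g. f \<in> E i \<Longrightarrow> g \<in> E j \<Longrightarrow> f * g \<in> E (i + j)" and one: "cind X \<in> E 0"
  obtains \<Lambda> where "finite \<Lambda>" "\<forall>i\<in>\<Lambda>. E i \<noteq> {0}" "\<forall>i. E i \<noteq> {0} \<longrightarrow> i \<in> nat_span \<Lambda>"
proof -
  let ?R = "regular_ring X"
  have E0: "0 \<in> E i" for i by (rule fv.subspace_0[OF direct_sumD(1)[OF E]])
  have EX: "f \<in> ?R" if "f \<in> E i" for f i using direct_sumD(2)[OF E] that by blast
  have "\<exists>F h. finite F \<and> (\<forall>i\<in>F. h i \<in> E i) \<and> coord_fun X k = sum h F" for k
    by (rule direct_sumD(3)[OF E coord_fun_regular_ring])
  then obtain F h where Fh: "\<And>k. finite (F k)" "\<And>k i. i \<in> F k \<Longrightarrow> h k i \<in> E i"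
    "\<And>k. coord_fun X k = sum (h k) (F k)" by metis
  define \<Lambda> where "\<Lambda> = (\<Union>k. {i \<in> F k. h k i \<noteq> 0})"
  define S where "S = fv.span (\<Union>i\<in>nat_span \<Lambda>. E i)"
  have "S \<subseteq> ?R" unfolding S_def by (rule fv.span_minimal[OF _ subspace_regular_ring]) (use EX in blast)
  have Smult: "f * g \<in> S" if "f \<in> S" "g \<in> S" for f g
    unfolding S_def
  proof (rule fv_span_mult[OF that[unfolded S_def]])
    fix x y assume "x \<in> (\<Union>i\<in>nat_span \<Lambda>. E i)" "y \<in> (\<Union>i\<in>nat_span \<Lambda>. E i)"
    then obtain i j where ij: "i \<in> nat_span \<Lambda>" "x \<in> E i" "j \<in> nat_span \<Lambda>" "y \<in> E j"
      by (elim UN_E)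
    then have "x * y \<in> (\<Union>i\<in>nat_span \<Lambda>. E i)"
      by (intro UN_I[OF nat_span.add[OF ij(1,3)]] mult)
    then show "x * y \<in> fv.span (\<Union>i\<in>nat_span \<Lambda>. E i)" by (rule fv.span_base)
  qed
  have Sadd: "f + g \<in> S" if "f \<in> S" "g \<in> S" for f g
    using that unfolding S_def by (rule fv.span_add)
  have RS: "f \<in> S" if "f \<in> ?R" for f
    using that
  proof (rule regular_ring_induct)
    have "cind X \<in> S" unfolding S_def using one nat_span.zero by (blast intro: fv.span_base)
    then show "fscale c (cind X) \<in> S" for c unfolding S_def by (rule fv.span_scale)
    show "coord_fun X k \<in> S" for k
      unfolding Fh(3) S_def
    proof (rule fv.span_sum)
      fix i assume i: "i \<in> F k"
      show "h k i \<in> fv.span (\<Union>i\<in>nat_span \<Lambda>. E i)"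
      proof (cases "h k i = 0")
        case True
        then show ?thesis using fv.span_zero by (simp only:)
      next
        case False
        then have "i \<in> nat_span \<Lambda>" using i by (auto simp: \<Lambda>_def intro!: nat_span.base)
        then show ?thesis using Fh(2)[OF i] by (blast intro: fv.span_base)
      qed
    qed
  qed (auto intro: Smult Sadd)
  have comp: "\<exists>G k. finite G \<and> G \<subseteq> nat_span \<Lambda> \<and> (\<forall>i\<in>G. k i \<in> E i) \<and> f = sum k G" if "f \<in> S" for f
    using that unfolding S_def
  proof (induction rule: fv.span_induct_alt)
    case base
    show ?case by (intro exI[of _ "{}"]) simp
  next
    case (step c x y)
    then obtain j G k where jGk: "j \<in> nat_span \<Lambda>" "x \<in> E j" "finite G" "G \<subseteq> nat_span \<Lambda>" "\<forall>i\<in>G. k i \<in> E i" "y = sum k G"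
      by blast
    define k' where "k' i = (if i \<in> G then k i else 0) + (if i = j then fscale c x else 0)" for i
    have "sum k' (insert j G) = (\<Sum>i\<in>insert j G. if i \<in> G then k i else 0) + (\<Sum>i\<in>insert j G. if i = j then fscale c x else 0)"
      unfolding k'_def by (rule sum.distrib)
    also have "(\<Sum>i\<in>insert j G. if i \<in> G then k i else 0) = sum k G"
      using jGk(3) by (intro sum.mono_neutral_cong_right) auto
    also have "(\<Sum>i\<in>insert j G. if i = j then fscale c x else 0) = fscale c x"
      using jGk(3) by (subst sum.delta) auto
    finally have "fscale c x + y = sum k' (insert j G)" using jGk(6) by (simp only: add.commute)
    moreover have "k' i \<in> E i" if "i \<in> insert j G" for i
      unfolding k'_def using jGk that E0 direct_sumD(1)[OF E]
      by (intro fv.subspace_add[OF direct_sumD(1)[OF E]]) (auto intro: fv.subspace_scale)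
    ultimately show ?case using jGk(1,3,4) by (intro exI[of _ "insert j G"] exI[of _ k']) auto
  qed
  show ?thesis
  proof (rule that[of \<Lambda>])
    show "finite \<Lambda>" unfolding \<Lambda>_def using Fh(1) by simp
    show "\<forall>i\<in>\<Lambda>. E i \<noteq> {0}" using Fh(2) by (auto simp: \<Lambda>_def)
    show "\<forall>i. E i \<noteq> {0} \<longrightarrow> i \<in> nat_span \<Lambda>"
    proof (intro allI impI)
      fix i assume i: "E i \<noteq> {0}"
      obtain f where f: "f \<in> E i" "f \<noteq> 0" using i E0 by blast
      obtain G k where G: "finite G" "G \<subseteq> nat_span \<Lambda>" "\<forall>i\<in>G. k i \<in> E i" "f = sum k G"
        using comp[OF RS[OF EX[OF f(1)]]] by blast
      have "(if i \<in> {i} then f else 0) = (if i \<in> G then k i else 0)"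
        by (rule direct_sum_unique[OF E, of "{i}" "\<lambda>_. f" G k]) (use f G in auto)
      then have "i \<in> G" using f(2) by (auto split: if_splits)
      then show "i \<in> nat_span \<Lambda>" using G(2) by blast
    qed
  qed
qed

section \<open>The grading by the eigenvalues of a derivation\<close>

lemma derivation_linear_operator: "derivation_on X D \<Longrightarrow> linear_operator (regular_ring X) D"
  unfolding derivation_on_def by unfold_locales (auto simp: subspace_regular_ring)

text \<open>\<open>shift (i + j)\<close> satisfies the product rule
  \<open>shift i f * g + f * shift j g\<close>, so its iterates on \<open>f * g\<close> vanish as
  soon as the number of steps is the sum of the two exponents.\<close>

lemma derivation_eigen_mult:
  assumes D: "derivation_on X D" 
    and f: "f \<in> linear_operator.eigen (regular_ring X) D i"
    and g: "g \<in> linear_operator.eigen (regular_ring X) D j"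
  shows "f * g \<in> linear_operator.eigen (regular_ring X) D (i + j)"
proof -
  let ?R = "regular_ring X"
  interpret linear_operator ?R D by (rule derivation_linear_operator[OF D])
  have *: "(shift (i + j) ^^ n) (f * g) = 0"
    if "f \<in> ?R" "g \<in> ?R" "(shift i ^^ k) f = 0" "(shift j ^^ l) g = 0" "n = k + l" for n k l f g
    using that
  proof (induction n arbitrary: k l f g)
    case 0
    then have "f * g = 0" by auto
    then show ?case by simp
  next
    case (Suc n)
    consider "k = 0" | "l = 0" | k' l' where "k = Suc k'" "l = Suc l'" by (cases k; cases l) auto
    then show ?case
    proof cases
      case 1
      then have "f * g = 0" using Suc.prems(3) by auto
      then show ?thesis using pow_zero[of "Suc n" "i + j"] by (simp only:)
    next
      case 2
      then have "f * g = 0" using Suc.prems(4) by auto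
      then show ?thesis using pow_zero[of "Suc n" "i + j"] by (simp only:)
    next
      case 3
      have m: "shift i f \<in> ?R" "shift j g \<in> ?R" using Suc.prems(1,2) shift_mem by blast+
      have "D (f * g) = D f * g + f * D g" using D Suc.prems(1,2) unfolding derivation_on_def by blast
      then have "shift (i + j) (f * g) = shift i f * g + f * shift j g"
        unfolding shift_def by (simp add: fv.scale_left_distrib left_diff_distrib right_diff_distrib fscale_mult_left fscale_mult_right)
      moreover have "(shift (i + j) ^^ n) (shift i f * g) = 0"
        by (rule Suc.IH[OF m(1) Suc.prems(2), of k' l]) (use 3 Suc.prems in \<open>auto simp: funpow_Suc_right simp del: funpow.simps\<close>)
      moreover have "(shift (i + j) ^^ n) (f * shift j g) = 0"
        by (rule Suc.IH[OF Suc.prems(1) m(2), of k l']) (use 3 Suc.prems in \<open>auto simp: funpow_Suc_right simp del: funpow.simps\<close>)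
      ultimately have "(shift (i + j) ^^ n) (shift (i + j) (f * g)) = 0"
        using pow_add[OF regular_ring_mult[OF m(1) Suc.prems(2)] regular_ring_mult[OF Suc.prems(1) m(2)]] by simp
      then show ?thesis by (simp add: funpow_Suc_right del: funpow.simps)
    qed
  qed
  obtain k l where kl: "(shift i ^^ k) f = 0" "(shift j ^^ l) g = 0" "f \<in> ?R" "g \<in> ?R"
    using f g by (auto simp: eigen_def)
  from *[OF kl(3,4,1,2) refl] show ?thesis
    unfolding eigen_def using regular_ring_mult[OF kl(3,4)] by blast
qed

text \<open>Each \<open>W u\<close> is finite-dimensional and stable under \<open>D\<close>, so it
  decomposes by itself; the eigenspaces of the whole ring then collect the pieces.\<close>

lemma locally_finite_direct_sum_eigen:
  fixes X :: "('a::alg_closed_field ^ 'n) set"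
  assumes D: "linear_operator (regular_ring X) D" and W: "direct_sum (regular_ring X) W"
    and fin: "\<And>u. \<exists>B. finite B \<and> W u \<subseteq> fv.span B" and DW: "\<And>u f. f \<in> W u \<Longrightarrow> D f \<in> W u"
  shows "f \<in> W u \<Longrightarrow> \<exists>F h. finite F \<and> (\<forall>i\<in>F. h i \<in> linear_operator.eigen (regular_ring X) D i \<inter> W u) \<and> f = sum h F"
    and "direct_sum (regular_ring X) (linear_operator.eigen (regular_ring X) D)"
proof -
  let ?R = "regular_ring X"
  interpret linear_operator ?R D by (rule D)
  have WX: "f \<in> ?R" if "f \<in> W u" for f u using direct_sumD(2)[OF W] that by blast
  show *: "\<exists>F h. finite F \<and> (\<forall>i\<in>F. h i \<in> eigen i \<inter> W u) \<and> f = sum h F" if f: "f \<in> W u" for f u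
  proof -
    interpret V: linear_operator "W u" D
      by unfold_locales (use direct_sumD(1)[OF W] DW D_add D_scale WX in auto)
    obtain B where B: "finite B" "W u \<subseteq> fv.span B" using fin by blast
    obtain F h where "finite F" "\<forall>i\<in>F. h i \<in> V.eigen i" "f = sum h F"
      using V.eigen_decomposition[OF B f alg_closed_imp_poly_has_root] by blast
    moreover have "V.eigen i \<subseteq> eigen i \<inter> W u" for i
      unfolding V.eigen_def eigen_def using WX by auto
    ultimately show ?thesis by blast
  qed
  show "direct_sum ?R eigen"
    unfolding direct_sum_def
  proof (intro conjI allI ballI impI)
    show "fv.subspace (eigen i)" "eigen i \<subseteq> ?R" for i using subspace_eigen eigen_subset by auto
    show "h i = 0" if "finite F" "\<forall>i\<in>F. h i \<in> eigen i" "sum h F = 0" "i \<in> F" for F h i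
      using eigen_independent[of F h i] that by blast
    show "\<exists>F h. finite F \<and> (\<forall>i\<in>F. h i \<in> eigen i) \<and> f = sum h F" if "f \<in> ?R" for f
    proof (rule direct_sum_induct[OF W that _ _ A])
      show "\<exists>F h. finite F \<and> (\<forall>i\<in>F. h i \<in> eigen i) \<and> f = sum h F" if "f \<in> W u" for f u
        using *[OF that] by blast
      fix f g assume "\<exists>F h. finite F \<and> (\<forall>i\<in>F. h i \<in> eigen i) \<and> f = sum h F"
        "\<exists>F h. finite F \<and> (\<forall>i\<in>F. h i \<in> eigen i) \<and> g = sum h F"
      then obtain F h G k where Fh: "finite F" "\<forall>i\<in>F. h i \<in> eigen i" "f = sum h F"
        "finite G" "\<forall>i\<in>G. k i \<in> eigen i" "g = sum k G" by (elim exE conjE) 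
      define h' where "h' = (\<lambda>i. if i \<in> F then h i else 0)"
      define k' where "k' = (\<lambda>i. if i \<in> G then k i else 0)"
      have "sum h' (F \<union> G) = f" "sum k' (F \<union> G) = g"
        unfolding h'_def k'_def Fh using Fh(1,4) by (auto intro!: sum.mono_neutral_cong_right)
      then have "f + g = (\<Sum>i\<in>F \<union> G. h' i + k' i)" by (simp add: sum.distrib)
      moreover have "h' i + k' i \<in> eigen i" for i
        unfolding h'_def k'_def using Fh(2,5) fv.subspace_0[OF subspace_eigen]
        by (intro fv.subspace_add[OF subspace_eigen]) auto
      ultimately show "\<exists>F h. finite F \<and> (\<forall>i\<in>F. h i \<in> eigen i) \<and> f + g = sum h F"
        using Fh(1,4) by (intro exI[of _ "F \<union> G"] exI[of _ "\<lambda>i. h' i + k' i"]) simp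
    qed
  qed
qed

text \<open>The nilpotent part of \<open>D\<close> is again a derivation, which rigidity forces to vanish.\<close>

lemma rigid_derivation_semisimple:
  fixes X :: "('a::field_char_0 ^ 'n) set"
  assumes X: "zariski_closed X" and "rigid X" and D: "derivation_on X D"
    and E: "direct_sum (regular_ring X) (linear_operator.eigen (regular_ring X) D)"
    and f: "f \<in> linear_operator.eigen (regular_ring X) D c"
  shows "D f = fscale c f"
proof -
  let ?R = "regular_ring X"
  interpret linear_operator ?R D by (rule derivation_linear_operator[OF D])
  have EX: "f \<in> ?R" if "f \<in> eigen i" for f i using that eigen_subset by blast
  obtain S where S: "\<And>f. f \<in> ?R \<Longrightarrow> S f \<in> ?R" 
    "\<And>f g. f \<in> ?R \<Longrightarrow> g \<in> ?R \<Longrightarrow> S (f + g) = S f + S g"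
    "\<And>c f. f \<in> ?R \<Longrightarrow> S (fscale c f) = fscale c (S f)"
    "\<And>i f. f \<in> eigen i \<Longrightarrow> S f = fscale i f"
    using direct_sum_multiplier[OF E subspace_regular_ring, of "\<lambda>i. i"] by blast
  \<comment> \<open>The semisimple part is a derivation because eigenvalues add up under
    multiplication. The rule is proved for homogeneous factors and extended linearly, one factor at
    a time.\<close>
  have S1: "S (f * g) = S f * g + f * S g" if "f \<in> eigen i" "g \<in> ?R" for f g i
  proof (rule direct_sum_induct[OF E \<open>g \<in> ?R\<close> _ _ subspace_regular_ring])
    show "S (f * g) = S f * g + f * S g" if "g \<in> eigen j" for g j
      unfolding S(4)[OF derivation_eigen_mult[OF D \<open>f \<in> eigen i\<close> that]] S(4)[OF that] S(4)[OF \<open>f \<in> eigen i\<close>]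
      by (simp add: fscale_mult_left fscale_mult_right fv.scale_left_distrib)
    show "S (f * (g + h)) = S f * (g + h) + f * S (g + h)"
      if "g \<in> ?R" "h \<in> ?R" "S (f * g) = S f * g + f * S g" "S (f * h) = S f * h + f * S h" for g h
      using that S(2)[OF regular_ring_mult[OF EX[OF \<open>f \<in> eigen i\<close>] that(1)] regular_ring_mult[OF EX[OF \<open>f \<in> eigen i\<close>] that(2)]] S(2)[OF that(1,2)]
      by (simp add: distrib_left add_ac)
  qed
  have S2: "S (f * g) = S f * g + f * S g" if "f \<in> ?R" "g \<in> ?R" for f g
  proof (rule direct_sum_induct[OF E \<open>f \<in> ?R\<close> _ _ subspace_regular_ring])
    show "S (f * g) = S f * g + f * S g" if "f \<in> eigen i" for f i by (rule S1[OF that \<open>g \<in> ?R\<close>])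
    show "S ((f + h) * g) = S (f + h) * g + (f + h) * S g"
      if "f \<in> ?R" "h \<in> ?R" "S (f * g) = S f * g + f * S g" "S (h * g) = S h * g + h * S g" for f h
      using that S(2)[OF regular_ring_mult[OF that(1) \<open>g \<in> ?R\<close>] regular_ring_mult[OF that(2) \<open>g \<in> ?R\<close>]] S(2)[OF that(1,2)]
      by (simp add: distrib_right add_ac)
  qed
  define N where "N f = D f - S f" for f
  have N: "N f \<in> ?R" "N (f + g) = N f + N g" "N (f * g) = N f * g + f * N g" "N (fscale c f) = fscale c (N f)"
    if "f \<in> ?R" "g \<in> ?R" for f g c
  proof -
    have "D (f * g) = D f * g + f * D g" using D that unfolding derivation_on_def by blast
    then show "N (f * g) = N f * g + f * N g"
      unfolding N_def S2[OF that] by (simp add: left_diff_distrib right_diff_distrib)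
  qed (use that S D_add D_scale D_mem in \<open>auto simp: N_def fv.scale_right_diff_distrib intro: fv.subspace_diff[OF subspace_regular_ring]\<close>)
  have Npow: "(N ^^ k) f \<in> ?R" if "f \<in> ?R" for f k
    by (induction k) (use that N(1) in auto)
  have Nadd: "(N ^^ k) (f + g) = (N ^^ k) f + (N ^^ k) g" if "f \<in> ?R" "g \<in> ?R" for f g k
    by (induction k) (use that N(2) Npow in auto)
  have N0: "(N ^^ k) 0 = 0" for k
    using Nadd[OF zero_regular_ring zero_regular_ring, of k] by simp
  have Nvan: "(N ^^ k) f = 0" if "(N ^^ m) f = 0" "m \<le> k" for m k f
  proof -
    have "(N ^^ k) f = (N ^^ (k - m)) ((N ^^ m) f)"
      using that(2) by (simp flip: funpow_add o_apply[of "N ^^ _" "N ^^ _"])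
    then show ?thesis unfolding that(1) N0 .
  qed
  have nil: "\<exists>k. (N ^^ k) f = 0" if "f \<in> ?R" for f
  proof (rule direct_sum_induct[OF E that _ _ subspace_regular_ring])
    show "\<exists>k. (N ^^ k) f = 0" if f: "f \<in> eigen i" for f i
    proof -
      \<comment> \<open>On \<open>eigen i\<close> the nilpotent part is \<open>shift i\<close>, so
        local nilpotency is the definition of the generalized eigenspace.\<close>
      have "(N ^^ k) f = (shift i ^^ k) f \<and> (shift i ^^ k) f \<in> eigen i" for k
      proof (induction k)
        case (Suc k)
        then have "S ((shift i ^^ k) f) = fscale i ((shift i ^^ k) f)" by (intro S(4)) (rule conjunct2)
        then have "N ((shift i ^^ k) f) = shift i ((shift i ^^ k) f)"
          by (simp only: N_def shift_def)
        then show ?case using Suc shift_eigen by simp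
      qed (use f in simp)
      then show ?thesis using f unfolding eigen_def by auto
    qed
    fix f g assume fg: "f \<in> ?R" "g \<in> ?R" "\<exists>k. (N ^^ k) f = 0" "\<exists>k. (N ^^ k) g = 0"
    then obtain k l where kl: "(N ^^ k) f = 0" "(N ^^ l) g = 0" by blast
    have "(N ^^ (max k l)) (f + g) = 0"
      unfolding Nadd[OF fg(1,2)] Nvan[OF kl(1) max.cobounded1] Nvan[OF kl(2) max.cobounded2] by (rule add_0)
    then show "\<exists>k. (N ^^ k) (f + g) = 0" by blast
  qed
  interpret N: nilpotent_derivation X N
    by unfold_locales (use X N nil zero_regular_ring[of X] in \<open>auto simp: derivation_on_def\<close>)
  have "N f = 0" by (rule N.rigid_imp_zero[OF \<open>rigid X\<close> EX[OF f]])
  then show ?thesis unfolding N_def S(4)[OF f] by (simp only: right_minus_eq)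
qed

text \<open>\<open>TW\<close> is what links \<open>T\<close> to \<open>W\<close>: the subtorus built
  from the eigenvalue grading lies in \<open>T\<close> by maximality and is therefore forced to act
  on \<open>W u\<close> by a single scalar.\<close>

lemma derivation_scalar_on_weight_spaces:
  fixes X :: "('a::{alg_closed_field, field_char_0} ^ 'n::finite) set"
  assumes X: "zariski_closed X" and "rigid X" and T: "maximal_torus X T" and D: "derivation_on X D"
    and W: "direct_sum (regular_ring X) W" and fin: "\<And>u. \<exists>B. finite B \<and> W u \<subseteq> fv.span B"
    and DW: "\<And>u f. f \<in> W u \<Longrightarrow> D f \<in> W u"
    and TW: "\<And>t u. t \<in> T \<Longrightarrow> \<exists>c. \<forall>f\<in>W u. \<forall>x\<in>X. f (t x) = c * f x"
  shows "\<exists>c. \<forall>f\<in>W u. D f = fscale c f"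
proof -
  let ?R = "regular_ring X"
  interpret linear_operator ?R D by (rule derivation_linear_operator[OF D])
  have WX: "f \<in> ?R" if "f \<in> W u" for f u using direct_sumD(2)[OF W] that by blast
  have dec: "\<exists>F h. finite F \<and> (\<forall>i\<in>F. h i \<in> eigen i \<inter> W u) \<and> f = sum h F" if "f \<in> W u" for f u
    by (rule locally_finite_direct_sum_eigen(1)[OF derivation_linear_operator[OF D] W fin _ that]) (rule DW)
  have E: "direct_sum ?R eigen"
    by (rule locally_finite_direct_sum_eigen(2)[OF derivation_linear_operator[OF D] W fin]) (rule DW)
  note mult = derivation_eigen_mult[OF D]
  \<comment> \<open>The unit is idempotent, so \<open>D\<close> annihilates it and it has degree 0
    in the eigenvalue grading.\<close>
  have "D (cind X * cind X) = D (cind X) * cind X + cind X * D (cind X)"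
    using D cind_regular_ring unfolding derivation_on_def by blast
  then have "D (cind X) = D (cind X) + D (cind X)"
    using cind_mult[OF cind_regular_ring, of X] cind_mult[OF D_mem[OF cind_regular_ring]]
    by (simp add: mult.commute)
  then have "D (cind X) = 0" by (metis add_cancel_right_right)
  then have "(shift 0 ^^ 1) (cind X) = 0" by (simp add: shift_def)
  then have one: "cind X \<in> eigen 0" unfolding eigen_def using cind_regular_ring by blast
  have unique: "i = j" if fg: "f \<in> eigen i \<inter> W u" "g \<in> eigen j \<inter> W u" "f \<noteq> 0" "g \<noteq> 0" for f g i j
  proof (rule ccontr)
    assume "i \<noteq> j"
    obtain \<Lambda> where \<Lambda>: "finite \<Lambda>" "\<forall>i\<in>\<Lambda>. eigen i \<noteq> {0}" "\<forall>i. eigen i \<noteq> {0} \<longrightarrow> i \<in> nat_span \<Lambda>"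
      by (rule direct_sum_component_nat_span[OF E mult one]; (rule that)?; assumption)
    have ij: "i \<in> nat_span \<Lambda>" "j \<in> nat_span \<Lambda>" using \<Lambda>(3) fg by blast+
    obtain \<rho> :: "'a \<Rightarrow> int" where \<rho>: "\<rho> 0 = 0 \<and> \<rho> i \<noteq> \<rho> j \<and> Gcd (\<rho> ` \<Lambda>) = 1 \<and>
      (\<forall>x\<in>nat_span \<Lambda>. \<forall>y\<in>nat_span \<Lambda>. \<rho> (x + y) = \<rho> x + \<rho> y)"
      by (rule exE[OF separating_integer_functional[OF \<Lambda>(1) ij \<open>i \<noteq> j\<close>]])
    then have \<rho>0: "\<rho> 0 = 0" and \<rho>ij: "\<rho> i \<noteq> \<rho> j" and \<rho>1: "Gcd (\<rho> ` \<Lambda>) = 1" by blast+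
    have \<rho>add: "\<rho> (a + b) = \<rho> a + \<rho> b" if "eigen a \<noteq> {0}" "eigen b \<noteq> {0}" for a b
      using that \<Lambda>(3) \<rho> by blast
    obtain H where H: "subtorus X H"
      "\<forall>c. c \<noteq> 0 \<longrightarrow> (\<exists>t\<in>H. \<forall>i. \<forall>f\<in>eigen i. \<forall>x\<in>X. f (t x) = c powi \<rho> i * f x)"
      by (rule grading_subtorus[OF X E mult one \<rho>0 \<rho>add \<Lambda>(1) bspec[OF \<Lambda>(2)] \<rho>1]; (rule that)?; assumption)
    \<comment> \<open>In characteristic zero 2 has infinite multiplicative order, so this single
      element of the subtorus tells different exponents apart.\<close>
    have "(2 :: 'a) \<noteq> 0" by simp
    then obtain t where t: "t \<in> H" "\<forall>i. \<forall>f\<in>eigen i. \<forall>x\<in>X. f (t x) = 2 powi \<rho> i * f x"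
      using H(2) by blast
    have "t \<in> T" using T H(1) t(1) unfolding maximal_torus_def by blast
    then obtain c where c: "\<forall>f\<in>W u. \<forall>x\<in>X. f (t x) = c * f x" using TW by blast
    have val: "c = 2 powi \<rho> k" if h: "h \<in> eigen k \<inter> W u" "h \<noteq> 0" for h k
    proof -
      obtain x where x: "h x \<noteq> 0" using h(2) by (auto simp: fun_eq_iff fun_simps)
      then have "x \<in> X" using regular_ring_off[OF WX] h(1) by blast
      then have "c * h x = 2 powi \<rho> k * h x" using c t(2) h(1) by (metis IntD1 IntD2)
      then show ?thesis using x by simp
    qed
    show False using val[OF fg(1,3)] val[OF fg(2,4)] \<rho>ij two_power_int_eq by metis
  qed
  show ?thesis
  proof (cases "\<exists>f\<in>W u. f \<noteq> 0")
    case False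
    then have "D f = fscale 0 f" if "f \<in> W u" for f using that D_zero by auto
    then show ?thesis by blast
  next
    case True
    then obtain f0 where f0: "f0 \<in> W u" "f0 \<noteq> 0" by blast
    obtain F h where Fh: "finite F" "\<forall>i\<in>F. h i \<in> eigen i \<inter> W u" "f0 = sum h F" using dec[OF f0(1)] by blast
    have "\<exists>i\<in>F. h i \<noteq> 0" using Fh(3) f0(2) by (metis sum.neutral)
    then obtain i0 where i0: "i0 \<in> F" "h i0 \<noteq> 0" by blast
    have "D f = fscale i0 f" if f: "f \<in> W u" for f
    proof -
      obtain G k where Gk: "finite G" "\<forall>i\<in>G. k i \<in> eigen i \<inter> W u" "f = sum k G" using dec[OF f] by blast
      have "k i \<in> eigen i0" if "i \<in> G" for i
      proof (cases "k i = 0")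
        case True
        then show ?thesis using fv.subspace_0[OF subspace_eigen] by (simp only:)
      next
        case False
        have "i = i0" by (rule unique[of "k i" i "h i0" i0]) (use Gk(2) that Fh(2) i0 False in auto)
        then show ?thesis using Gk(2) that by blast
      qed
      \<comment> \<open>All of \<open>W u\<close> lies in one generalized eigenspace, on which
        rigidity leaves no nilpotent part.\<close>
      then have "f \<in> eigen i0" unfolding Gk(3) by (rule fv.subspace_sum[OF subspace_eigen])
      then show ?thesis by (rule rigid_derivation_semisimple[OF X \<open>rigid X\<close> D E])
    qed
    then show ?thesis by blast
  qed
qed

section \<open>The weight decomposition of a torus action\<close>

definition tmonom :: "nat \<Rightarrow> (nat \<Rightarrow> int) \<Rightarrow> (nat \<Rightarrow> 'a::field) \<Rightarrow> 'a" where
  "tmonom s u t = (\<Prod>i<s. t i powi u i)"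

definition weights :: "nat \<Rightarrow> (nat \<Rightarrow> int) set" where
  "weights s = {u. \<forall>i\<ge>s. u i = 0}"

lemma weights_simps: "0 \<in> weights s" "u \<in> weights s \<Longrightarrow> v \<in> weights s \<Longrightarrow> u + v \<in> weights s"
  "u \<in> weights s \<Longrightarrow> - u \<in> weights s"
  by (auto simp: weights_def fun_simps)

lemma torus_nonzero: "t \<in> carrier (torus s) \<Longrightarrow> t i \<noteq> 0"
  by (cases "i < s") (auto simp: torus_def)

lemma tmonom_zero: "tmonom s 0 t = 1"
  by (simp add: tmonom_def fun_simps)

lemma tmonom_add: "t \<in> carrier (torus s) \<Longrightarrow> tmonom s (u + v) t = tmonom s u t * tmonom s v t"
  by (simp add: tmonom_def fun_simps power_int_add torus_nonzero prod.distrib)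

lemma tmonom_mult: "tmonom s u (t \<otimes>\<^bsub>torus s\<^esub> t') = tmonom s u t * tmonom s u t'"
  by (simp add: tmonom_def torus_def power_int_mult_distrib prod.distrib)

lemma tmonom_one: "tmonom s u (\<lambda>_. 1) = 1"
  by (simp add: tmonom_def)

lemma tmonom_nonzero: "t \<in> carrier (torus s) \<Longrightarrow> tmonom s u t \<noteq> 0"
  by (simp add: tmonom_def torus_nonzero)

lemma tmonom_inverse: "tmonom s u (\<lambda>i. inverse (t i)) = tmonom s (- u) t"
  by (simp add: tmonom_def fun_simps power_int_inverse power_int_minus)

lemma inverse_torus: "t \<in> carrier (torus s) \<Longrightarrow> (\<lambda>i. inverse (t i)) \<in> carrier (torus s)"
  by (auto simp: torus_def)

text \<open>Setting one coordinate to 2 and the others to 1 reads off a single exponent.\<close>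

lemma tmonom_separates:
  assumes "u \<in> weights s" "v \<in> weights s" "u \<noteq> v"
  shows "\<exists>t\<in>carrier (torus s :: (nat \<Rightarrow> 'a::field_char_0) monoid). tmonom s u t \<noteq> tmonom s v t"
proof -
  obtain j where j: "u j \<noteq> v j" using assms(3) by blast
  then have js: "j < s" using assms(1,2) by (force simp: weights_def not_less[symmetric])
  define t where "t = (\<lambda>i. if i = j then 2 else 1 :: 'a)"
  have m: "tmonom s w t = 2 powi w j" for w
  proof -
    have "tmonom s w t = (\<Prod>i<s. if i = j then 2 powi w i else 1)"
      unfolding tmonom_def t_def by (intro prod.cong) auto
    then show ?thesis using js by simp
  qed
  have "t \<in> carrier (torus s)" using js by (auto simp: torus_def t_def)
  moreover have "tmonom s u t \<noteq> tmonom s v t" unfolding m using j two_power_int_eq by blast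
  ultimately show ?thesis by blast
qed

text \<open>Artin's argument: the relation at \<open>t\<close> times a separating \<open>t0\<close>,
  minus \<open>tmonom s v t0\<close> times the relation at \<open>t\<close>, no longer involves
  \<open>v\<close>.\<close>

lemma tmonom_independent:
  fixes a :: "(nat \<Rightarrow> int) \<Rightarrow> 'a::field_char_0"
  assumes "finite U" "U \<subseteq> weights s"
    and "\<And>t. t \<in> carrier (torus s) \<Longrightarrow> (\<Sum>u\<in>U. a u * tmonom s u t) = 0" "u \<in> U"
  shows "a u = 0"
  using assms
proof (induction U arbitrary: a u rule: finite_induct)
  case (insert v U)
  have aU: "a w = 0" if w: "w \<in> U" for w
  proof -
    have "w \<noteq> v" "w \<in> weights s" "v \<in> weights s" using w insert.hyps insert.prems(1) by auto
    then obtain t0 :: "nat \<Rightarrow> 'a" where t0: "t0 \<in> carrier (torus s)" "tmonom s w t0 \<noteq> tmonom s v t0"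
      using tmonom_separates by blast
    have "a w * (tmonom s w t0 - tmonom s v t0) = 0"
    proof (rule insert.IH[of "\<lambda>w. a w * (tmonom s w t0 - tmonom s v t0)"])
      fix t :: "nat \<Rightarrow> 'a" assume t: "t \<in> carrier (torus s)"
      have tt: "t \<otimes>\<^bsub>torus s\<^esub> t0 \<in> carrier (torus s)"
        by (rule monoid.m_closed[OF group.is_monoid[OF group_torus] t t0(1)])
      have "a v * tmonom s v t + (\<Sum>u\<in>U. a u * tmonom s u t) = 0"
        using insert.prems(2)[OF t] insert.hyps by simp
      moreover have "a v * (tmonom s v t * tmonom s v t0) + (\<Sum>u\<in>U. a u * (tmonom s u t * tmonom s u t0)) = 0"
        using insert.prems(2)[OF tt] insert.hyps by (simp add: tmonom_mult)
      moreover have "(\<Sum>u\<in>U. a u * (tmonom s u t0 - tmonom s v t0) * tmonom s u t) =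
          (\<Sum>u\<in>U. a u * (tmonom s u t * tmonom s u t0)) - tmonom s v t0 * (\<Sum>u\<in>U. a u * tmonom s u t)"
        unfolding sum_distrib_left sum_subtractf[symmetric] by (intro sum.cong) (auto simp: algebra_simps)
      ultimately show "(\<Sum>u\<in>U. a u * (tmonom s u t0 - tmonom s v t0) * tmonom s u t) = 0"
        by (simp add: add_eq_0_iff)
    qed (use w insert.prems in auto)
    then show ?thesis using t0(2) by simp
  qed
  have "(\<lambda>_. 1) \<in> carrier (torus s :: (nat \<Rightarrow> 'a) monoid)" by (simp add: torus_def)
  from insert.prems(2)[OF this] have "a v = 0" using aU insert.hyps by (simp add: tmonom_one)
  then show ?case using aU insert.prems(3) by auto
qed simp

lemma tmonom_regular: "regular_on (carrier (torus s)) (torus_coords s) (tmonom s u)"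
  unfolding tmonom_def by (intro regular_on_prod torus_coord_power) simp

text \<open>Regular functions on the product of the torus and \<open>X\<close> are Laurent
  polynomials with coefficients in the coordinate ring of \<open>X\<close>.\<close>

lemma laurent_expansion:
  fixes F :: "(nat \<Rightarrow> 'a::field) \<times> ('a ^ 'n) \<Rightarrow> 'a"
  assumes "regular_on (carrier (torus s) \<times> X) (prod_coords (torus_coords s) affine_coords) F"
  shows "\<exists>U h. finite U \<and> U \<subseteq> weights s \<and> (\<forall>u\<in>U. h u \<in> regular_ring X) \<and>
    (\<forall>t\<in>carrier (torus s). \<forall>x\<in>X. F (t, x) = (\<Sum>u\<in>U. tmonom s u t * h u x))"
proof -
  define P where "P F \<longleftrightarrow> (\<exists>U h. finite U \<and> U \<subseteq> weights s \<and> (\<forall>u\<in>U. h u \<in> regular_ring X) \<and>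
    (\<forall>t\<in>carrier (torus s). \<forall>x\<in>X. F (t, x) = (\<Sum>u\<in>U. tmonom s u t * h u x)))" 
    for F :: "(nat \<Rightarrow> 'a) \<times> ('a ^ 'n) \<Rightarrow> 'a"
  have single: "P F" if "u \<in> weights s" "h \<in> regular_ring X" 
    "\<And>t x. t \<in> carrier (torus s) \<Longrightarrow> x \<in> X \<Longrightarrow> F (t, x) = tmonom s u t * h x" for F u h
    unfolding P_def by (intro exI[of _ "{u}"] exI[of _ "\<lambda>_. h"]) (use that in auto)
  obtain p where p: "p \<in> fun_algebra (prod_coords (torus_coords s) affine_coords)" 
    "\<forall>z\<in>carrier (torus s) \<times> X. F z = p z"
    using assms unfolding regular_on_def by blast
  from p(1) have "P p"
  proof induction
    case (const c)
    show ?case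
      by (rule single[OF weights_simps(1) regular_ring_scale[OF cind_regular_ring, of c]])
        (simp add: tmonom_zero fscale_apply cind_def)
  next
    case (generator g)
    then consider q where "q \<in> torus_coords s" "g = q \<circ> fst" | i where "g = (\<lambda>z. snd z $ i)"
      by (auto simp: prod_coords_def affine_coords_def o_def)
    then show ?case
    proof cases
      case 1
      have *: "P (\<lambda>z. fst z j powi n)" if j: "j < s" for j n
      proof (rule single)
        show "(\<lambda>i. if i = j then n else 0) \<in> weights s" using j by (auto simp: weights_def)
        show "cind X \<in> regular_ring X" by (rule cind_regular_ring)
        fix t :: "nat \<Rightarrow> 'a" and x assume "x \<in> X"
        have "tmonom s (\<lambda>i. if i = j then n else 0) t = (\<Prod>i<s. if i = j then t i powi n else 1)"
          unfolding tmonom_def by (intro prod.cong) auto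
        then show "fst (t, x) j powi n = tmonom s (\<lambda>i. if i = j then n else 0) t * cind X x"
          using \<open>x \<in> X\<close> j by (simp add: cind_def)
      qed
      from 1 consider j where "j < s" "g = (\<lambda>z. fst z j)" | j where "j < s" "g = (\<lambda>z. inverse (fst z j))"
        by (auto simp: torus_coords_def o_def)
      then show ?thesis
        using *[of _ 1] *[of _ "-1"] by cases (simp_all add: power_int_minus)
    next
      case 2
      show ?thesis
        by (rule single[OF weights_simps(1) coord_fun_regular_ring[of X i]])
          (simp add: tmonom_zero 2 coord_fun_def)
    qed
  next
    case (add f g)
    then obtain U h V k where Uh: "finite U" "U \<subseteq> weights s" "\<forall>u\<in>U. h u \<in> regular_ring X"
      "\<forall>t\<in>carrier (torus s). \<forall>x\<in>X. f (t, x) = (\<Sum>u\<in>U. tmonom s u t * h u x)"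
      and Vk: "finite V" "V \<subseteq> weights s" "\<forall>u\<in>V. k u \<in> regular_ring X"
      "\<forall>t\<in>carrier (torus s). \<forall>x\<in>X. g (t, x) = (\<Sum>u\<in>V. tmonom s u t * k u x)"
      unfolding P_def by (elim exE conjE)
    define h' where "h' = (\<lambda>u. if u \<in> U then h u else 0)"
    define k' where "k' = (\<lambda>u. if u \<in> V then k u else 0)"
    have "(\<Sum>u\<in>U. tmonom s u t * h u x) = (\<Sum>u\<in>U \<union> V. tmonom s u t * h' u x)"
      "(\<Sum>u\<in>V. tmonom s u t * k u x) = (\<Sum>u\<in>U \<union> V. tmonom s u t * k' u x)" for t x
      unfolding h'_def k'_def using Uh(1) Vk(1) by (auto intro!: sum.mono_neutral_cong_left simp: fun_simps)
    then have "\<forall>t\<in>carrier (torus s). \<forall>x\<in>X. f (t, x) + g (t, x) = (\<Sum>u\<in>U \<union> V. tmonom s u t * (h' u + k' u) x)"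
      using Uh(4) Vk(4) by (simp add: fun_simps distrib_left sum.distrib)
    moreover have "\<forall>u\<in>U \<union> V. h' u + k' u \<in> regular_ring X"
      using Uh(3) Vk(3) by (auto simp: h'_def k'_def zero_regular_ring intro!: regular_ring_add)
    ultimately show ?case
      unfolding P_def using Uh(1,2) Vk(1,2) by (intro exI[of _ "U \<union> V"] exI[of _ "\<lambda>u. h' u + k' u"]) auto
  next
    case (mult f g)
    then obtain U h V k where Uh: "finite U" "U \<subseteq> weights s" "\<forall>u\<in>U. h u \<in> regular_ring X"
      "\<forall>t\<in>carrier (torus s). \<forall>x\<in>X. f (t, x) = (\<Sum>u\<in>U. tmonom s u t * h u x)"
      and Vk: "finite V" "V \<subseteq> weights s" "\<forall>u\<in>V. k u \<in> regular_ring X"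
      "\<forall>t\<in>carrier (torus s). \<forall>x\<in>X. g (t, x) = (\<Sum>u\<in>V. tmonom s u t * k u x)"
      unfolding P_def by (elim exE conjE)
    \<comment> \<open>The coefficients of a product are convolutions: pairs of exponents are grouped
      by their sum.\<close>
    define pl where "pl = (\<lambda>(u, v). u + v :: nat \<Rightarrow> int)"
    define l where "l w = (\<Sum>(u, v)\<in>{z \<in> U \<times> V. pl z = w}. h u * k v)" for w
    have fin: "finite (U \<times> V)" using Uh(1) Vk(1) by simp
    have "f (t, x) * g (t, x) = (\<Sum>w\<in>pl ` (U \<times> V). tmonom s w t * l w x)"
      if t: "t \<in> carrier (torus s)" and x: "x \<in> X" for t x
    proof -
      have "f (t, x) * g (t, x) = (\<Sum>(u, v)\<in>U \<times> V. tmonom s u t * h u x * (tmonom s v t * k v x))"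
        using Uh(4) Vk(4) t x by (simp add: sum_product sum.cartesian_product)
      also have "\<dots> = (\<Sum>z\<in>U \<times> V. tmonom s (pl z) t * (h (fst z) x * k (snd z) x))"
        by (intro sum.cong) (auto simp: pl_def tmonom_add[OF t])
      also have "\<dots> = (\<Sum>w\<in>pl ` (U \<times> V). \<Sum>z\<in>{z \<in> U \<times> V. pl z = w}. tmonom s (pl z) t * (h (fst z) x * k (snd z) x))"
        by (rule sum.image_gen[OF fin])
      also have "\<dots> = (\<Sum>w\<in>pl ` (U \<times> V). tmonom s w t * l w x)"
        unfolding l_def by (intro sum.cong refl) (auto simp: fun_simps sum_distrib_left case_prod_beta intro!: sum.cong)
      finally show ?thesis .
    qed
    moreover have "\<forall>w\<in>pl ` (U \<times> V). l w \<in> regular_ring X"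
      unfolding l_def using Uh(3) Vk(3)
      by (auto intro!: fv.subspace_sum[OF subspace_regular_ring] regular_ring_mult)
    moreover have "pl ` (U \<times> V) \<subseteq> weights s"
      using Uh(2) Vk(2) by (auto simp: pl_def intro!: weights_simps)
    ultimately show ?case
      unfolding P_def using fin by (intro exI[of _ "pl ` (U \<times> V)"] exI[of _ l]) auto
  qed
  then show ?thesis unfolding P_def using p(2) by simp
qed

text \<open>Only the first \<open>s\<close> entries of an index matter for \<open>tmonom\<close>, so other indices get the zero space.\<close>

definition weight_space where
  "weight_space X s \<phi> u = (if u \<in> weights s then 
     {f \<in> regular_ring X. \<forall>t\<in>carrier (torus s). \<forall>x\<in>X. f (\<phi> t x) = tmonom s u t * f x} else {0})"

section \<open>The weight grading of the coordinate ring\<close>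

locale torus_on_variety =
  fixes X :: "('a::{alg_closed_field, field_char_0} ^ 'n::finite) set" and T s \<phi>
  assumes irreducible: "irreducible_affine_variety X"
    and torus: "torus_structure X T s \<phi>"
begin

abbreviation "R \<equiv> regular_ring X"
abbreviation "W \<equiv> weight_space X s \<phi>"
abbreviation "TT \<equiv> carrier (torus s :: (nat \<Rightarrow> 'a) monoid)"

lemma closed: "zariski_closed X" and nonempty: "X \<noteq> {}"
  using irreducible by (auto simp: irreducible_affine_variety_def)

lemma subgroup_T: "subgroup T (Aut X)"
  and \<phi>_iso: "\<phi> \<in> iso (torus s) (Aut X\<lparr>carrier := T\<rparr>)"
  and \<phi>_regular: "regular_map (TT \<times> X) (prod_coords (torus_coords s) affine_coords) X (\<lambda>(t, x). \<phi> t x)"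
  using torus by (auto simp: torus_structure_def)

lemma T_automorphisms: "T \<subseteq> automorphisms X"
  using subgroup.subset[OF subgroup_T] by (simp add: carrier_Aut)

lemma \<phi>_image: "\<phi> ` TT = T" and \<phi>_inj: "inj_on \<phi> TT" and \<phi>_mem: "t \<in> TT \<Longrightarrow> \<phi> t \<in> T"
  using \<phi>_iso by (auto simp: iso_def bij_betw_def)

lemma \<phi>_automorphism: "t \<in> TT \<Longrightarrow> \<phi> t \<in> automorphisms X"
  using \<phi>_mem T_automorphisms by blast

lemma automorphism_mem: "g \<in> automorphisms X \<Longrightarrow> x \<in> X \<Longrightarrow> g x \<in> X"
  by (auto simp: automorphisms_def Bij_def bij_betw_def)

lemma \<phi>_mult: 
  assumes "t \<in> TT" "t' \<in> TT" "x \<in> X" shows "\<phi> (t \<otimes>\<^bsub>torus s\<^esub> t') x = \<phi> t (\<phi> t' x)"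
proof -
  have "\<phi> (t \<otimes>\<^bsub>torus s\<^esub> t') = \<phi> t \<otimes>\<^bsub>Aut X\<^esub> \<phi> t'"
    using \<phi>_iso assms by (auto simp: iso_def hom_def)
  then show ?thesis using assms(3) by (simp add: mult_Aut \<phi>_automorphism assms compose_def)
qed

lemma torus_one: "(\<lambda>_. 1) \<in> TT" "\<one>\<^bsub>torus s\<^esub> = (\<lambda>_. 1 :: 'a)"
  by (simp_all add: torus_def)

lemma \<phi>_one: "x \<in> X \<Longrightarrow> \<phi> (\<lambda>_. 1) x = x"
proof -
  assume x: "x \<in> X"
  have "group (Aut X\<lparr>carrier := T\<rparr>)" by (rule group.subgroup_imp_group[OF group_Aut subgroup_T])
  then have "group_hom (torus s) (Aut X\<lparr>carrier := T\<rparr>) \<phi>"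
    using \<phi>_iso by (auto simp: group_hom_def group_hom_axioms_def group_torus iso_def)
  then have "\<phi> \<one>\<^bsub>torus s\<^esub> = \<one>\<^bsub>Aut X\<lparr>carrier := T\<rparr>\<^esub>" by (rule group_hom.hom_one)
  then show ?thesis using x by (simp add: torus_one one_Aut)
qed

lemma \<phi>_inverse:
  assumes "t \<in> TT" "x \<in> X" shows "(inv\<^bsub>Aut X\<^esub> \<phi> t) x = \<phi> (\<lambda>i. inverse (t i)) x"
proof -
  let ?y = "\<phi> (\<lambda>i. inverse (t i)) x"
  have m: "(\<lambda>i. inverse (t i)) \<in> TT" by (rule inverse_torus[OF assms(1)])
  have "t \<otimes>\<^bsub>torus s\<^esub> (\<lambda>i. inverse (t i)) = (\<lambda>_. 1)"
    using torus_nonzero[OF assms(1)] by (auto simp: torus_def)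
  then have "\<phi> t ?y = x" using \<phi>_mult[OF assms(1) m assms(2)] \<phi>_one[OF assms(2)] by simp
  moreover have "?y \<in> X" by (rule automorphism_mem[OF \<phi>_automorphism[OF m] assms(2)])
  moreover have "inj_on (\<phi> t) X" using \<phi>_automorphism[OF assms(1)] by (simp add: automorphisms_def Bij_def bij_betw_def)
  ultimately have "inv_into X (\<phi> t) x = ?y" by (metis inv_into_f_eq)
  then show ?thesis using assms(2) by (simp add: inv_Aut[OF \<phi>_automorphism[OF assms(1)]])
qed

lemma weight_space_iff: 
  assumes "u \<in> weights s"
  shows "f \<in> W u \<longleftrightarrow> f \<in> R \<and> (\<forall>t\<in>TT. \<forall>x\<in>X. f (\<phi> t x) = tmonom s u t * f x)"
  using assms by (simp add: weight_space_def)

lemma W_R: "f \<in> W u \<Longrightarrow> f \<in> R"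
  by (auto simp: weight_space_def zero_regular_ring split: if_splits)

lemma W_apply: "f \<in> W u \<Longrightarrow> t \<in> TT \<Longrightarrow> x \<in> X \<Longrightarrow> f (\<phi> t x) = tmonom s u t * f x"
  by (auto simp: weight_space_def fun_simps split: if_splits)

lemma W_weights: "f \<in> W u \<Longrightarrow> f \<noteq> 0 \<Longrightarrow> u \<in> weights s"
  by (auto simp: weight_space_def split: if_splits)

lemma subspace_W: "fv.subspace (W u)"
proof (cases "u \<in> weights s")
  case True
  show ?thesis
    by (rule fv.subspaceI)
      (auto simp: weight_space_iff[OF True] zero_regular_ring regular_ring_add regular_ring_scale fun_simps algebra_simps)
qed (simp add: weight_space_def)

lemma W_mult: assumes "f \<in> W u" "g \<in> W v" shows "f * g \<in> W (u + v)"
proof (cases "f = 0 \<or> g = 0")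
  case True
  then have "f * g = 0" by auto
  then show ?thesis using fv.subspace_0[OF subspace_W] by (simp only:)
next
  case False
  then have "u + v \<in> weights s" using W_weights assms weights_simps(2) by blast
  then show ?thesis 
    using W_R assms W_apply[OF assms(1)] W_apply[OF assms(2)]
    by (simp add: weight_space_iff regular_ring_mult fun_simps tmonom_add)
qed

lemma cind_W: "cind X \<in> W 0"
  using automorphism_mem[OF \<phi>_automorphism]
  by (simp add: weight_space_iff weights_simps cind_regular_ring tmonom_zero) (simp add: cind_def)

text \<open>Both halves come from independence of characters. A vanishing sum of homogeneous
  functions is a relation between characters at each point, and the homogeneous components of
  \<open>f\<close> are the Laurent coefficients of its pullback along the action.\<close>

lemma direct_sum_W: "direct_sum R W"
  unfolding direct_sum_def
proof (intro conjI allI ballI impI)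
  show "fv.subspace (W u)" "W u \<subseteq> R" for u using subspace_W W_R by blast+
  fix F h assume F: "finite F" "\<forall>u\<in>F. h u \<in> W u" "sum h F = 0" 
  fix u assume u: "u \<in> F"
  show "h u = 0"
  proof (rule ext)
    fix x
    show "h u x = 0 x"
    proof (cases "h u x = 0")
      case False
      \<comment> \<open>Indices outside \<open>weights s\<close> have zero weight space, and
        independence of the monomials requires that they be removed.\<close>
      define U where "U = {v \<in> F. v \<in> weights s}"
      have x: "x \<in> X" using False regular_ring_off[OF W_R] F(2) u by blast
      have uw: "u \<in> weights s" by (rule W_weights[of "h u"]) (use False F(2) u in \<open>auto simp: fun_simps\<close>)
      have "h u x = 0"
      proof (rule tmonom_independent[of U s "\<lambda>v. h v x"])
        fix t :: "nat \<Rightarrow> 'a" assume t: "t \<in> TT"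
        have "(\<Sum>v\<in>U. h v x * tmonom s v t) = (\<Sum>v\<in>U. h v (\<phi> t x))"
          using F(2) by (intro sum.cong) (auto simp: U_def W_apply[OF _ t x])
        also have "\<dots> = (\<Sum>v\<in>F. h v (\<phi> t x))"
          using F(1,2) by (intro sum.mono_neutral_left) (auto simp: U_def weight_space_def fun_simps split: if_splits)
        also have "\<dots> = 0" using F(3) sum_fun_apply[of h F "\<phi> t x"] by (simp add: fun_simps)
        finally show "(\<Sum>v\<in>U. h v x * tmonom s v t) = 0" .
      qed (use F(1) u uw in \<open>auto simp: U_def\<close>)
      then show ?thesis by (simp add: fun_simps)
    qed (simp add: fun_simps)
  qed
next
  fix f assume f: "f \<in> R"
  have "regular_on (TT \<times> X) (prod_coords (torus_coords s) affine_coords) (\<lambda>z. f (case z of (t, x) \<Rightarrow> \<phi> t x))"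
    by (rule regular_on_comp_map[OF regular_ring_regular[OF f] \<phi>_regular])
  from laurent_expansion[OF this] obtain U h where U: "finite U" "U \<subseteq> weights s" "\<forall>u\<in>U. h u \<in> R"
    "\<forall>t\<in>TT. \<forall>x\<in>X. f (\<phi> t x) = (\<Sum>u\<in>U. tmonom s u t * h u x)" by auto
  have hW: "h u \<in> W u" if u: "u \<in> U" for u
  proof -
    have uw: "u \<in> weights s" using u U(2) by blast
    have "h u (\<phi> t' x) = tmonom s u t' * h u x" if t': "t' \<in> TT" and x: "x \<in> X" for t' x
    proof -
      have "h u (\<phi> t' x) - tmonom s u t' * h u x = 0"
      proof (rule tmonom_independent[OF U(1,2) _ u, of "\<lambda>u. h u (\<phi> t' x) - tmonom s u t' * h u x"])
        fix t assume t: "t \<in> TT"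
        have tt: "t \<otimes>\<^bsub>torus s\<^esub> t' \<in> TT"
          by (rule monoid.m_closed[OF group.is_monoid[OF group_torus] t t'])
        \<comment> \<open>The value of \<open>f\<close> at \<open>\<phi> t (\<phi> t' x)\<close> is
          expanded twice, as a translate by \<open>t\<close> and as a translate by the product;
          comparing coefficients shows that \<open>h u\<close> has weight \<open>u\<close>.\<close>
        have "(\<Sum>u\<in>U. tmonom s u t * h u (\<phi> t' x)) = (\<Sum>u\<in>U. tmonom s u t * tmonom s u t' * h u x)"
        proof -
          have "(\<Sum>u\<in>U. tmonom s u t * h u (\<phi> t' x)) = f (\<phi> t (\<phi> t' x))"
            using U(4) t automorphism_mem[OF \<phi>_automorphism[OF t'] x] by simp
          also have "\<dots> = f (\<phi> (t \<otimes>\<^bsub>torus s\<^esub> t') x)" by (simp only: \<phi>_mult[OF t t' x])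
          also have "\<dots> = (\<Sum>u\<in>U. tmonom s u (t \<otimes>\<^bsub>torus s\<^esub> t') * h u x)" using U(4) tt x by blast
          finally show ?thesis by (simp only: tmonom_mult)
        qed
        then have "(\<Sum>u\<in>U. tmonom s u t * h u (\<phi> t' x) - tmonom s u t * tmonom s u t' * h u x) = 0"
          by (simp add: sum_subtractf)
        then show "(\<Sum>u\<in>U. (h u (\<phi> t' x) - tmonom s u t' * h u x) * tmonom s u t) = 0"
          by (simp add: algebra_simps)
      qed
      then show ?thesis by simp
    qed
    then show ?thesis using uw U(3) u by (simp add: weight_space_iff)
  qed
  have "f = sum h U"
  proof (rule regular_ring_eqI[OF f])
    show "sum h U \<in> R" using U(3) by (intro fv.subspace_sum[OF subspace_regular_ring]) auto
    show "f x = sum h U x" if "x \<in> X" for x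
      using U(4)[rule_format, OF torus_one(1) that] \<phi>_one[OF that] by (simp add: fun_simps tmonom_one)
  qed
  then show "\<exists>F h. finite F \<and> (\<forall>i\<in>F. h i \<in> W i) \<and> f = sum h F" using U(1) hW by blast
qed

text \<open>If a product vanishes, \<open>X\<close> is the union of the zero sets of the two
  factors, and irreducibility makes one of them all of \<open>X\<close>.\<close>

lemma R_domain: 
  assumes f: "f \<in> R" and g: "g \<in> R" and fg: "f * g = 0"
  shows "f = 0 \<or> g = 0"
proof -
  obtain P where P: "P \<subseteq> fun_algebra affine_coords" "X = {x. \<forall>p\<in>P. p x = 0}"
    using closed unfolding zariski_closed_def by blast
  obtain p where p: "p \<in> fun_algebra affine_coords" "\<forall>x\<in>X. f x = p x"
    using f unfolding regular_ring_def regular_on_def by blast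
  obtain q where q: "q \<in> fun_algebra affine_coords" "\<forall>x\<in>X. g x = q x"
    using g unfolding regular_ring_def regular_on_def by blast
  have cl: "zariski_closed {x. \<forall>p\<in>insert r P. p x = 0}" if "r \<in> fun_algebra affine_coords" for r
    unfolding zariski_closed_def by (intro exI[of _ "insert r P"]) (use that P(1) in auto)
  have pq: "p x = 0 \<or> q x = 0" if "x \<in> X" for x
  proof -
    have "f x * g x = 0" using fun_cong[OF fg, of x] by (simp add: fun_simps)
    then show ?thesis using p(2) q(2) that by auto
  qed
  define Y where "Y r = {x. \<forall>r'\<in>insert r P. r' x = 0}" for r
  have "X = Y p \<union> Y q" unfolding Y_def using pq P(2) by auto
  then have "X = Y p \<or> X = Y q"
    using irreducible cl[OF p(1), folded Y_def] cl[OF q(1), folded Y_def]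
    by (simp only: irreducible_affine_variety_def simp_thms)
  moreover have "r x = 0" if "X = Y r" "x \<in> X" for r x
  proof -
    have "x \<in> Y r" using that by simp
    then show ?thesis by (simp add: Y_def)
  qed
  ultimately have "(\<forall>x\<in>X. p x = 0) \<or> (\<forall>x\<in>X. q x = 0)" by metis
  moreover have "f = 0" if "\<forall>x\<in>X. p x = 0"
    by (rule regular_ring_eqI[OF f zero_regular_ring]) (use that p(2) in \<open>simp add: fun_simps\<close>)
  moreover have "g = 0" if "\<forall>x\<in>X. q x = 0"
    by (rule regular_ring_eqI[OF g zero_regular_ring]) (use that q(2) in \<open>simp add: fun_simps\<close>)
  ultimately show ?thesis by blast
qed

end

section \<open>Pointed gradings\<close>

lemma nat_mono_subsequence: "\<exists>r. strict_mono r \<and> incseq (\<lambda>n. g (r n) :: nat)" for g :: "nat \<Rightarrow> nat"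
proof -
  obtain r where r: "strict_mono r" "monoseq (\<lambda>n. g (r n))" using seq_monosub[of g] by blast
  then consider "incseq (\<lambda>n. g (r n))" | "decseq (\<lambda>n. g (r n))" by (auto simp: monoseq_iff)
  then show ?thesis
  proof cases
    case 1
    then show ?thesis using r(1) by blast
  next
    case 2
    define m where "m = (LEAST k. \<exists>n. g (r n) = k)"
    have "\<exists>n. g (r n) = m" unfolding m_def by (rule LeastI_ex) blast
    then obtain N where N: "g (r N) = m" by blast
    have "m \<le> g (r n)" for n unfolding m_def by (rule Least_le) blast
    moreover have "g (r (n + N)) \<le> m" for n using decseqD[OF 2, of N "n + N"] N by simp
    ultimately have "g (r (n + N)) = m" for n by (meson le_antisym)
    moreover have "strict_mono (\<lambda>n. r (n + N))" using r(1) by (simp add: strict_mono_def)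
    ultimately show ?thesis by (intro exI[of _ "\<lambda>n. r (n + N)"]) (simp add: incseq_def)
  qed
qed

text \<open>A sequence of distinct exponents is thinned out until it is nondecreasing at each of the
  finitely many positions; its first two terms are then comparable.\<close>

lemma dickson:
  assumes "finite Y" "infinite S" "S \<subseteq> exponents Y"
  shows "\<exists>a\<in>S. \<exists>b\<in>S. a \<noteq> b \<and> (\<forall>y. a y \<le> b y)"
proof -
  obtain f :: "nat \<Rightarrow> _" where f: "inj f" "range f \<subseteq> S"
    using infinite_countable_subset[OF assms(2)] by blast
  have "\<exists>r. strict_mono r \<and> (\<forall>y\<in>Z. incseq (\<lambda>n. f (r n) y))" if "finite Z" for Z
    using that
  proof (induction Z rule: finite_induct)
    case empty
    then show ?case by (intro exI[of _ id]) (simp add: strict_mono_def)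
  next
    case (insert z Z)
    then obtain r where r: "strict_mono r" "\<forall>y\<in>Z. incseq (\<lambda>n. f (r n) y)" by blast
    obtain r' where r': "strict_mono r'" "incseq (\<lambda>n. f (r (r' n)) z)"
      using nat_mono_subsequence[of "\<lambda>n. f (r n) z"] by blast
    have "incseq (\<lambda>n. f (r (r' n)) y)" if "y \<in> Z" for y
      using r(2) that strict_mono_mono[OF r'(1)] by (auto simp: incseq_def mono_def)
    moreover have "strict_mono (\<lambda>n. r (r' n))" using r(1) r'(1) by (simp add: strict_mono_def)
    ultimately show ?case using r'(2) by (intro exI[of _ "\<lambda>n. r (r' n)"]) auto
  qed
  from this[OF assms(1)] obtain r where r: "strict_mono r" "\<forall>y\<in>Y. incseq (\<lambda>n. f (r n) y)" by blast
  have "f (r 0) \<noteq> f (r 1)" using f(1) strict_monoD[OF r(1), of 0 1] by (auto dest: injD)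
  moreover have "f (r 0) y \<le> f (r 1) y" for y
  proof (cases "y \<in> Y")
    case True
    then show ?thesis using r(2) by (auto simp: incseq_def)
  next
    case False
    moreover have "f (r 0) \<in> exponents Y" using f(2) assms(3) by blast
    ultimately show ?thesis by (simp add: exponents_def)
  qed
  ultimately show ?thesis using f(2) by blast
qed

section \<open>Lines in the rational span of an abelian group\<close>

lemma group_frac_rel_trans:
  assumes K: "comm_group K" and "((v, m), (w, n)) \<in> frac_rel K" "((w, n), (z, l)) \<in> frac_rel K"
  shows "((v, m), (z, l)) \<in> frac_rel K"
proof -
  interpret comm_group K by (rule K)
  obtain k k' where k: "v \<in> carrier K" "w \<in> carrier K" "z \<in> carrier K" "m > 0" "n > 0" "l > 0" "k > 0" "k' > 0"
    "v [^]\<^bsub>K\<^esub> (k * n) = w [^]\<^bsub>K\<^esub> (k * m)" "w [^]\<^bsub>K\<^esub> (k' * l) = z [^]\<^bsub>K\<^esub> (k' * n)"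
    using assms(2,3) by (auto simp: frac_rel_def)
  have "v [^]\<^bsub>K\<^esub> (k * k' * n * l) = (v [^]\<^bsub>K\<^esub> (k * n)) [^]\<^bsub>K\<^esub> (k' * l)"
    using k(1) by (simp add: int_pow_pow mult_ac)
  also have "\<dots> = (w [^]\<^bsub>K\<^esub> (k' * l)) [^]\<^bsub>K\<^esub> (k * m)"
    unfolding k(9) using k(2) by (simp add: int_pow_pow mult_ac)
  also have "\<dots> = z [^]\<^bsub>K\<^esub> (k * k' * n * m)"
    unfolding k(10) using k(3) by (simp add: int_pow_pow mult_ac)
  finally show ?thesis using k by (auto simp: frac_rel_def intro!: exI[of _ "k * k' * n"])
qed

lemma frac_rel_sym: "(a, b) \<in> frac_rel K \<Longrightarrow> (b, a) \<in> frac_rel K"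
  by (auto simp: frac_rel_def intro: sym)

lemma frac_eqI:
  assumes "comm_group K" "((v, m), (w, n)) \<in> frac_rel K" shows "frac K v m = frac K w n"
  unfolding frac_def using group_frac_rel_trans[OF assms(1)] assms(2) frac_rel_sym by fast

lemma frac_eqD:
  assumes "frac K v m = frac K w n" "w \<in> carrier K" "0 < n" shows "((v, m), (w, n)) \<in> frac_rel K"
proof -
  have "((w, n), (w, n)) \<in> frac_rel K" using assms(2,3) by (auto simp: frac_rel_def intro: exI[of _ 1])
  then have "(w, n) \<in> frac K w n" by (simp add: frac_def)
  then show ?thesis unfolding assms(1)[symmetric] by (simp add: frac_def)
qed

lemma rat_scale_frac:
  assumes K: "comm_group K" and w: "w \<in> carrier K" and q: "quotient_of q = (p, d)"
  shows "rat_scale K q (frac K w 1) = frac K (w [^]\<^bsub>K\<^esub> p) d"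
proof -
  interpret comm_group K by (rule K)
  have d: "d > 0" using quotient_of_denom_pos[OF q] .
  have "frac K (v [^]\<^bsub>K\<^esub> p) (n * d) = frac K (w [^]\<^bsub>K\<^esub> p) d" if vn: "(v, n) \<in> frac K w 1" for v n
  proof (rule frac_eqI[OF K])
    obtain k where k: "v \<in> carrier K" "n > 0" "k > 0" "w [^]\<^bsub>K\<^esub> (k * n) = v [^]\<^bsub>K\<^esub> k"
      using vn by (auto simp: frac_def frac_rel_def)
    have "(v [^]\<^bsub>K\<^esub> p) [^]\<^bsub>K\<^esub> (k * d) = (v [^]\<^bsub>K\<^esub> k) [^]\<^bsub>K\<^esub> (p * d)"
      using k(1) by (simp add: int_pow_pow mult_ac)
    also have "\<dots> = (w [^]\<^bsub>K\<^esub> p) [^]\<^bsub>K\<^esub> (k * (n * d))"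
      unfolding k(4)[symmetric] using w by (simp add: int_pow_pow mult_ac)
    finally show "((v [^]\<^bsub>K\<^esub> p, n * d), (w [^]\<^bsub>K\<^esub> p, d)) \<in> frac_rel K"
      using k w d by (auto simp: frac_rel_def)
  qed
  moreover have "(w, 1) \<in> frac K w 1" using w by (auto simp: frac_def frac_rel_def intro: exI[of _ 1])
  ultimately show ?thesis unfolding rat_scale_def q by fastforce
qed

text \<open>Otherwise the class of \<open>w\<close> is nonzero and the cone contains the line
  through it: nonnegative multiples come from \<open>w\<close>, negative ones from its inverse.
  Torsion has to be allowed in the conclusion because it disappears after tensoring with the
  rationals.\<close>

lemma pointed_no_opposite_weights:
  assumes K: "comm_group K" and "\<not> contains_line K (convex_cone_hull K ((\<lambda>w. frac K w 1) ` S))"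
    and w: "w \<in> carrier K" "w \<in> S" "inv\<^bsub>K\<^esub> w \<in> S"
  shows "\<exists>k>0. w [^]\<^bsub>K\<^esub> (k :: int) = \<one>\<^bsub>K\<^esub>"
proof (rule ccontr)
  assume no: "\<not> ?thesis"
  interpret comm_group K by (rule K)
  let ?a = "frac K w 1"
  have "?a \<in> rat_space K" unfolding rat_space_def frac_def using w(1) by (intro quotientI) simp
  moreover have "?a \<noteq> rat_zero K"
  proof
    assume "?a = rat_zero K"
    then have "((w, 1), (\<one>\<^bsub>K\<^esub>, 1)) \<in> frac_rel K" unfolding rat_zero_def by (rule frac_eqD) auto
    then show False using no by (auto simp: frac_rel_def)
  qed
  moreover have "rat_scale K q ?a \<in> convex_cone_hull K ((\<lambda>w. frac K w 1) ` S)" for q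
  proof (cases "q \<ge> 0")
    case True
    show ?thesis by (rule convex_cone_hull.scale[OF convex_cone_hull.incl True]) (use w(2) in blast)
  next
    case False
    obtain p d where q: "quotient_of q = (p, d)" by (cases "quotient_of q")
    then have q': "quotient_of (- q) = (- p, d)" by (simp add: rat_uminus_code)
    have "rat_scale K q ?a = frac K (w [^]\<^bsub>K\<^esub> p) d" by (rule rat_scale_frac[OF K w(1) q])
    also have "\<dots> = rat_scale K (- q) (frac K (inv\<^bsub>K\<^esub> w) 1)"
      unfolding rat_scale_frac[OF K inv_closed[OF w(1)] q'] using w(1)
      by (simp add: int_pow_inv int_pow_neg)
    also have "\<dots> \<in> convex_cone_hull K ((\<lambda>w. frac K w 1) ` S)"
      by (rule convex_cone_hull.scale[OF convex_cone_hull.incl]) (use w(3) False in auto)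
    finally show ?thesis .
  qed
  ultimately show False using assms(2) unfolding contains_line_def by blast
qed

section \<open>Exponent vectors and characters of the torus\<close>

context torus_on_variety
begin

abbreviation "M \<equiv> character_lattice X T s \<phi>"

lemma character_iff: 
  "\<xi> \<in> carrier M \<longleftrightarrow> \<xi> \<in> extensional T \<and> (\<forall>a\<in>T. \<xi> a \<noteq> 0) \<and>
    (\<forall>a\<in>T. \<forall>b\<in>T. \<xi> (a \<otimes>\<^bsub>Aut X\<^esub> b) = \<xi> a * \<xi> b) \<and> regular_on TT (torus_coords s) (\<lambda>t. \<xi> (\<phi> t))"
  by (auto simp: character_lattice_def hom_def Gm_def restrict_regular_functions_iff)

lemma T_closed: "a \<in> T \<Longrightarrow> b \<in> T \<Longrightarrow> a \<otimes>\<^bsub>Aut X\<^esub> b \<in> T"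
  by (rule subgroup.m_closed[OF subgroup_T])

lemma mult_M: "\<xi> \<otimes>\<^bsub>M\<^esub> \<eta> = (\<lambda>t\<in>T. \<xi> t * \<eta> t)" and one_M: "\<one>\<^bsub>M\<^esub> = (\<lambda>t\<in>T. 1)"
  by (simp_all add: character_lattice_def)

lemma comm_group_M: "comm_group M"
proof (rule comm_groupI)
  fix \<xi> \<eta> assume x: "\<xi> \<in> carrier M" and y: "\<eta> \<in> carrier M"
  have "regular_on TT (torus_coords s) (\<lambda>t. (\<lambda>a\<in>T. \<xi> a * \<eta> a) (\<phi> t))"
    by (rule regular_on_cong[OF _ regular_on_mult[of TT _ "\<lambda>t. \<xi> (\<phi> t)" "\<lambda>t. \<eta> (\<phi> t)"]])
      (use x y \<phi>_mem in \<open>auto simp: character_iff\<close>)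
  then show "\<xi> \<otimes>\<^bsub>M\<^esub> \<eta> \<in> carrier M" using x y T_closed by (auto simp: character_iff mult_M)
  show "\<xi> \<otimes>\<^bsub>M\<^esub> \<eta> = \<eta> \<otimes>\<^bsub>M\<^esub> \<xi>" by (auto simp: mult_M mult.commute)
  fix \<zeta> assume "\<zeta> \<in> carrier M"
  show "\<xi> \<otimes>\<^bsub>M\<^esub> \<eta> \<otimes>\<^bsub>M\<^esub> \<zeta> = \<xi> \<otimes>\<^bsub>M\<^esub> (\<eta> \<otimes>\<^bsub>M\<^esub> \<zeta>)"
    by (auto simp: mult_M mult.assoc)
next
  have "regular_on TT (torus_coords s) (\<lambda>t. (\<lambda>a\<in>T. 1) (\<phi> t))"
    by (rule regular_on_cong[OF _ regular_on_const[of _ _ 1]]) (simp add: \<phi>_mem)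
  then show "\<one>\<^bsub>M\<^esub> \<in> carrier M" using T_closed by (auto simp: character_iff one_M)
next
  fix \<xi> assume x: "\<xi> \<in> carrier M"
  show "\<one>\<^bsub>M\<^esub> \<otimes>\<^bsub>M\<^esub> \<xi> = \<xi>"
    using x by (auto simp: mult_M one_M character_iff extensional_def fun_eq_iff)
  \<comment> \<open>The inverse of a character is the character composed with inversion on the
    torus, which shows that it is regular.\<close>
  have inv: "inverse (\<xi> (\<phi> t)) = \<xi> (\<phi> (\<lambda>i. inverse (t i)))" if t: "t \<in> TT" for t
  proof -
    let ?u = "\<lambda>i. inverse (t i)"
    have u: "?u \<in> TT" by (rule inverse_torus[OF t])
    have "\<phi> (t \<otimes>\<^bsub>torus s\<^esub> ?u) = \<phi> t \<otimes>\<^bsub>Aut X\<^esub> \<phi> ?u" 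
      using \<phi>_iso t u by (auto simp: iso_def hom_def)
    moreover have "\<phi> (\<one>\<^bsub>torus s\<^esub> \<otimes>\<^bsub>torus s\<^esub> \<one>\<^bsub>torus s\<^esub>) = \<phi> \<one>\<^bsub>torus s\<^esub> \<otimes>\<^bsub>Aut X\<^esub> \<phi> \<one>\<^bsub>torus s\<^esub>"
      using \<phi>_iso torus_one by (auto simp: iso_def hom_def)
    moreover have "t \<otimes>\<^bsub>torus s\<^esub> ?u = \<one>\<^bsub>torus s\<^esub>" "\<one>\<^bsub>torus s\<^esub> \<otimes>\<^bsub>torus s\<^esub> \<one>\<^bsub>torus s\<^esub> = \<one>\<^bsub>torus s :: (nat \<Rightarrow> 'a) monoid\<^esub>"
      using torus_nonzero[OF t] by (auto simp: torus_def)
    ultimately have "\<xi> (\<phi> t) * \<xi> (\<phi> ?u) = \<xi> (\<phi> \<one>\<^bsub>torus s\<^esub>)" "\<xi> (\<phi> \<one>\<^bsub>torus s\<^esub>) * \<xi> (\<phi> \<one>\<^bsub>torus s\<^esub>) = \<xi> (\<phi> \<one>\<^bsub>torus s\<^esub>)"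
      using x t u torus_one \<phi>_mem unfolding character_iff by metis+
    moreover have "\<xi> (\<phi> \<one>\<^bsub>torus s\<^esub>) \<noteq> 0" using x torus_one \<phi>_mem unfolding character_iff by metis
    ultimately have "\<xi> (\<phi> t) * \<xi> (\<phi> ?u) = 1" by simp
    then show ?thesis by (rule inverse_unique)
  qed
  have "regular_on TT (torus_coords s) (\<lambda>t. \<xi> (\<phi> (\<lambda>i. inverse (t i))))"
  proof (rule regular_on_comp[where f = "\<lambda>t. \<xi> (\<phi> t)" and Y = TT and H = "torus_coords s"])
    show "regular_on TT (torus_coords s) (\<lambda>z. h (\<lambda>i. inverse (z i)))" if "h \<in> torus_coords s" for h
      using that torus_coord_power[where n = "-1"] torus_coord_power[where n = 1]
      by (auto simp: torus_coords_def power_int_minus)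
  qed (use x inverse_torus in \<open>auto simp: character_iff\<close>)
  then have "regular_on TT (torus_coords s) (\<lambda>t. (\<lambda>a\<in>T. inverse (\<xi> a)) (\<phi> t))"
    by (rule regular_on_cong[rotated]) (simp add: inv \<phi>_mem)
  then have "(\<lambda>a\<in>T. inverse (\<xi> a)) \<in> carrier M" using x T_closed by (auto simp: character_iff)
  moreover have "(\<lambda>a\<in>T. inverse (\<xi> a)) \<otimes>\<^bsub>M\<^esub> \<xi> = \<one>\<^bsub>M\<^esub>"
    using x by (auto simp: mult_M one_M character_iff fun_eq_iff)
  ultimately show "\<exists>\<eta>\<in>carrier M. \<eta> \<otimes>\<^bsub>M\<^esub> \<xi> = \<one>\<^bsub>M\<^esub>" by blast
qed

text \<open>The sign accounts for \<open>t\<close> acting on functions through its inverse.\<close>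

definition weight_character :: "(nat \<Rightarrow> int) \<Rightarrow> ('a ^ 'n \<Rightarrow> 'a ^ 'n) \<Rightarrow> 'a" where
  "weight_character u = (\<lambda>a\<in>T. tmonom s (- u) (inv_into TT \<phi> a))"

lemma weight_character_apply: "t \<in> TT \<Longrightarrow> weight_character u (\<phi> t) = tmonom s (- u) t"
  by (simp add: weight_character_def \<phi>_mem inv_into_f_f[OF \<phi>_inj])

lemma weight_character_mem: "weight_character u \<in> carrier M"
proof -
  have "regular_on TT (torus_coords s) (\<lambda>t. weight_character u (\<phi> t))"
    by (rule regular_on_cong[OF _ tmonom_regular]) (simp add: weight_character_apply)
  moreover have "weight_character u (a \<otimes>\<^bsub>Aut X\<^esub> b) = weight_character u a * weight_character u b"
    if ab: "a \<in> T" "b \<in> T" for a b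
  proof -
    obtain t t' where t: "a = \<phi> t" "b = \<phi> t'" "t \<in> TT" "t' \<in> TT" using ab \<phi>_image by blast
    have "\<phi> t \<otimes>\<^bsub>Aut X\<^esub> \<phi> t' = \<phi> (t \<otimes>\<^bsub>torus s\<^esub> t')" using \<phi>_iso t by (auto simp: iso_def hom_def)
    moreover have "t \<otimes>\<^bsub>torus s\<^esub> t' \<in> TT"
      by (rule monoid.m_closed[OF group.is_monoid[OF group_torus] t(3,4)])
    ultimately show ?thesis unfolding t(1,2) by (simp add: weight_character_apply t tmonom_mult)
  qed
  moreover have "weight_character u a \<noteq> 0" if a: "a \<in> T" for a
  proof -
    obtain t where "a = \<phi> t" "t \<in> TT" using a \<phi>_image by blast
    then show ?thesis by (simp add: weight_character_apply tmonom_nonzero)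
  qed
  ultimately show ?thesis by (auto simp: character_iff weight_character_def)
qed

lemma character_eqI:
  assumes "\<xi> \<in> extensional T" "\<eta> \<in> extensional T" "\<And>t. t \<in> TT \<Longrightarrow> \<xi> (\<phi> t) = \<eta> (\<phi> t)" shows "\<xi> = \<eta>"
  by (rule extensionalityI[OF assms(1,2)]) (use assms(3) \<phi>_image in blast)

lemma weight_character_zero: "weight_character 0 = \<one>\<^bsub>M\<^esub>"
proof (rule character_eqI)
  show "weight_character 0 \<in> extensional T" by (simp add: weight_character_def)
qed (auto simp: weight_character_apply one_M \<phi>_mem tmonom_zero)

text \<open>Acting through the inverse turns the exponent \<open>u\<close> into \<open>- u\<close>,
  in agreement with the sign in \<open>weight_character\<close>.\<close>

lemma weight_space_canonical:
  assumes f: "f \<in> W u" 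
  shows "restrict f X \<in> canonical_grading X T (weight_character u)"
proof -
  have "restrict f X \<in> coordinate_ring X"
    unfolding coordinate_ring_def using restrict_regular_functions_iff regular_ring_regular[OF W_R[OF f]] by blast
  moreover have "restrict f X ((inv\<^bsub>Aut X\<^esub> a) x) = weight_character u a * restrict f X x" if a: "a \<in> T" and x: "x \<in> X" for a x
  proof -
    obtain t where t: "a = \<phi> t" "t \<in> TT" using a \<phi>_image by blast
    note t' = inverse_torus[OF t(2)]
    show ?thesis
      using x automorphism_mem[OF \<phi>_automorphism[OF t'] x] W_apply[OF f t' x] 
      by (simp add: t \<phi>_inverse weight_character_apply tmonom_inverse)
  qed
  ultimately show ?thesis by (simp add: canonical_grading_def)
qed

end

section \<open>The weight monoid of a pointed grading\<close>

locale pointed_torus = torus_on_variety X T s \<phi>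
  for X :: "('a::{alg_closed_field, field_char_0} ^ 'n::finite) set" and T s \<phi> +
  assumes pointed: "pointed_grading (character_lattice X T s \<phi>) X (canonical_grading X T)"
begin

definition S :: "(nat \<Rightarrow> int) set" where "S = {u. W u \<noteq> {0}}"

lemma S_iff: "u \<in> S \<longleftrightarrow> (\<exists>f\<in>W u. f \<noteq> 0)"
  using fv.subspace_0[OF subspace_W, of u] by (auto simp: S_def)

lemma S_weights: "u \<in> S \<Longrightarrow> u \<in> weights s"
  unfolding S_iff using W_weights by blast

lemma cind_nonzero: "cind X \<noteq> (0 :: 'a ^ 'n \<Rightarrow> 'a)"
proof -
  obtain x where "x \<in> X" using nonempty by blast
  then have "cind X x \<noteq> (0 :: 'a)" by (simp add: cind_def)
  then show ?thesis by (auto simp: fun_simps)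
qed

lemma zero_S: "0 \<in> S" 
  unfolding S_iff using cind_W cind_nonzero by blast

lemma S_add: assumes "u \<in> S" "v \<in> S" shows "u + v \<in> S"
proof -
  obtain f g where fg: "f \<in> W u" "f \<noteq> 0" "g \<in> W v" "g \<noteq> 0" using assms unfolding S_iff by blast
  then have "f * g \<noteq> 0" using R_domain W_R by blast
  then show ?thesis unfolding S_iff using W_mult[OF fg(1,3)] by blast
qed

lemma weight_character_S: assumes "u \<in> S" shows "weight_character u \<in> weight_monoid M X (canonical_grading X T)"
proof -
  obtain f where f: "f \<in> W u" "f \<noteq> 0" using assms unfolding S_iff by blast
  then obtain x where x: "f x \<noteq> 0" by (auto simp: fun_eq_iff fun_simps)
  then have xX: "x \<in> X" using regular_ring_off[OF W_R[OF f(1)]] by blast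
  have "restrict f X \<noteq> (\<lambda>x\<in>X. 0)"
  proof
    assume "restrict f X = (\<lambda>x\<in>X. 0)"
    from fun_cong[OF this, of x] show False using x xX by simp
  qed
  then show ?thesis using weight_space_canonical[OF f(1)] weight_character_mem by (auto simp: weight_monoid_def)
qed

text \<open>Opposite weights correspond to inverse characters, so pointedness makes the character of
  \<open>u\<close> a torsion element, and the exponent lattice has no torsion.\<close>

lemma S_pointed: assumes u: "u \<in> S" and v: "v \<in> S" and uv: "u + v = 0" shows "u = 0"
proof -
  interpret K: comm_group M by (rule comm_group_M)
  let ?w = "weight_character u"
  have "weight_character v \<otimes>\<^bsub>M\<^esub> ?w = \<one>\<^bsub>M\<^esub>"
  proof (rule character_eqI)
    fix t assume t: "t \<in> TT"
    have "tmonom s (- v) t * tmonom s (- u) t = tmonom s (- v + - u) t" by (rule tmonom_add[OF t, symmetric])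
    also have "- v + - u = 0" using uv by (metis add_uminus_conv_diff minus_add_distrib neg_equal_0_iff_equal minus_add add.commute)
    finally show "(weight_character v \<otimes>\<^bsub>M\<^esub> ?w) (\<phi> t) = \<one>\<^bsub>M\<^esub> (\<phi> t)"
      using t by (simp add: mult_M one_M \<phi>_mem weight_character_apply tmonom_zero)
  qed (auto simp: mult_M one_M)
  then have inv: "inv\<^bsub>M\<^esub> ?w = weight_character v"
    using weight_character_mem by (intro K.inv_equality)
  have "\<not> contains_line M (convex_cone_hull M ((\<lambda>w. frac M w 1) ` weight_monoid M X (canonical_grading X T)))"
    using pointed by (simp add: pointed_grading_def weight_cone_def)
  from pointed_no_opposite_weights[OF comm_group_M this weight_character_mem weight_character_S[OF u]]
  obtain k :: int where k: "k > 0" "?w [^]\<^bsub>M\<^esub> k = \<one>\<^bsub>M\<^esub>"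
    using weight_character_S[OF v] unfolding inv by blast
  have wk: "?w [^]\<^bsub>M\<^esub> nat k = \<one>\<^bsub>M\<^esub>"
  proof -
    have "\<not> k < 0" using k(1) by simp
    then show ?thesis using k(2) by (simp only: int_pow_def2 if_False)
  qed
  have pwr: "(?w [^]\<^bsub>M\<^esub> n) (\<phi> t) = tmonom s (- u) t ^ n" if "t \<in> TT" for n :: nat and t
  proof (induction n)
    case 0
    show ?case by (simp add: one_M \<phi>_mem[OF that])
  next
    case (Suc n)
    have "(?w [^]\<^bsub>M\<^esub> Suc n) (\<phi> t) = (?w [^]\<^bsub>M\<^esub> n) (\<phi> t) * ?w (\<phi> t)"
      using \<phi>_mem[OF that] by (simp add: mult_M)
    then show ?case unfolding Suc.IH weight_character_apply[OF that] by simp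
  qed
  have pw: "tmonom s (- u) t ^ nat k = 1" if t: "t \<in> TT" for t
  proof -
    have "tmonom s (- u) t ^ nat k = (?w [^]\<^bsub>M\<^esub> nat k) (\<phi> t)" by (rule pwr[OF t, symmetric])
    also have "\<dots> = \<one>\<^bsub>M\<^esub> (\<phi> t)" by (simp only: wk)
    also have "\<dots> = 1" using \<phi>_mem[OF t] by (simp add: one_M)
    finally show ?thesis .
  qed
  have "u i = 0" for i
  proof (cases "i < s")
    case True
    \<comment> \<open>With a single coordinate equal to 2, triviality of a positive power forces the
      exponent at this coordinate to be 0.\<close>
    define t where "t = (\<lambda>j. if j = i then 2 else 1 :: 'a)"
    have t: "t \<in> TT" using True by (auto simp: torus_def t_def)
    have "tmonom s (- u) t = (\<Prod>j<s. if j = i then 2 powi (- u) j else 1)"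
      unfolding tmonom_def t_def by (intro prod.cong) auto
    then have "tmonom s (- u) t = 2 powi (- u i)" using True by (simp add: fun_simps)
    then have "(2 :: 'a) powi (- u i * int (nat k)) = 2 powi 0"
      using pw[OF t] by (simp only: power_int_power' power_int_0_right)
    then have "- u i * int (nat k) = 0" by (rule two_power_int_eq)
    then show ?thesis using k(1) by simp
  next
    case False
    then show ?thesis using S_weights[OF u] by (simp add: weights_def)
  qed
  then show ?thesis by (auto simp: fun_simps)
qed

lemma W_zero: assumes f: "f \<in> W 0" shows "\<exists>c. f = fscale c (cind X)"
proof -
  have "restrict f X \<in> range (\<lambda>c. \<lambda>x\<in>X. c)"
    using weight_space_canonical[OF f] pointed by (simp add: weight_character_zero pointed_grading_def)
  then obtain c where c: "restrict f X = (\<lambda>x\<in>X. c)" by blast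
  have "f x = fscale c (cind X) x" for x
  proof (cases "x \<in> X")
    case True
    then show ?thesis using fun_cong[OF c, of x] by (simp add: fscale_apply cind_def)
  next
    case False
    then show ?thesis using regular_ring_off[OF W_R[OF f]] by (simp add: fscale_apply cind_def)
  qed
  then show ?thesis by blast
qed

end

context pointed_torus
begin

text \<open>The generators are the homogeneous components of the coordinate functions. Those of
  degree 0 are constants and are dropped, so that every remaining generator has nonzero
  weight.\<close>

lemma homogeneous_generators:
  "\<exists>Y wt. finite Y \<and> (\<forall>y\<in>Y. y \<in> W (wt y) \<and> y \<noteq> 0 \<and> wt y \<noteq> 0) \<and> (\<forall>f\<in>R. regular_on X Y f)"
proof -
  have "\<exists>F h. finite F \<and> (\<forall>i\<in>F. h i \<in> W i) \<and> coord_fun X k = sum h F" for k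
    by (rule direct_sumD(3)[OF direct_sum_W coord_fun_regular_ring])
  then obtain F h where Fh: "\<And>k. finite (F k)" "\<And>k i. i \<in> F k \<Longrightarrow> h k i \<in> W i"
    "\<And>k. coord_fun X k = sum (h k) (F k)" by metis
  define Y where "Y = (\<Union>k. h k ` {i \<in> F k. h k i \<noteq> 0 \<and> i \<noteq> 0})"
  have "\<exists>u. y \<in> W u \<and> u \<noteq> 0" if "y \<in> Y" for y using that Fh(2) unfolding Y_def by blast
  then obtain wt where wt: "\<And>y. y \<in> Y \<Longrightarrow> y \<in> W (wt y) \<and> wt y \<noteq> 0" by metis
  have hY: "regular_on X Y (h k i)" if i: "i \<in> F k" for k i
  proof (cases "h k i = 0 \<or> i = 0")
    case True
    then obtain c where "h k i = fscale c (cind X)"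
      using W_zero Fh(2)[OF i] fv.scale_zero_left by metis
    then show ?thesis
      by (intro regular_on_cong[OF _ regular_on_const[of _ _ c]]) (simp add: fscale_apply cind_def)
  next
    case False
    then show ?thesis using i by (intro regular_on_generator) (auto simp: Y_def)
  qed
  have "regular_on X Y f" if "f \<in> R" for f
  proof (rule regular_on_trans[OF regular_ring_regular[OF that]])
    fix g :: "'a ^ 'n \<Rightarrow> 'a" assume "g \<in> affine_coords"
    then obtain k where g: "g = (\<lambda>x. x $ k)" by (auto simp: affine_coords_def)
    have "regular_on X Y (\<lambda>x. \<Sum>i\<in>F k. h k i x)" by (rule regular_on_sum[OF hY])
    then show "regular_on X Y g"
    proof (rule regular_on_cong[rotated])
      fix x assume "x \<in> X"
      then have "g x = coord_fun X k x" by (simp add: g coord_fun_def)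
      then show "(\<Sum>i\<in>F k. h k i x) = g x" unfolding Fh(3) by (simp add: sum_fun_apply)
    qed
  qed
  moreover have "finite Y" unfolding Y_def using Fh(1) by simp
  moreover have "y \<noteq> 0" if "y \<in> Y" for y using that by (auto simp: Y_def)
  ultimately show ?thesis using wt by (intro exI[of _ Y] exI[of _ wt]) simp
qed

end

section \<open>Degrees of monomials and indecomposable weights\<close>

definition nsc :: "nat \<Rightarrow> (nat \<Rightarrow> int) \<Rightarrow> nat \<Rightarrow> int" where
  "nsc n u = (\<lambda>i. int n * u i)"

lemma nsc_simps: "nsc 0 u = 0" "nsc (Suc n) u = u + nsc n u" "nsc (m + n) u = nsc m u + nsc n u"
  by (auto simp: nsc_def fun_simps algebra_simps)

locale generated_pointed_torus = pointed_torus X T s \<phi>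
  for X :: "('a::{alg_closed_field, field_char_0} ^ 'n::finite) set" and T s \<phi> +
  fixes Y :: "('a ^ 'n \<Rightarrow> 'a) set" and wt :: "('a ^ 'n \<Rightarrow> 'a) \<Rightarrow> nat \<Rightarrow> int"
  assumes finite_Y: "finite Y" and Y_W: "y \<in> Y \<Longrightarrow> y \<in> W (wt y)" and Y_nonzero: "y \<in> Y \<Longrightarrow> y \<noteq> 0"
    and wt_nonzero: "y \<in> Y \<Longrightarrow> wt y \<noteq> 0" and gen: "f \<in> R \<Longrightarrow> regular_on X Y f"
begin

definition wsum :: "(('a ^ 'n \<Rightarrow> 'a) \<Rightarrow> nat) \<Rightarrow> nat \<Rightarrow> int" where
  "wsum a = (\<Sum>y\<in>Y. nsc (a y) (wt y))"

lemma wsum_add: "wsum (a + b) = wsum a + wsum b"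
  by (simp add: wsum_def fun_simps nsc_simps sum.distrib)

lemma wt_S: "y \<in> Y \<Longrightarrow> wt y \<in> S"
  unfolding S_iff using Y_W Y_nonzero by blast

text \<open>Nonvanishing rests on the ring being a domain; it puts the degree of every monomial into
  \<open>S\<close>.\<close>

lemma monomial_W:
  assumes "Z \<subseteq> Y"
  shows "cind X * (\<Prod>y\<in>Z. y ^ a y) \<in> W (\<Sum>y\<in>Z. nsc (a y) (wt y)) \<and> cind X * (\<Prod>y\<in>Z. y ^ a y) \<noteq> 0"
  using finite_subset[OF assms finite_Y] assms
proof (induction Z rule: finite_induct)
  case empty
  have "cind X * 1 \<in> W 0 \<and> cind X * 1 \<noteq> (0 :: 'a ^ 'n \<Rightarrow> 'a)"
    using cind_W cind_nonzero by simp
  then show ?case by (simp only: sum.empty prod.empty simp_thms)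
next
  case (insert y Z)
  define p where "p = cind X * (\<Prod>y\<in>Z. y ^ a y)"
  define u where "u = (\<Sum>y\<in>Z. nsc (a y) (wt y))"
  have p: "p \<in> W u" "p \<noteq> 0" using insert unfolding p_def u_def by auto
  have y: "y \<in> W (wt y)" "y \<noteq> 0" using insert.prems Y_W Y_nonzero by auto
  have "p * y ^ n \<in> W (nsc n (wt y) + u) \<and> p * y ^ n \<noteq> 0" for n
  proof (induction n)
    case 0
    have "p * 1 \<in> W (0 + u) \<and> p * 1 \<noteq> 0" using p by simp
    then show ?case by (simp only: nsc_simps power_0 simp_thms)
  next
    case (Suc n)
    have "y * (p * y ^ n) \<in> W (wt y + (nsc n (wt y) + u))" using W_mult[OF y(1)] Suc.IH by blast
    moreover have "y * (p * y ^ n) \<noteq> 0" using R_domain W_R y Suc.IH by blast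
    moreover have "p * y ^ Suc n = y * (p * y ^ n)" by (simp add: mult_ac)
    ultimately show ?case by (simp only: nsc_simps add.assoc not_False_eq_True simp_thms)
  qed
  from this[of "a y"] show ?case
    using insert.hyps by (simp add: p_def u_def mult_ac)
qed

lemma monom_W: "monom_fun X Y a \<in> W (wsum a)" and monom_nonzero: "monom_fun X Y a \<noteq> 0"
  using monomial_W[OF subset_refl] by (simp_all add: monom_fun_def wsum_def)

lemma wsum_S: "wsum a \<in> S"
  unfolding S_iff using monom_W monom_nonzero by blast

definition unit_exp where "unit_exp z = (\<lambda>y. if y = z then 1 else 0 :: nat)"

lemma wsum_unit_exp: assumes "z \<in> Y" shows "wsum (unit_exp z) = wt z"
proof -
  have "wsum (unit_exp z) = (\<Sum>y\<in>Y. if y = z then nsc 1 (wt y) else 0)"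
    unfolding wsum_def by (intro sum.cong) (auto simp: unit_exp_def nsc_simps)
  also have "\<dots> = nsc 1 (wt z)" using assms finite_Y by simp
  finally show ?thesis by (simp add: nsc_def)
qed

lemma exponent_split:
  assumes "a y > 0" shows "a = unit_exp y + (\<lambda>z. a z - unit_exp y z)"
  using assms by (auto simp: fun_eq_iff fun_simps unit_exp_def)

text \<open>Splitting off one generator writes 0 as its weight plus another element of
  \<open>S\<close>; pointedness makes this weight 0, which was excluded.\<close>

lemma wsum_eq_0:
  assumes a: "a \<in> exponents Y" and "wsum a = 0"
  shows "a = 0"
proof (rule ccontr)
  assume "a \<noteq> 0"
  then obtain y where y: "a y \<noteq> 0" by (auto simp: fun_eq_iff fun_simps)
  then have yY: "y \<in> Y" using a by (auto simp: exponents_def)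
  have "wsum a = wsum (unit_exp y) + wsum (\<lambda>z. a z - unit_exp y z)"
    using wsum_add exponent_split[of a y] y by (metis gr0I)
  then have "wt y + wsum (\<lambda>z. a z - unit_exp y z) = 0"
    using assms(2) by (simp add: wsum_unit_exp[OF yY])
  then have "wt y = 0" by (rule S_pointed[OF wt_S[OF yY] wsum_S])
  then show False using wt_nonzero[OF yY] by blast
qed

text \<open>By Dickson's lemma an infinite set would contain two comparable exponents, whose
  difference is a nonzero exponent of degree 0.\<close>

lemma finite_wsum: "finite {a \<in> exponents Y. wsum a = u}"
proof (rule ccontr)
  assume "infinite {a \<in> exponents Y. wsum a = u}"
  then have "\<exists>a\<in>{a \<in> exponents Y. wsum a = u}. \<exists>b\<in>{a \<in> exponents Y. wsum a = u}. a \<noteq> b \<and> (\<forall>y. a y \<le> b y)"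
    by (rule dickson[OF finite_Y]) simp
  then obtain a b where ab: "a \<in> exponents Y" "b \<in> exponents Y" "wsum a = u" "wsum b = u" "a \<noteq> b" "\<And>y. a y \<le> b y"
    by blast
  define c where "c = (\<lambda>y. b y - a y)"
  have b: "b = a + c" using ab(6) by (auto simp: c_def fun_eq_iff fun_simps)
  then have "wsum c = 0" using wsum_add[of a c] ab(3,4) by simp
  moreover have "c \<in> exponents Y" using ab(2) by (auto simp: c_def exponents_def)
  ultimately have "c = 0" by (rule wsum_eq_0[rotated])
  then show False using b ab(5) by simp
qed

text \<open>In an expansion of \<open>f\<close> into monomials, those of equal degree are collected;
  uniqueness of components discards all degrees but \<open>u\<close>.\<close>

lemma W_subset_span: "W u \<subseteq> fv.span (monom_fun X Y ` {a \<in> exponents Y. wsum a = u})"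
proof
  fix f assume f: "f \<in> W u"
  have "f \<in> fv.span (monom_fun X Y ` exponents Y)"
    by (rule regular_on_imp_span_monom[OF finite_Y gen[OF W_R[OF f]] regular_ring_off[OF W_R[OF f]]])
  then obtain t r where t: "finite t" "t \<subseteq> monom_fun X Y ` exponents Y" "f = (\<Sum>v\<in>t. fscale (r v) v)"
    unfolding fv.span_explicit by blast
  have "\<forall>v\<in>t. \<exists>a. a \<in> exponents Y \<and> v = monom_fun X Y a" using t(2) by blast
  then obtain e where e: "\<And>v. v \<in> t \<Longrightarrow> e v \<in> exponents Y \<and> v = monom_fun X Y (e v)" by metis
  define w where "w = (\<lambda>v. wsum (e v))"
  define k where "k = (\<lambda>x. \<Sum>v\<in>{v \<in> t. w v = x}. fscale (r v) v)"
  have "f = sum k (w ` t)" unfolding t(3) k_def by (rule sum.image_gen[OF t(1)])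
  moreover have "k x \<in> W x" for x
    unfolding k_def
  proof (intro fv.subspace_sum[OF subspace_W] fv.subspace_scale[OF subspace_W])
    fix v assume "v \<in> {v \<in> t. w v = x}"
    then show "v \<in> W x" using monom_W[of "e v"] e[of v] unfolding w_def by auto
  qed
  ultimately have u: "(if u \<in> {u} then f else 0) = (if u \<in> w ` t then k u else 0)"
    by (intro direct_sum_unique[OF direct_sum_W, of "{u}" "\<lambda>_. f" "w ` t" k]) (use f t(1) in auto)
  have "k u \<in> fv.span (monom_fun X Y ` {a \<in> exponents Y. wsum a = u})"
    unfolding k_def
  proof (intro fv.span_sum fv.span_scale fv.span_base)
    fix v assume v: "v \<in> {v \<in> t. w v = u}"
    then have "v = monom_fun X Y (e v)" "e v \<in> exponents Y" using e by blast+
    then show "v \<in> monom_fun X Y ` {a \<in> exponents Y. wsum a = u}" 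
      using v unfolding w_def by blast
  qed
  then show "f \<in> fv.span (monom_fun X Y ` {a \<in> exponents Y. wsum a = u})"
    using u fv.span_zero by (auto split: if_splits simp del: fv.span_zero)
qed

lemma W_finite_dim: "\<exists>B. finite B \<and> W u \<subseteq> fv.span B"
  using W_subset_span finite_wsum by blast

lemma S_wsum: assumes "u \<in> S" shows "\<exists>a\<in>exponents Y. wsum a = u"
proof (rule ccontr)
  assume "\<not> ?thesis"
  then have "{a \<in> exponents Y. wsum a = u} = {}" by blast
  then have "W u \<subseteq> fv.span (monom_fun X Y ` {})" using W_subset_span[of u] by (simp only:)
  then have "W u \<subseteq> {0}" by simp
  then show False using assms unfolding S_iff by blast
qed

text \<open>Defined from the monoid \<open>S\<close> alone, without reference to the generators, so
  that additive permutations of \<open>S\<close> preserve it.\<close>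

definition indec :: "(nat \<Rightarrow> int) set" where
  "indec = {u \<in> S. u \<noteq> 0 \<and> \<not> (\<exists>a\<in>S. \<exists>b\<in>S. a \<noteq> 0 \<and> b \<noteq> 0 \<and> u = a + b)}"

lemma indec_subset: "indec \<subseteq> wt ` Y"
proof
  fix u assume u: "u \<in> indec"
  then have "u \<in> S" by (simp add: indec_def)
  then obtain a where a: "a \<in> exponents Y" "wsum a = u" using S_wsum[of u] by blast
  have "a \<noteq> 0"
  proof
    assume "a = 0"
    then have "wsum a = 0" by (simp add: wsum_def fun_simps nsc_simps)
    then show False using u a(2) by (simp add: indec_def)
  qed
  then obtain y where y: "a y \<noteq> 0" by (auto simp: fun_eq_iff fun_simps)
  then have yY: "y \<in> Y" using a(1) by (auto simp: exponents_def)
  let ?v = "wsum (\<lambda>z. a z - unit_exp y z)"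
  have "u = wt y + ?v"
    using wsum_add[of "unit_exp y" "\<lambda>z. a z - unit_exp y z"] exponent_split[of a y] y a(2)
    by (simp add: wsum_unit_exp[OF yY])
  then have "?v = 0" using u wsum_S wt_S[OF yY] wt_nonzero[OF yY] unfolding indec_def by blast
  then show "u \<in> wt ` Y" using \<open>u = wt y + ?v\<close> yY by simp
qed

lemma finite_indec: "finite indec"
  using indec_subset finite_Y finite_subset by blast

text \<open>The largest number of generators, with multiplicity, in a monomial of degree
  \<open>u\<close>. It is superadditive and positive away from 0, so both parts of a decomposition
  are strictly shorter.\<close>

definition len :: "(nat \<Rightarrow> int) \<Rightarrow> nat" where
  "len u = Max ((\<lambda>a. \<Sum>y\<in>Y. a y) ` {a \<in> exponents Y. wsum a = u})"

lemma len_ge: "a \<in> exponents Y \<Longrightarrow> wsum a = u \<Longrightarrow> (\<Sum>y\<in>Y. a y) \<le> len u"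
  unfolding len_def by (intro Max_ge finite_imageI finite_wsum) blast

lemma len_attained: assumes "u \<in> S" shows "\<exists>a\<in>exponents Y. wsum a = u \<and> len u = (\<Sum>y\<in>Y. a y)"
proof -
  have "len u \<in> (\<lambda>a. \<Sum>y\<in>Y. a y) ` {a \<in> exponents Y. wsum a = u}"
    unfolding len_def using S_wsum[OF assms] by (intro Max_in finite_imageI finite_wsum) blast
  then show ?thesis by blast
qed

lemma len_pos: assumes "u \<in> S" "u \<noteq> 0" shows "len u > 0"
proof (rule ccontr)
  assume "\<not> len u > 0"
  then obtain a where a: "a \<in> exponents Y" "wsum a = u" "(\<Sum>y\<in>Y. a y) = 0"
    using len_attained[OF assms(1)] by auto
  then have "\<forall>y\<in>Y. a y = 0" using finite_Y by simp
  then have "wsum a = 0" by (simp add: wsum_def nsc_simps)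
  then show False using a(2) assms(2) by simp
qed

lemma len_add: assumes "u \<in> S" "v \<in> S" shows "len u + len v \<le> len (u + v)"
proof -
  obtain a b where ab: "a \<in> exponents Y" "wsum a = u" "len u = (\<Sum>y\<in>Y. a y)"
    "b \<in> exponents Y" "wsum b = v" "len v = (\<Sum>y\<in>Y. b y)" using len_attained assms by blast
  have "len u + len v = (\<Sum>y\<in>Y. (a + b) y)" by (simp add: ab fun_simps sum.distrib)
  also have "\<dots> \<le> len (u + v)"
    using ab exponents_add by (intro len_ge) (auto simp: wsum_add)
  finally show ?thesis .
qed

lemma S_induct:
  assumes "u \<in> S" "P 0" "\<And>u. u \<in> indec \<Longrightarrow> P u" "\<And>u v. u \<in> S \<Longrightarrow> v \<in> S \<Longrightarrow> P u \<Longrightarrow> P v \<Longrightarrow> P (u + v)"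
  shows "P u"
  using assms(1)
proof (induction "len u" arbitrary: u rule: less_induct)
  case less
  show ?case
  proof (cases "u = 0 \<or> u \<in> indec")
    case True
    then show ?thesis using assms(2,3) by blast
  next
    case False
    then obtain a b where ab: "a \<in> S" "b \<in> S" "a \<noteq> 0" "b \<noteq> 0" "u = a + b"
      using less.prems unfolding indec_def by blast
    then have "len a < len u" "len b < len u"
      using len_add[OF ab(1,2)] len_pos[OF ab(1,3)] len_pos[OF ab(2,4)] by simp_all
    then show ?thesis using assms(4)[OF ab(1,2)] less.hyps ab by blast
  qed
qed

end

section \<open>The action of the automorphism group on the weights\<close>

definition pull :: "'x set \<Rightarrow> ('x \<Rightarrow> 'x) \<Rightarrow> ('x \<Rightarrow> 'a::zero) \<Rightarrow> 'x \<Rightarrow> 'a" where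
  "pull X g f = (\<lambda>x. if x \<in> X then f (g x) else 0)"

lemma pull_scale: "pull X g (fscale c f) = fscale c (pull X g f)"
  by (auto simp: pull_def fun_eq_iff fun_simps)

lemma pull_mult: "pull X g (f * h) = pull X g f * pull X g (h :: _ \<Rightarrow> 'a::mult_zero)"
  by (auto simp: pull_def fun_eq_iff fun_simps)

lemma pull_sum: "pull X g (\<Sum>i\<in>I. f i) = (\<Sum>i\<in>I. pull X g (f i :: _ \<Rightarrow> 'a::comm_monoid_add))"
  by (auto simp: pull_def fun_eq_iff fun_simps)

lemma pull_compose: "g' \<in> X \<rightarrow> X \<Longrightarrow> pull X (compose X g g') f = pull X g' (pull X g f)"
  by (auto simp: pull_def fun_eq_iff compose_def)

lemma pull_id: "f \<in> regular_ring X \<Longrightarrow> pull X (\<lambda>x\<in>X. x) f = f"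
  by (auto simp: pull_def fun_eq_iff regular_ring_off)

lemma pull_regular_ring:
  assumes "g \<in> automorphisms X" "f \<in> regular_ring X" shows "pull X g f \<in> regular_ring X"
  by (rule regular_ringI[of X "\<lambda>x. f (g x)"])
    (use assms in \<open>auto simp: pull_def automorphisms_def intro: regular_on_comp_map regular_ring_regular\<close>)

lemma automorphism_funcset: "g \<in> automorphisms X \<Longrightarrow> g \<in> X \<rightarrow> X"
  by (auto simp: automorphisms_def Bij_def bij_betw_def)

lemma compose_automorphisms: "g \<in> automorphisms X \<Longrightarrow> h \<in> automorphisms X \<Longrightarrow> compose X g h \<in> automorphisms X"
  using monoid.m_closed[OF group.is_monoid[OF group_Aut], of g X h] by (simp add: carrier_Aut mult_Aut)

lemma automorphism_inverse:
  assumes "g \<in> automorphisms X"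
  shows "inv\<^bsub>Aut X\<^esub> g \<in> automorphisms X" "compose X g (inv\<^bsub>Aut X\<^esub> g) = (\<lambda>x\<in>X. x)"
    "compose X (inv\<^bsub>Aut X\<^esub> g) g = (\<lambda>x\<in>X. x)"
proof -
  interpret A: group "Aut X" by (rule group_Aut)
  have g: "g \<in> carrier (Aut X)" using assms by (simp add: carrier_Aut)
  show 1: "inv\<^bsub>Aut X\<^esub> g \<in> automorphisms X" using A.inv_closed[OF g] by (simp add: carrier_Aut)
  show "compose X g (inv\<^bsub>Aut X\<^esub> g) = (\<lambda>x\<in>X. x)" "compose X (inv\<^bsub>Aut X\<^esub> g) g = (\<lambda>x\<in>X. x)"
    using A.r_inv[OF g] A.l_inv[OF g] mult_Aut[OF assms 1] mult_Aut[OF 1 assms] by (simp_all add: one_Aut)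
qed

lemma pull_inverse:
  assumes "g \<in> automorphisms X" "f \<in> regular_ring X"
  shows "pull X (inv\<^bsub>Aut X\<^esub> g) (pull X g f) = f" "pull X g (pull X (inv\<^bsub>Aut X\<^esub> g) f) = f"
  using pull_compose[OF automorphism_funcset[OF automorphism_inverse(1)[OF assms(1)]], of g f]
    pull_compose[OF automorphism_funcset[OF assms(1)], of "inv\<^bsub>Aut X\<^esub> g" f]
    automorphism_inverse(2,3)[OF assms(1)] pull_id[OF assms(2)] by simp_all

lemma pull_nonzero:
  assumes "g \<in> automorphisms X" "f \<in> regular_ring X" "f \<noteq> 0" shows "pull X g f \<noteq> 0"
proof
  assume "pull X g f = 0"
  then have "f = pull X (inv\<^bsub>Aut X\<^esub> g) 0" using pull_inverse(1)[OF assms(1,2)] by simp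
  also have "\<dots> = 0" by (auto simp: pull_def fun_eq_iff fun_simps)
  finally show False using assms(3) by blast
qed

text \<open>Conjugation transports the parametrization, and the new action sends
  \<open>(t, x)\<close> to \<open>g (\<phi> t (g' x))\<close> with \<open>g'\<close> the inverse of
  \<open>g\<close>, a composite of regular maps.\<close>

lemma (in torus_on_variety) conjugate_subtorus:
  assumes g: "g \<in> automorphisms X"
  shows "subtorus X ((\<lambda>a. g \<otimes>\<^bsub>Aut X\<^esub> a \<otimes>\<^bsub>Aut X\<^esub> inv\<^bsub>Aut X\<^esub> g) ` T)"
proof -
  interpret A: group "Aut X" by (rule group_Aut)
  let ?g' = "inv\<^bsub>Aut X\<^esub> g"
  define c where "c a = g \<otimes>\<^bsub>Aut X\<^esub> a \<otimes>\<^bsub>Aut X\<^esub> ?g'" for a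
  have gc: "g \<in> carrier (Aut X)" using g by (simp add: carrier_Aut)
  have Tc: "a \<in> carrier (Aut X)" if "a \<in> T" for a using that T_automorphisms by (auto simp: carrier_Aut)
  have c_mult: "c (a \<otimes>\<^bsub>Aut X\<^esub> b) = c a \<otimes>\<^bsub>Aut X\<^esub> c b" if "a \<in> T" "b \<in> T" for a b
  proof -
    note m = gc Tc[OF that(1)] Tc[OF that(2)]
    have "?g' \<otimes>\<^bsub>Aut X\<^esub> (g \<otimes>\<^bsub>Aut X\<^esub> z) = z" if "z \<in> carrier (Aut X)" for z
      using that gc by (simp add: A.m_assoc[symmetric])
    then show ?thesis unfolding c_def using m by (simp add: A.m_assoc)
  qed
  have c_inj: "inj_on c T"
  proof (rule inj_onI)
    fix a b assume ab: "a \<in> T" "b \<in> T" "c a = c b"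
    then have "g \<otimes>\<^bsub>Aut X\<^esub> a = g \<otimes>\<^bsub>Aut X\<^esub> b" unfolding c_def using gc Tc by (simp add: A.right_cancel)
    then show "a = b" using gc Tc ab by simp
  qed
  have hom: "c \<circ> \<phi> \<in> hom (torus s) (Aut X)"
  proof (rule homI)
    fix t t' assume t: "t \<in> TT" "t' \<in> TT"
    have "\<phi> (t \<otimes>\<^bsub>torus s\<^esub> t') = \<phi> t \<otimes>\<^bsub>Aut X\<^esub> \<phi> t'" using \<phi>_iso t by (auto simp: iso_def hom_def)
    then show "(c \<circ> \<phi>) (t \<otimes>\<^bsub>torus s\<^esub> t') = (c \<circ> \<phi>) t \<otimes>\<^bsub>Aut X\<^esub> (c \<circ> \<phi>) t'"
      using c_mult[OF \<phi>_mem[OF t(1)] \<phi>_mem[OF t(2)]] by simp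
  qed (use gc Tc \<phi>_mem in \<open>auto simp: c_def\<close>)
  interpret h: group_hom "torus s" "Aut X" "c \<circ> \<phi>"
    by (rule group_hom.intro[OF group_torus group_Aut]) (unfold group_hom_axioms_def, rule hom)
  have img: "(c \<circ> \<phi>) ` TT = c ` T" unfolding \<phi>_image[symmetric] by (simp add: image_comp)
  have sub: "subgroup (c ` T) (Aut X)" using h.img_is_subgroup unfolding img .
  have "inj_on (c \<circ> \<phi>) TT" using comp_inj_on[OF \<phi>_inj, of c] c_inj by (simp add: \<phi>_image)
  then have iso: "c \<circ> \<phi> \<in> iso (torus s) (Aut X\<lparr>carrier := c ` T\<rparr>)"
    using hom img by (auto simp: iso_def hom_def bij_betw_def)
  have g': "?g' \<in> automorphisms X" by (rule automorphism_inverse(1)[OF g])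
  have c_apply: "(c \<circ> \<phi>) t x = g (\<phi> t (?g' x))" if "t \<in> TT" "x \<in> X" for t x
  proof -
    have "g \<otimes>\<^bsub>Aut X\<^esub> \<phi> t = compose X g (\<phi> t)" by (rule mult_Aut[OF g \<phi>_automorphism[OF that(1)]])
    moreover have "g \<otimes>\<^bsub>Aut X\<^esub> \<phi> t \<in> automorphisms X"
      using A.m_closed[OF gc Tc[OF \<phi>_mem[OF that(1)]]] by (simp add: carrier_Aut)
    ultimately show ?thesis
      using that(2) automorphism_mem[OF g' that(2)] by (simp add: c_def mult_Aut g' compose_def)
  qed
  let ?C = "prod_coords (torus_coords s) affine_coords :: ((nat \<Rightarrow> 'a) \<times> ('a ^ 'n) \<Rightarrow> 'a) set"
  have "regular_map (TT \<times> X) ?C X (\<lambda>z. \<phi> (fst z) (?g' (snd z)))"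
    unfolding regular_map_iff
  proof (intro conjI allI)
    show "(\<lambda>z. \<phi> (fst z) (?g' (snd z))) \<in> TT \<times> X \<rightarrow> X"
      using automorphism_mem[OF \<phi>_automorphism automorphism_mem[OF g']] by auto
    fix i
    have "regular_on (TT \<times> X) ?C (\<lambda>z. (case (fst z, ?g' (snd z)) of (t, x) \<Rightarrow> \<phi> t x) $ i)"
    proof (rule regular_on_comp[where Y = "TT \<times> X" and H = ?C and f = "\<lambda>z. (case z of (t, x) \<Rightarrow> \<phi> t x) $ i"])
      show "regular_on (TT \<times> X) ?C (\<lambda>z. (case z of (t, x) \<Rightarrow> \<phi> t x) $ i)"
        using \<phi>_regular unfolding regular_map_iff by blast
      show "(\<lambda>z. (fst z, ?g' (snd z))) \<in> TT \<times> X \<rightarrow> TT \<times> X"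
        using automorphism_mem[OF g'] by auto
      fix h assume "h \<in> ?C"
      then consider q where "q \<in> torus_coords s" "h = q \<circ> fst" | j where "h = (\<lambda>x. x $ j) \<circ> snd"
        by (auto simp: prod_coords_def affine_coords_def)
      then show "regular_on (TT \<times> X) ?C (\<lambda>z. h (fst z, ?g' (snd z)))"
      proof cases
        case 1
        then show ?thesis using regular_on_fst[OF regular_on_generator, of q "torus_coords s"] by simp
      next
        case 2
        have "regular_on X affine_coords (\<lambda>x. ?g' x $ j)"
          using g' by (simp add: automorphisms_def regular_map_iff)
        then show ?thesis using regular_on_snd 2 by simp
      qed
    qed
    then show "regular_on (TT \<times> X) ?C (\<lambda>z. \<phi> (fst z) (?g' (snd z)) $ i)" by simp
  qed
  moreover have "regular_map X affine_coords X g" using g by (simp add: automorphisms_def)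
  ultimately have r: "regular_map (TT \<times> X) ?C X (\<lambda>z. g (\<phi> (fst z) (?g' (snd z))))"
    by (rule regular_map_comp[rotated])
  have "regular_map (TT \<times> X) ?C X (\<lambda>(t, x). (c \<circ> \<phi>) t x)"
    by (rule regular_map_cong[OF _ r]) (use c_apply in fastforce)
  then have "torus_structure X (c ` T) s (c \<circ> \<phi>)" unfolding torus_structure_def using sub iso by blast
  then show ?thesis unfolding subtorus_def c_def by blast
qed

lemma (in torus_on_variety) maximal_torus_normal:
  assumes "maximal_torus X T" shows "T \<lhd> Aut X"
proof -
  interpret A: group "Aut X" by (rule group_Aut)
  show ?thesis
    unfolding A.normal_inv_iff
    using subgroup_T conjugate_subtorus assms unfolding maximal_torus_def carrier_Aut by blast
qed

section \<open>The permutation of the weights induced by an automorphism\<close>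

locale maximal_torus_setup = generated_pointed_torus X T s \<phi> Y wt
  for X :: "('a::{alg_closed_field, field_char_0} ^ 'n::finite) set" and T s \<phi> Y wt +
  assumes maximal: "maximal_torus X T"
begin

lemma W_unique: assumes "f \<in> W u" "f \<in> W v" "f \<noteq> 0" shows "u = v"
proof -
  have "(if u \<in> {u} then f else 0) = (if u \<in> {v} then f else 0)"
    by (rule direct_sum_unique[OF direct_sum_W, of "{u}" "\<lambda>_. f" "{v}" "\<lambda>_. f"]) (use assms in auto)
  then show ?thesis using assms(3) by (auto split: if_splits)
qed

lemma conjugate_torus:
  assumes g: "g \<in> automorphisms X" and t: "t \<in> TT"
  shows "\<exists>t'\<in>TT. \<forall>x\<in>X. g (\<phi> t x) = \<phi> t' (g x)"
proof -
  interpret A: group "Aut X" by (rule group_Aut)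
  let ?g' = "inv\<^bsub>Aut X\<^esub> g"
  have gc: "g \<in> carrier (Aut X)" "\<phi> t \<in> carrier (Aut X)" using g \<phi>_automorphism[OF t] by (auto simp: carrier_Aut)
  have "g \<otimes>\<^bsub>Aut X\<^esub> \<phi> t \<otimes>\<^bsub>Aut X\<^esub> ?g' \<in> T"
    using normal.inv_op_closed2[OF maximal_torus_normal[OF maximal] gc(1) \<phi>_mem[OF t]] .
  then obtain t' where t': "t' \<in> TT" "g \<otimes>\<^bsub>Aut X\<^esub> \<phi> t \<otimes>\<^bsub>Aut X\<^esub> ?g' = \<phi> t'" using \<phi>_image by blast
  have "\<phi> t' \<otimes>\<^bsub>Aut X\<^esub> g = g \<otimes>\<^bsub>Aut X\<^esub> \<phi> t"
    unfolding t'(2)[symmetric] using gc by (simp add: A.m_assoc)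
  then have "compose X (\<phi> t') g = compose X g (\<phi> t)"
    by (simp add: mult_Aut g \<phi>_automorphism t t'(1))
  then have "g (\<phi> t x) = \<phi> t' (g x)" if "x \<in> X" for x
    using fun_cong[of _ _ x] that by (metis compose_eq)
  then show ?thesis using t'(1) by blast
qed

text \<open>Conjugation by \<open>g\<close> induces a map \<open>\<tau>\<close> on the torus, here
  obtained pointwise by choice. That \<open>tmonom s u (\<tau> t)\<close> is again a monomial in
  \<open>t\<close> is read off from a nonzero homogeneous component of one function pulled back from
  \<open>W u\<close>.\<close>

lemma pull_weight_space:
  assumes g: "g \<in> automorphisms X" and u: "u \<in> S"
  shows "\<exists>v\<in>S. \<forall>f\<in>W u. pull X g f \<in> W v"
proof -
  have "\<forall>t\<in>TT. \<exists>t'\<in>TT. \<forall>x\<in>X. g (\<phi> t x) = \<phi> t' (g x)" using conjugate_torus[OF g] by blast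
  then obtain \<tau> where \<tau>: "\<And>t. t \<in> TT \<Longrightarrow> \<tau> t \<in> TT" "\<And>t x. t \<in> TT \<Longrightarrow> x \<in> X \<Longrightarrow> g (\<phi> t x) = \<phi> (\<tau> t) (g x)"
    by metis
  have act: "pull X g f (\<phi> t x) = tmonom s u (\<tau> t) * pull X g f x" if "f \<in> W u" "t \<in> TT" "x \<in> X" for f t x
    using that \<tau> automorphism_mem[OF \<phi>_automorphism[OF that(2)] that(3)] W_apply[OF that(1) \<tau>(1)[OF that(2)] automorphism_mem[OF g that(3)]]
    by (simp add: pull_def)
  obtain f where f: "f \<in> W u" "f \<noteq> 0" using u unfolding S_iff by blast
  define k where "k = pull X g f"
  have k: "k \<in> R" "k \<noteq> 0" unfolding k_def using pull_regular_ring[OF g] pull_nonzero[OF g] f W_R by auto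
  obtain F h where F: "finite F" "\<forall>v\<in>F. h v \<in> W v" "k = sum h F" using direct_sumD(3)[OF direct_sum_W k(1)] by blast
  have "\<exists>v\<in>F. h v \<noteq> 0" using k(2) F(3) by (metis sum.neutral)
  then obtain v where v: "v \<in> F" "h v \<noteq> 0" by blast
  have vw: "v \<in> weights s" using W_weights F(2) v by blast
  have th: "tmonom s u (\<tau> t) = tmonom s v t" if t: "t \<in> TT" for t
  proof -
    \<comment> \<open>The pulled back function is an eigenvector of \<open>\<phi> t\<close>;
      subtracting eigenvalue times function from its translate gives a vanishing sum of homogeneous
      terms.\<close>
    have "(\<Sum>w\<in>F. fscale (tmonom s w t - tmonom s u (\<tau> t)) (h w)) = 0"
    proof (rule ext)
      fix x
      show "(\<Sum>w\<in>F. fscale (tmonom s w t - tmonom s u (\<tau> t)) (h w)) x = 0 x"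
      proof (cases "x \<in> X")
        case True
        have "(\<Sum>w\<in>F. h w (\<phi> t x)) = tmonom s u (\<tau> t) * (\<Sum>w\<in>F. h w x)"
          using act[OF f(1) t True] F(3) unfolding k_def[symmetric] by (simp add: fun_simps)
        moreover have "(\<Sum>w\<in>F. h w (\<phi> t x)) = (\<Sum>w\<in>F. tmonom s w t * h w x)"
          using F(2) W_apply t True by (intro sum.cong) auto
        ultimately show ?thesis by (simp add: fun_simps left_diff_distrib sum_subtractf sum_distrib_left)
      next
        case False
        then have "h w x = 0" if "w \<in> F" for w using regular_ring_off[OF W_R] F(2) that by blast
        then show ?thesis by (simp add: fun_simps)
      qed
    qed
    then have "fscale (tmonom s v t - tmonom s u (\<tau> t)) (h v) = 0"
      by (intro direct_sumD(4)[OF direct_sum_W F(1) _ _ v(1), of "\<lambda>w. fscale (tmonom s w t - tmonom s u (\<tau> t)) (h w)"])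
        (use F(2) fv.subspace_scale[OF subspace_W] in auto)
    then show ?thesis using v(2) by simp
  qed
  have "pull X g f' \<in> W v" if "f' \<in> W u" for f'
    unfolding weight_space_iff[OF vw] using act[OF that] th pull_regular_ring[OF g W_R[OF that]] by simp
  moreover have "v \<in> S" unfolding S_iff using F(2) v by blast
  ultimately show ?thesis by blast
qed

definition wperm :: "('a ^ 'n \<Rightarrow> 'a ^ 'n) \<Rightarrow> (nat \<Rightarrow> int) \<Rightarrow> nat \<Rightarrow> int" where
  "wperm g u = (SOME v. v \<in> S \<and> (\<forall>f\<in>W u. pull X g f \<in> W v))"

lemma wperm: 
  assumes "g \<in> automorphisms X" "u \<in> S" 
  shows "wperm g u \<in> S" "\<And>f. f \<in> W u \<Longrightarrow> pull X g f \<in> W (wperm g u)"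
proof -
  have "\<exists>v. v \<in> S \<and> (\<forall>f\<in>W u. pull X g f \<in> W v)" using pull_weight_space[OF assms] by blast
  from someI_ex[OF this] show "wperm g u \<in> S" "\<And>f. f \<in> W u \<Longrightarrow> pull X g f \<in> W (wperm g u)"
    unfolding wperm_def by blast+
qed

lemma wperm_eqI:
  assumes "g \<in> automorphisms X" "u \<in> S" "f \<in> W u" "f \<noteq> 0" "pull X g f \<in> W v" shows "wperm g u = v"
  by (rule W_unique[OF wperm(2)[OF assms(1-3)] assms(5) pull_nonzero[OF assms(1) W_R[OF assms(3)] assms(4)]])

lemma wperm_add:
  assumes "g \<in> automorphisms X" "u \<in> S" "v \<in> S" shows "wperm g (u + v) = wperm g u + wperm g v"
proof -
  obtain f h where fh: "f \<in> W u" "f \<noteq> 0" "h \<in> W v" "h \<noteq> 0" using assms(2,3) unfolding S_iff by blast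
  show ?thesis
    by (rule wperm_eqI[OF assms(1) S_add[OF assms(2,3)] W_mult[OF fh(1,3)]])
      (use R_domain[OF W_R[OF fh(1)] W_R[OF fh(3)]] fh wperm(2)[OF assms(1)] assms(2,3) in \<open>auto simp: pull_mult intro!: W_mult\<close>)
qed

lemma wperm_zero: assumes g: "g \<in> automorphisms X" shows "wperm g 0 = 0"
proof (rule wperm_eqI[OF g zero_S cind_W cind_nonzero])
  have "pull X g (cind X) = (cind X :: 'a ^ 'n \<Rightarrow> 'a)" using automorphism_mem[OF g] by (auto simp: pull_def cind_def fun_eq_iff)
  then show "pull X g (cind X) \<in> W 0" using cind_W by (simp only:)
qed

lemma wperm_compose:
  assumes "g \<in> automorphisms X" "h \<in> automorphisms X" "u \<in> S"
  shows "wperm (compose X g h) u = wperm h (wperm g u)"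
proof -
  obtain f where f: "f \<in> W u" "f \<noteq> 0" using assms(3) unfolding S_iff by blast
  show ?thesis
    by (rule wperm_eqI[OF compose_automorphisms[OF assms(1,2)] assms(3) f])
      (simp add: pull_compose automorphism_funcset assms wperm f)
qed

lemma wperm_id: assumes "u \<in> S" shows "wperm (\<lambda>x\<in>X. x) u = u"
proof -
  obtain f where f: "f \<in> W u" "f \<noteq> 0" using assms unfolding S_iff by blast
  have "(\<lambda>x\<in>X. x) \<in> automorphisms X"
    using monoid.one_closed[OF group.is_monoid[OF group_Aut], of X] by (simp add: carrier_Aut one_Aut)
  then show ?thesis by (rule wperm_eqI[OF _ assms f]) (simp add: pull_id[OF W_R[OF f(1)]] f)
qed

lemma wperm_inverse:
  assumes g: "g \<in> automorphisms X" and u: "u \<in> S"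
  shows "wperm (inv\<^bsub>Aut X\<^esub> g) (wperm g u) = u" "wperm g (wperm (inv\<^bsub>Aut X\<^esub> g) u) = u"
  using wperm_compose[OF g automorphism_inverse(1)[OF g] u] wperm_compose[OF automorphism_inverse(1)[OF g] g u]
    automorphism_inverse(2,3)[OF g] wperm_id[OF u] by simp_all

text \<open>A decomposition of the image would be carried back to a decomposition of
  \<open>u\<close> by the inverse automorphism.\<close>

lemma wperm_indec: assumes g: "g \<in> automorphisms X" and u: "u \<in> indec" shows "wperm g u \<in> indec"
proof -
  let ?g' = "inv\<^bsub>Aut X\<^esub> g"
  have g': "?g' \<in> automorphisms X" by (rule automorphism_inverse(1)[OF g])
  have uS: "u \<in> S" "u \<noteq> 0" using u by (auto simp: indec_def)
  have nz: "wperm h v \<noteq> 0" if "h \<in> automorphisms X" "v \<in> S" "v \<noteq> 0" for h v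
    using wperm_inverse(1)[OF that(1,2)] wperm_zero[OF automorphism_inverse(1)[OF that(1)]] that(3) by auto
  have "\<not> (\<exists>a\<in>S. \<exists>b\<in>S. a \<noteq> 0 \<and> b \<noteq> 0 \<and> wperm g u = a + b)"
  proof
    assume "\<exists>a\<in>S. \<exists>b\<in>S. a \<noteq> 0 \<and> b \<noteq> 0 \<and> wperm g u = a + b"
    then obtain a b where ab: "a \<in> S" "b \<in> S" "a \<noteq> 0" "b \<noteq> 0" "wperm g u = a + b" by blast
    have "u = wperm ?g' a + wperm ?g' b"
      using wperm_inverse(1)[OF g uS(1)] wperm_add[OF g' ab(1,2)] ab(5) by simp
    then show False using u wperm(1)[OF g'] nz[OF g'] ab unfolding indec_def by blast
  qed
  then show ?thesis unfolding indec_def using wperm(1)[OF g uS(1)] nz[OF g uS] by blast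
qed

text \<open>The subgroup \<open>G\<close> of the overview.\<close>

definition stab :: "('a ^ 'n \<Rightarrow> 'a ^ 'n) set" where
  "stab = {g \<in> automorphisms X. \<forall>u. \<forall>f\<in>W u. pull X g f \<in> W u}"

lemma stabI: 
  assumes "g \<in> automorphisms X" "\<And>u. u \<in> S \<Longrightarrow> wperm g u = u" shows "g \<in> stab"
  unfolding stab_def
proof (intro CollectI conjI allI ballI assms(1))
  fix u f assume f: "f \<in> W u"
  show "pull X g f \<in> W u"
  proof (cases "f = 0")
    case True
    then have "pull X g f = 0" by (auto simp: pull_def fun_eq_iff fun_simps)
    then show ?thesis using fv.subspace_0[OF subspace_W] by (simp only:)
  next
    case False
    then have "u \<in> S" using f unfolding S_iff by blast
    then show ?thesis using wperm(2)[OF assms(1) _ f] assms(2) by simp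
  qed
qed

lemma stab_finite_index:
  "\<exists>Q. finite Q \<and> Q \<subseteq> automorphisms X \<and> (\<forall>g\<in>automorphisms X. \<exists>q\<in>Q. \<exists>k\<in>stab. g = compose X k q)"
proof -
  define \<kappa> where "\<kappa> g = restrict (wperm g) indec" for g
  have "\<kappa> ` automorphisms X \<subseteq> indec \<rightarrow>\<^sub>E indec" unfolding \<kappa>_def using wperm_indec by auto
  then have "finite (\<kappa> ` automorphisms X)"
    using finite_PiE[OF finite_indec, of "\<lambda>_. indec"] finite_indec finite_subset by blast
  \<comment> \<open>One may take representatives of the finitely many self-maps of
    \<open>indec\<close> that arise from automorphisms.\<close>
  then obtain Q where Q: "Q \<subseteq> automorphisms X" "finite Q" "\<kappa> ` automorphisms X = \<kappa> ` Q"
    using finite_subset_image[of "\<kappa> ` automorphisms X" \<kappa> "automorphisms X"] by blast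
  have "\<exists>q\<in>Q. \<exists>k\<in>stab. g = compose X k q" if g: "g \<in> automorphisms X" for g
  proof -
    obtain q where q: "q \<in> Q" "\<kappa> g = \<kappa> q" using Q(3) g by (metis imageE imageI)
    have qa: "q \<in> automorphisms X" using q Q(1) by blast
    let ?q' = "inv\<^bsub>Aut X\<^esub> q"
    have q': "?q' \<in> automorphisms X" by (rule automorphism_inverse(1)[OF qa])
    have agree: "wperm g u = wperm q u" if "u \<in> S" for u
      using that
    proof (rule S_induct)
      show "wperm g 0 = wperm q 0" using wperm_zero g qa by simp
      show "wperm g u = wperm q u" if "u \<in> indec" for u
        using fun_cong[OF q(2), of u] that by (simp add: \<kappa>_def)
      show "wperm g (u + v) = wperm q (u + v)" if "u \<in> S" "v \<in> S" "wperm g u = wperm q u" "wperm g v = wperm q v" for u v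
        using wperm_add[OF g that(1,2)] wperm_add[OF qa that(1,2)] that(3,4) by simp
    qed
    have k: "compose X g ?q' \<in> stab"
      by (rule stabI[OF compose_automorphisms[OF g q']])
        (simp add: wperm_compose[OF g q'] agree wperm_inverse[OF qa])
    have "g x = compose X (compose X g ?q') q x" for x
    proof (cases "x \<in> X")
      case True
      then have "?q' (q x) = x" using fun_cong[OF automorphism_inverse(3)[OF qa], of x] by (simp add: compose_def)
      then show ?thesis using True automorphism_mem[OF qa True] by (simp add: compose_def)
    next
      case False
      moreover have "g \<in> extensional X" using g by (auto simp: automorphisms_def Bij_def)
      ultimately show ?thesis by (simp add: compose_def extensional_def)
    qed
    then show ?thesis using q(1) k by (intro bexI[of _ q] bexI[of _ "compose X g ?q'"]) auto
  qed
  then show ?thesis using Q(1,2) by blast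
qed

lemma stab_automorphism: "g \<in> stab \<Longrightarrow> g \<in> automorphisms X"
  and stab_W: "g \<in> stab \<Longrightarrow> f \<in> W u \<Longrightarrow> pull X g f \<in> W u"
  by (auto simp: stab_def)

lemma compose_stab: "g \<in> stab \<Longrightarrow> h \<in> stab \<Longrightarrow> compose X g h \<in> stab"
  unfolding stab_def by (simp add: compose_automorphisms pull_compose automorphism_funcset)

lemma pull_\<phi>: "t \<in> TT \<Longrightarrow> f \<in> W u \<Longrightarrow> pull X (\<phi> t) f = fscale (tmonom s u t) f"
  using regular_ring_off[OF W_R] W_apply by (auto simp: pull_def fun_eq_iff fscale_apply)

lemma \<phi>_stab: "t \<in> TT \<Longrightarrow> \<phi> t \<in> stab"
  unfolding stab_def by (auto simp: \<phi>_automorphism pull_\<phi> intro: fv.subspace_scale[OF subspace_W])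

lemma inverse_stab: assumes g: "g \<in> stab" shows "inv\<^bsub>Aut X\<^esub> g \<in> stab"
proof (rule stabI[OF automorphism_inverse(1)[OF stab_automorphism[OF g]]])
  fix u assume u: "u \<in> S"
  then obtain f where f: "f \<in> W u" "f \<noteq> 0" unfolding S_iff by blast
  have "wperm g u = u" by (rule wperm_eqI[OF stab_automorphism[OF g] u f stab_W[OF g f(1)]])
  then show "wperm (inv\<^bsub>Aut X\<^esub> g) u = u" using wperm_inverse(1)[OF stab_automorphism[OF g] u] by simp
qed

end

section \<open>The subgroup of determinant one\<close>

definition rat_vec :: "(nat \<Rightarrow> int) \<Rightarrow> nat \<Rightarrow> rat" where
  "rat_vec u = (\<lambda>i. of_int (u i))"

lemma inj_rat_vec: "inj rat_vec"
  by (rule injI) (auto simp: rat_vec_def fun_eq_iff)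

text \<open>Functionals dual to the independent vectors of \<open>J\<close> invert the exponent
  matrix over the rationals. Clearing denominators by \<open>N\<close> leaves an integer matrix
  \<open>Z\<close>, and \<open>N\<close>-th roots of the prescribed values compensate for the factor
  \<open>N\<close>.\<close>

lemma tmonom_solve:
  fixes a :: "(nat \<Rightarrow> int) \<Rightarrow> 'a::{alg_closed_field, field_char_0}"
  assumes J: "finite J" "J \<subseteq> weights s" "fv.independent (rat_vec ` J)" and a: "\<And>u. u \<in> J \<Longrightarrow> a u \<noteq> 0"
  shows "\<exists>t\<in>carrier (torus s). \<forall>u\<in>J. tmonom s u t = a u"
proof -
  have "\<exists>r :: (nat \<Rightarrow> rat) \<Rightarrow> rat. (\<forall>f g. r (f + g) = r f + r g) \<and> (\<forall>c f. r (fscale c f) = c * r f) \<and>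
      (\<forall>b\<in>rat_vec ` J. r b = (if b = rat_vec u then 1 else 0))" for u
    by (rule ex_linear_functional[OF J(3)])
  then obtain r :: "(nat \<Rightarrow> int) \<Rightarrow> (nat \<Rightarrow> rat) \<Rightarrow> rat" where r: "\<And>u f g. r u (f + g) = r u f + r u g"
    "\<And>u c f. r u (fscale c f) = c * r u f" "\<And>u v. v \<in> J \<Longrightarrow> r u (rat_vec v) = (if rat_vec v = rat_vec u then 1 else 0)"
    by (metis image_eqI)
  have r0: "r u 0 = 0" for u using r(1)[of u 0 0] by simp
  have rsum: "r u (sum f I) = (\<Sum>i\<in>I. r u (f i))" for u f and I :: "nat set"
    by (induction I rule: infinite_finite_induct) (simp_all only: sum.infinite sum.empty sum.insert r0 r(1) not_False_eq_True)
  define ev where "ev i = (\<lambda>j. if j = i then 1 else 0 :: rat)" for i :: nat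
  \<comment> \<open>Duality in coordinates: a weight vanishes from position \<open>s\<close> on, so
    it is a combination of the first \<open>s\<close> unit vectors.\<close>
  have dual: "(\<Sum>i<s. of_int (v i) * r u (ev i)) = (if v = u then 1 else 0)" if v: "v \<in> J" for u v
  proof -
    have "rat_vec v = (\<Sum>i<s. fscale (of_int (v i)) (ev i))"
    proof (rule ext)
      fix j
      have "(\<Sum>i<s. of_int (v i) * (if j = i then 1 else 0 :: rat)) = (\<Sum>i<s. if j = i then of_int (v i) else 0)"
        by (intro sum.cong) auto
      then have "(\<Sum>i<s. fscale (of_int (v i)) (ev i)) j = (if j < s then of_int (v j) else 0)"
        by (simp add: fun_simps ev_def)
      then show "rat_vec v j = (\<Sum>i<s. fscale (of_int (v i)) (ev i)) j"
        using J(2) v by (auto simp: rat_vec_def weights_def not_less)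
    qed
    then have "r u (rat_vec v) = (\<Sum>i<s. of_int (v i) * r u (ev i))" by (simp only: rsum r(2))
    then show ?thesis using r(3)[OF v, of u] inj_rat_vec by (simp add: inj_eq)
  qed
  obtain N :: int where N: "N > 0" "\<forall>q\<in>(\<lambda>(i, u). r u (ev i)) ` ({..<s} \<times> J). \<exists>z. of_int N * q = of_int z"
    using common_denominator[of "(\<lambda>(i, u). r u (ev i)) ` ({..<s} \<times> J)"] J(1) by auto
  then have "\<forall>i u. i < s \<and> u \<in> J \<longrightarrow> (\<exists>z. of_int N * r u (ev i) = of_int z)" by auto
  then obtain Z :: "nat \<Rightarrow> (nat \<Rightarrow> int) \<Rightarrow> int" where
    Z: "\<And>i u. i < s \<Longrightarrow> u \<in> J \<Longrightarrow> of_int N * r u (ev i) = of_int (Z i u)" by metis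
  have rel: "(\<Sum>i<s. Z i u * v i) = (if v = u then N else 0)" if "u \<in> J" "v \<in> J" for u v
  proof -
    have "of_int (\<Sum>i<s. Z i u * v i) = (\<Sum>i<s. of_int N * (of_int (v i) * r u (ev i)))"
      unfolding of_int_sum
    proof (rule sum.cong[OF refl])
      fix i assume "i \<in> {..<s}"
      then show "of_int (Z i u * v i) = of_int N * (of_int (v i) * r u (ev i))"
        using Z[of i u] that(1) by (simp add: mult_ac) 
    qed
    also have "\<dots> = of_int (if v = u then N else 0)"
      unfolding sum_distrib_left[symmetric] dual[OF that(2)] by simp
    finally show ?thesis by (simp only: of_int_eq_iff)
  qed
  have "\<exists>y. y ^ nat N = a u" for u using nth_root_exists[of "nat N" "a u"] N(1) by auto
  then obtain b where b: "\<And>u. b u ^ nat N = a u" by metis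
  have b0: "b u \<noteq> 0" if "u \<in> J" for u using b[of u] a[OF that] N(1) by (auto simp: power_0_left)
  \<comment> \<open>Evaluating \<open>tmonom s v\<close> here produces the exponents
    \<open>\<Sum>i<s. Z i u * v i\<close>, which by \<open>rel\<close> are \<open>N\<close> for
    \<open>u = v\<close> and 0 otherwise.\<close>
  define t where "t i = (if i < s then \<Prod>u\<in>J. b u powi Z i u else 1)" for i
  have t: "t \<in> carrier (torus s)" using b0 J(1) by (auto simp: torus_def t_def)
  have prod_powi: "(\<Prod>u\<in>I. f u) powi n = (\<Prod>u\<in>I. f u powi n)" for I :: "(nat \<Rightarrow> int) set" and f :: "_ \<Rightarrow> 'a" and n
    by (induction I rule: infinite_finite_induct) (auto simp: power_int_mult_distrib)
  have sum_powi: "x powi (\<Sum>i\<in>I. f i) = (\<Prod>i\<in>I. x powi f i)" if "x \<noteq> 0" for x :: 'a and I :: "nat set" and f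
    using that by (induction I rule: infinite_finite_induct) (auto simp: power_int_add)
  have "tmonom s v t = a v" if v: "v \<in> J" for v
  proof -
    have "tmonom s v t = (\<Prod>i<s. \<Prod>u\<in>J. b u powi (Z i u * v i))"
      unfolding tmonom_def t_def by (intro prod.cong refl) (simp add: prod_powi power_int_mult)
    also have "\<dots> = (\<Prod>u\<in>J. \<Prod>i<s. b u powi (Z i u * v i))" by (rule prod.swap)
    also have "\<dots> = (\<Prod>u\<in>J. if v = u then a u else 1)"
    proof (rule prod.cong[OF refl])
      fix u assume u: "u \<in> J"
      have "(\<Prod>i<s. b u powi (Z i u * v i)) = b u powi (if v = u then N else 0)"
        unfolding rel[OF u v, symmetric] by (rule sum_powi[OF b0[OF u], symmetric])
      also have "\<dots> = (if v = u then a u else 1)" using b[of u] N(1) by (auto simp: power_int_def)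
      finally show "(\<Prod>i<s. b u powi (Z i u * v i)) = (if v = u then a u else 1)" .
    qed
    also have "\<dots> = a v" using J(1) v by simp
    finally show ?thesis .
  qed
  then show ?thesis using t by blast
qed

section \<open>Bases of the weight spaces\<close>

context generated_pointed_torus
begin

lemma ex_weight_basis: "\<exists>l. distinct l \<and> fv.independent (set l) \<and> set l \<subseteq> W u \<and> W u \<subseteq> fv.span (set l)"
proof -
  obtain B where B: "B \<subseteq> W u" "fv.independent B" "W u \<subseteq> fv.span B" by (rule fv.maximal_independent_subset)
  obtain B' where B': "finite B'" "W u \<subseteq> fv.span B'" using W_finite_dim by blast
  have "B \<subseteq> fv.span B'" using B(1) B'(2) by blast
  then have "finite B" using fv.independent_span_bound[OF B'(1) B(2)] by blast
  then obtain l where "set l = B" "distinct l" using finite_distinct_list by blast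
  then show ?thesis using B by blast
qed

text \<open>A list and not a set, so that positions can serve as matrix indices.\<close>

definition basis :: "(nat \<Rightarrow> int) \<Rightarrow> ('a ^ 'n \<Rightarrow> 'a) list" where
  "basis u = (SOME l. distinct l \<and> fv.independent (set l) \<and> set l \<subseteq> W u \<and> W u \<subseteq> fv.span (set l))"

lemma basis: "distinct (basis u)" "fv.independent (set (basis u))" "set (basis u) \<subseteq> W u" "W u \<subseteq> fv.span (set (basis u))"
  using someI_ex[OF ex_weight_basis[of u]] unfolding basis_def[symmetric] by blast+

abbreviation "dm u \<equiv> length (basis u)"

definition coord :: "(nat \<Rightarrow> int) \<Rightarrow> nat \<Rightarrow> ('a ^ 'n \<Rightarrow> 'a) \<Rightarrow> 'a" where
  "coord u j f = fv.representation (set (basis u)) f (basis u ! j)"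

lemma basis_W: "i < dm u \<Longrightarrow> basis u ! i \<in> W u"
  using basis(3) nth_mem by blast

lemma basis_expand: assumes "f \<in> W u" shows "f = (\<Sum>j<dm u. fscale (coord u j f) (basis u ! j))"
proof -
  have "f \<in> fv.span (set (basis u))" using assms basis(4) by blast
  then have "f = (\<Sum>b\<in>set (basis u). fscale (fv.representation (set (basis u)) f b) b)"
    by (rule fv.sum_representation_eq[OF basis(2) _ finite_set subset_refl, symmetric])
  also have "\<dots> = (\<Sum>j<dm u. fscale (coord u j f) (basis u ! j))"
    unfolding coord_def
    by (rule sum.reindex_bij_betw[OF bij_betw_nth[OF basis(1) refl refl], symmetric])
  finally show ?thesis .
qed

lemma basis_unique:
  assumes "(\<Sum>j<dm u. fscale (a j) (basis u ! j)) = (\<Sum>j<dm u. fscale (b j) (basis u ! j))" "j < dm u"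
  shows "a j = b j"
proof -
  define k where "k x = a (inv_into {..<dm u} (\<lambda>j. basis u ! j) x) - b (inv_into {..<dm u} (\<lambda>j. basis u ! j) x)" for x
  have bij: "bij_betw (\<lambda>j. basis u ! j) {..<dm u} (set (basis u))" by (rule bij_betw_nth[OF basis(1) refl refl])
  have kj: "k (basis u ! j) = a j - b j" if "j < dm u" for j
    unfolding k_def using bij_betw_inv_into_left[OF bij, of j] that by simp
  have "(\<Sum>x\<in>set (basis u). fscale (k x) x) = (\<Sum>j<dm u. fscale (k (basis u ! j)) (basis u ! j))"
    by (rule sum.reindex_bij_betw[OF bij, symmetric])
  also have "\<dots> = (\<Sum>j<dm u. fscale (a j) (basis u ! j) - fscale (b j) (basis u ! j))"
    by (intro sum.cong refl) (simp add: kj fv.scale_left_diff_distrib)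
  also have "\<dots> = 0" using assms(1) by (simp add: sum_subtractf)
  finally have "k (basis u ! j) = 0"
    by (rule fv.independentD[OF basis(2) finite_set subset_refl]) (use assms(2) in simp)
  then show ?thesis using kj[OF assms(2)] by simp
qed

lemma dm_pos: "u \<in> S \<Longrightarrow> dm u > 0"
  using basis(4)[of u] unfolding S_iff by (cases "basis u") auto

end

context maximal_torus_setup
begin

definition cf :: "(nat \<Rightarrow> int) \<Rightarrow> nat \<Rightarrow> nat \<Rightarrow> ('a ^ 'n \<Rightarrow> 'a ^ 'n) \<Rightarrow> 'a" where
  "cf u i j g = coord u j (pull X g (basis u ! i))"

lemma pull_basis:
  assumes "g \<in> stab" "i < dm u" 
  shows "pull X g (basis u ! i) = (\<Sum>j<dm u. fscale (cf u i j g) (basis u ! j))"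
  unfolding cf_def by (rule basis_expand[OF stab_W[OF assms(1) basis_W[OF assms(2)]]])

lemma cf_unique:
  assumes "g \<in> stab" "i < dm u" "j < dm u" "pull X g (basis u ! i) = (\<Sum>j<dm u. fscale (a j) (basis u ! j))" 
  shows "cf u i j g = a j"
  using pull_basis[OF assms(1,2)] assms(4) by (intro basis_unique[OF _ assms(3)]) simp

text \<open>Two reversals cancel: pullback is contravariant, but the image of the
  \<open>i\<close>-th basis function is stored in row \<open>i\<close>. The matrices therefore
  multiply in the order of composition.\<close>

lemma cf_compose:
  assumes "g \<in> stab" "h \<in> stab" "i < dm u" "j < dm u"
  shows "cf u i j (compose X g h) = (\<Sum>k<dm u. cf u i k g * cf u k j h)"
proof (rule cf_unique[OF compose_stab[OF assms(1,2)] assms(3,4)])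
  have "pull X (compose X g h) (basis u ! i) = (\<Sum>k<dm u. fscale (cf u i k g) (pull X h (basis u ! k)))"
    using assms by (simp add: pull_compose automorphism_funcset stab_automorphism pull_basis pull_sum pull_scale)
  also have "\<dots> = (\<Sum>k<dm u. \<Sum>j<dm u. fscale (cf u i k g * cf u k j h) (basis u ! j))"
    using assms(2) by (intro sum.cong refl) (simp add: pull_basis fv.scale_sum_right)
  also have "\<dots> = (\<Sum>j<dm u. \<Sum>k<dm u. fscale (cf u i k g * cf u k j h) (basis u ! j))" by (rule sum.swap)
  finally show "pull X (compose X g h) (basis u ! i) =
      (\<Sum>j<dm u. fscale (\<Sum>k<dm u. cf u i k g * cf u k j h) (basis u ! j))"
    by (simp add: fv.scale_sum_left)
qed

lemma id_stab: "(\<lambda>x\<in>X. x) \<in> stab"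
proof -
  have "(\<lambda>x\<in>X. x) \<in> automorphisms X"
    using monoid.one_closed[OF group.is_monoid[OF group_Aut], of X] by (simp add: carrier_Aut one_Aut)
  then show ?thesis using W_R by (simp add: stab_def pull_id)
qed

lemma cf_scalar:
  assumes "g \<in> stab" "i < dm u" "j < dm u" "pull X g (basis u ! i) = fscale c (basis u ! i)"
  shows "cf u i j g = (if i = j then c else 0)"
proof (rule cf_unique[OF assms(1-3)])
  have "(\<Sum>j<dm u. fscale (if i = j then c else 0) (basis u ! j)) = (\<Sum>j<dm u. if i = j then fscale c (basis u ! j) else 0)"
    by (intro sum.cong) auto
  then show "pull X g (basis u ! i) = (\<Sum>j<dm u. fscale (if i = j then c else 0) (basis u ! j))"
    using assms(2,4) by simp
qed

lemma cf_id: "i < dm u \<Longrightarrow> j < dm u \<Longrightarrow> cf u i j (\<lambda>x\<in>X. x) = (if i = j then 1 else 0)"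
  by (rule cf_scalar[OF id_stab]) (simp_all add: pull_id[OF W_R[OF basis_W]])

lemma cf_torus: "t \<in> TT \<Longrightarrow> i < dm u \<Longrightarrow> j < dm u \<Longrightarrow> cf u i j (\<phi> t) = (if i = j then tmonom s u t else 0)"
  by (rule cf_scalar[OF \<phi>_stab]) (simp_all add: pull_\<phi>[OF _ basis_W])

definition det_on :: "(nat \<Rightarrow> int) \<Rightarrow> ('a ^ 'n \<Rightarrow> 'a ^ 'n) \<Rightarrow> 'a" where
  "det_on u g = Determinant.det (Matrix.mat (dm u) (dm u) (\<lambda>(i, j). cf u i j g))"

lemma det_on_compose:
  assumes "g \<in> stab" "h \<in> stab" shows "det_on u (compose X g h) = det_on u g * det_on u h"
proof -
  let ?M = "\<lambda>g. Matrix.mat (dm u) (dm u) (\<lambda>(i, j). cf u i j g)"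
  have "?M (compose X g h) = ?M g * ?M h"
    by (rule eq_matI) (auto simp: cf_compose[OF assms] scalar_prod_def atLeast0LessThan intro!: sum.cong)
  then show ?thesis unfolding det_on_def by (simp add: det_mult[of _ "dm u"])
qed

lemma det_on_torus: assumes "t \<in> TT" shows "det_on u (\<phi> t) = tmonom s u t ^ dm u"
proof -
  have "Matrix.mat (dm u) (dm u) (\<lambda>(i, j). cf u i j (\<phi> t)) = tmonom s u t \<cdot>\<^sub>m 1\<^sub>m (dm u)"
    by (rule eq_matI) (auto simp: cf_torus[OF assms])
  then show ?thesis unfolding det_on_def by (simp add: det_smult)
qed

lemma det_on_id: "det_on u (\<lambda>x\<in>X. x) = 1"
proof -
  have "Matrix.mat (dm u) (dm u) (\<lambda>(i, j). cf u i j (\<lambda>x\<in>X. x)) = 1\<^sub>m (dm u)"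
    by (rule eq_matI) (auto simp: cf_id)
  then show ?thesis unfolding det_on_def by simp
qed

lemma det_on_inverse: assumes "g \<in> stab" shows "det_on u g * det_on u (inv\<^bsub>Aut X\<^esub> g) = 1"
  using det_on_compose[OF assms inverse_stab[OF assms], of u]
    automorphism_inverse(2)[OF stab_automorphism[OF assms]] det_on_id by simp

lemma det_on_nonzero: "g \<in> stab \<Longrightarrow> det_on u g \<noteq> 0"
  using det_on_inverse[of g u] by auto

text \<open>A rational basis of the span of the weights of the generators, chosen among these
  weights.\<close>

definition frame :: "(nat \<Rightarrow> int) set" where
  "frame = (SOME J. J \<subseteq> wt ` Y \<and> fv.independent (rat_vec ` J) \<and> rat_vec ` wt ` Y \<subseteq> fv.span (rat_vec ` J))"

lemma frame: "frame \<subseteq> wt ` Y" "fv.independent (rat_vec ` frame)" "rat_vec ` wt ` Y \<subseteq> fv.span (rat_vec ` frame)"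
proof -
  obtain B where B: "B \<subseteq> rat_vec ` wt ` Y" "fv.independent B" "rat_vec ` wt ` Y \<subseteq> fv.span B"
    by (rule fv.maximal_independent_subset)
  define J where "J = {u \<in> wt ` Y. rat_vec u \<in> B}"
  have "rat_vec ` J = B" using B(1) by (auto simp: J_def)
  then have "\<exists>J. J \<subseteq> wt ` Y \<and> fv.independent (rat_vec ` J) \<and> rat_vec ` wt ` Y \<subseteq> fv.span (rat_vec ` J)"
    using B by (intro exI[of _ J]) (auto simp: J_def)
  from someI_ex[OF this] show "frame \<subseteq> wt ` Y" "fv.independent (rat_vec ` frame)"
    "rat_vec ` wt ` Y \<subseteq> fv.span (rat_vec ` frame)" unfolding frame_def by blast+
qed

lemma finite_frame: "finite frame" using frame(1) finite_Y finite_subset by blast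

lemma frame_S: "u \<in> frame \<Longrightarrow> u \<in> S" using frame(1) wt_S by blast

text \<open>The subgroup \<open>G\<^sub>1\<close> of the overview.\<close>

definition slice :: "('a ^ 'n \<Rightarrow> 'a ^ 'n) set" where
  "slice = {g \<in> stab. \<forall>u\<in>frame. det_on u g = 1}"

text \<open>A torus element has determinant \<open>tmonom s u t ^ dm u\<close> on
  \<open>W u\<close>. So \<open>dm u\<close>-th roots of the determinants of \<open>g\<close> are
  prescribed as values of the monomials; independence of the frame lets one \<open>t\<close> attain
  all of them.\<close>

lemma stab_decompose:
  assumes g: "g \<in> stab"
  shows "\<exists>t\<in>TT. \<exists>h\<in>slice. g = compose X (\<phi> t) h"
proof -
  have "\<exists>y. y ^ dm u = det_on u g" if "u \<in> frame" for u
    using nth_root_exists[OF dm_pos[OF frame_S[OF that]]] by blast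
  then obtain a where a: "\<And>u. u \<in> frame \<Longrightarrow> a u ^ dm u = det_on u g" by metis
  have a0: "a u \<noteq> 0" if "u \<in> frame" for u
    using a[OF that] det_on_nonzero[OF g, of u] dm_pos[OF frame_S[OF that]] by (auto simp: power_0_left)
  have "frame \<subseteq> weights s" using frame_S S_weights by blast
  then have "\<exists>t\<in>TT. \<forall>u\<in>frame. tmonom s u t = a u"
    by (rule tmonom_solve[OF finite_frame _ frame(2) a0])
  then obtain t where t: "t \<in> TT" "\<forall>u\<in>frame. tmonom s u t = a u" by blast
  note st = \<phi>_stab[OF t(1)]
  let ?i = "inv\<^bsub>Aut X\<^esub> \<phi> t"
  have i: "?i \<in> stab" by (rule inverse_stab[OF st])
  have "det_on u (compose X ?i g) = 1" if "u \<in> frame" for u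
    using det_on_inverse[OF st, of u] det_on_compose[OF i g, of u] det_on_torus[OF t(1), of u] t(2) a[OF that] that
    by (simp add: mult.commute)
  then have h: "compose X ?i g \<in> slice" using compose_stab[OF i g] by (simp add: slice_def)
  have "g x = compose X (\<phi> t) (compose X ?i g) x" for x
  proof (cases "x \<in> X")
    case True
    have "g x \<in> X" by (rule automorphism_mem[OF stab_automorphism[OF g] True])
    then show ?thesis 
      using True fun_cong[OF automorphism_inverse(2)[OF stab_automorphism[OF st]], of "g x"] by (simp add: compose_def)
  next
    case False
    moreover have "g \<in> extensional X" using stab_automorphism[OF g] by (auto simp: automorphisms_def Bij_def)
    ultimately show ?thesis by (simp add: compose_def extensional_def)
  qed
  then show ?thesis using t(1) h by blast
qed

lemma slice_stab: "g \<in> slice \<Longrightarrow> g \<in> stab" by (simp add: slice_def)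

lemma id_slice: "(\<lambda>x\<in>X. x) \<in> slice" by (simp add: slice_def id_stab det_on_id)

lemma slice_translate:
  assumes "g \<in> slice" "h \<in> slice" shows "compose X g (inv\<^bsub>Aut X\<^esub> h) \<in> slice"
proof -
  have gh: "g \<in> stab" "h \<in> stab" using assms slice_stab by auto
  have "det_on u (compose X g (inv\<^bsub>Aut X\<^esub> h)) = 1" if "u \<in> frame" for u
    using det_on_compose[OF gh(1) inverse_stab[OF gh(2)], of u] det_on_inverse[OF gh(2), of u] assms that
    by (simp add: slice_def)
  then show ?thesis using compose_stab[OF gh(1) inverse_stab[OF gh(2)]] by (simp add: slice_def)
qed

text \<open>Coordinates on the slice. The weight spaces of the generators are enough, since an
  automorphism is determined by what it does to generators.\<close>

definition coeffs :: "(('a ^ 'n \<Rightarrow> 'a ^ 'n) \<Rightarrow> 'a) set" where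
  "coeffs = (\<Union>u\<in>wt ` Y. (\<lambda>(i, j). cf u i j) ` ({..<dm u} \<times> {..<dm u}))"

lemma finite_coeffs: "finite coeffs" unfolding coeffs_def using finite_Y by simp

lemma cf_coeffs: "u \<in> wt ` Y \<Longrightarrow> i < dm u \<Longrightarrow> j < dm u \<Longrightarrow> cf u i j \<in> coeffs"
  unfolding coeffs_def by (intro UN_I[of u] image_eqI[of _ _ "(i, j)"]) auto

text \<open>Trivial matrix entries mean that all generators are invariant under \<open>g\<close>,
  hence also the coordinate functions.\<close>

lemma coeffs_separate:
  assumes g: "g \<in> slice" and eq: "\<And>c. c \<in> coeffs \<Longrightarrow> c g = c (\<lambda>x\<in>X. x)"
  shows "g = (\<lambda>x\<in>X. x)"
proof (rule ext)
  fix x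
  have ga: "g \<in> automorphisms X" using g slice_stab stab_automorphism by blast
  show "g x = (\<lambda>x\<in>X. x) x"
  proof (cases "x \<in> X")
    case True
    have y: "y (g x) = y x" if y: "y \<in> Y" for y
    proof -
      let ?u = "wt y"
      have b: "pull X g (basis ?u ! i) = basis ?u ! i" if i: "i < dm ?u" for i
      proof -
        have "pull X g (basis ?u ! i) = pull X (\<lambda>x\<in>X. x) (basis ?u ! i)"
          unfolding pull_basis[OF slice_stab[OF g] i] pull_basis[OF id_stab i]
          using eq[OF cf_coeffs[OF imageI[OF y] i]] by (intro sum.cong) auto
        then show ?thesis by (simp add: pull_id[OF W_R[OF basis_W[OF i]]])
      qed
      have "pull X g y = (\<Sum>j<dm ?u. fscale (coord ?u j y) (pull X g (basis ?u ! j)))"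
        by (subst basis_expand[OF Y_W[OF y]]) (simp only: pull_sum pull_scale)
      also have "\<dots> = y" by (subst (2) basis_expand[OF Y_W[OF y]]) (simp add: b)
      finally have "pull X g y x = y x" by simp
      then show ?thesis using True by (simp add: pull_def)
    qed
    have "coord_fun X i (g x) = coord_fun X i x" for i
    proof -
      obtain p where p: "p \<in> fun_algebra Y" "\<forall>x\<in>X. coord_fun X i x = p x"
        using gen[OF coord_fun_regular_ring, of i] unfolding regular_on_def by blast
      from p(1) have "p (g x) = p x" by induction (use y in auto)
      then show ?thesis using p(2) True automorphism_mem[OF ga True] by simp
    qed
    then have "g x $ i = x $ i" for i using True automorphism_mem[OF ga True] by (simp add: coord_fun_def)
    then show ?thesis using True by (simp add: Finite_Cartesian_Product.vec_eq_iff)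
  next
    case False
    then show ?thesis using ga by (auto simp: automorphisms_def Bij_def extensional_def)
  qed
qed

text \<open>Right multiplication by a fixed element is linear in the matrix entries of
  \<open>g\<close>.\<close>

lemma coeffs_translate:
  assumes h: "h \<in> slice" 
  shows "\<exists>\<tau>. \<tau> \<in> slice \<rightarrow> slice \<and> \<tau> h = (\<lambda>x\<in>X. x) \<and> (\<forall>g\<in>slice. \<tau> g = (\<lambda>x\<in>X. x) \<longrightarrow> g = h) \<and>
      (\<forall>c\<in>coeffs. \<exists>a. \<forall>g\<in>slice. c (\<tau> g) = (\<Sum>d\<in>coeffs. a d * d g))"
proof (intro exI[of _ "\<lambda>g. compose X g (inv\<^bsub>Aut X\<^esub> h)"] conjI ballI impI)
  have hs: "h \<in> stab" "inv\<^bsub>Aut X\<^esub> h \<in> stab" using slice_stab[OF h] inverse_stab by auto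
  show "(\<lambda>g. compose X g (inv\<^bsub>Aut X\<^esub> h)) \<in> slice \<rightarrow> slice" using slice_translate[OF _ h] by blast
  show "compose X h (inv\<^bsub>Aut X\<^esub> h) = (\<lambda>x\<in>X. x)" by (rule automorphism_inverse(2)[OF stab_automorphism[OF hs(1)]])
  show "g = h" if g: "g \<in> slice" "compose X g (inv\<^bsub>Aut X\<^esub> h) = (\<lambda>x\<in>X. x)" for g
  proof -
    interpret A: group "Aut X" by (rule group_Aut)
    have a: "g \<in> automorphisms X" "h \<in> automorphisms X" "inv\<^bsub>Aut X\<^esub> h \<in> automorphisms X"
      using slice_stab[OF g(1)] hs stab_automorphism by auto
    then have "g \<otimes>\<^bsub>Aut X\<^esub> inv\<^bsub>Aut X\<^esub> h = \<one>\<^bsub>Aut X\<^esub>" using g(2) by (simp add: mult_Aut one_Aut)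
    then have "g = inv\<^bsub>Aut X\<^esub> (inv\<^bsub>Aut X\<^esub> h)" using a by (intro A.inv_equality[symmetric]) (simp_all add: carrier_Aut)
    then show ?thesis using a by (simp add: carrier_Aut)
  qed
  fix c assume "c \<in> coeffs"
  then obtain u i j where c: "u \<in> wt ` Y" "i < dm u" "j < dm u" "c = cf u i j" unfolding coeffs_def by auto
  have "(\<Sum>k<dm u. fscale (cf u k j (inv\<^bsub>Aut X\<^esub> h)) (cf u i k)) \<in> fv.span coeffs"
    using cf_coeffs[OF c(1,2)] by (intro fv.span_sum fv.span_scale fv.span_base) auto
  \<comment> \<open>Entries at different positions may coincide as functions, so the combination is
    rewritten as a sum over the set \<open>coeffs\<close>.\<close>
  then obtain a where a: "(\<Sum>k<dm u. fscale (cf u k j (inv\<^bsub>Aut X\<^esub> h)) (cf u i k)) = (\<Sum>d\<in>coeffs. fscale (a d) d)"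
    unfolding fv.span_finite[OF finite_coeffs] by blast
  have "c (compose X g (inv\<^bsub>Aut X\<^esub> h)) = (\<Sum>d\<in>coeffs. a d * d g)" if g: "g \<in> slice" for g
    using fun_cong[OF a, of g] cf_compose[OF slice_stab[OF g] hs(2) c(2,3)]
    by (simp add: c(4) fun_simps mult.commute)
  then show "\<exists>a. \<forall>g\<in>slice. c (compose X g (inv\<^bsub>Aut X\<^esub> h)) = (\<Sum>d\<in>coeffs. a d * d g)" by blast
qed

end

section \<open>Finiteness of the slice\<close>

context maximal_torus_setup
begin

lemma nsc_S: "u \<in> S \<Longrightarrow> nsc n u \<in> S"
  by (induction n) (simp_all only: nsc_simps zero_S S_add)

lemma sum_nsc_S: "finite F \<Longrightarrow> F \<subseteq> S \<Longrightarrow> (\<Sum>u\<in>F. nsc (n u) u) \<in> S"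
  by (induction F rule: finite_induct) (simp_all only: sum.empty sum.insert zero_S S_add nsc_S insert_subset not_False_eq_True)

text \<open>A positive multiple of \<open>v\<close> is an integral combination of frame weights, but
  \<open>l\<close> is additive only on the monoid \<open>S\<close>; the negative terms are therefore
  moved to the other side.\<close>

lemma additive_zero_on_frame:
  fixes l :: "(nat \<Rightarrow> int) \<Rightarrow> 'a"
  assumes add: "\<And>u v. u \<in> S \<Longrightarrow> v \<in> S \<Longrightarrow> l (u + v) = l u + l v" and 0: "\<And>u. u \<in> frame \<Longrightarrow> l u = 0"
    and v: "v \<in> wt ` Y"
  shows "l v = 0"
proof -
  have l0: "l 0 = 0" using add[OF zero_S zero_S] by simp
  have ln: "l (nsc n u) = of_nat n * l u" if "u \<in> S" for n u
  proof (induction n)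
    case 0
    show ?case by (simp only: nsc_simps l0 of_nat_0 mult_zero_left)
  next
    case (Suc n)
    then show ?case using add[OF that nsc_S[OF that, of n]] by (simp add: nsc_simps algebra_simps)
  qed
  have lsum: "l (\<Sum>u\<in>F. nsc (n u) u) = 0" if "finite F" "F \<subseteq> frame" for F n
    using that
  proof (induction F rule: finite_induct)
    case empty
    show ?case by (simp only: sum.empty l0)
  next
    case (insert u F)
    have F: "F \<subseteq> frame" "u \<in> frame" using insert.prems by auto
    then have "l (nsc (n u) u + (\<Sum>u\<in>F. nsc (n u) u)) = 0"
      using add[OF nsc_S[OF frame_S[OF F(2)], of "n u"] sum_nsc_S[OF insert.hyps(1), of n]] insert.IH ln[OF frame_S[OF F(2)]] 0[OF F(2)] frame_S
      by auto
    then show ?case using insert.hyps by (simp only: sum.insert not_False_eq_True)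
  qed
  have "rat_vec v \<in> fv.span (rat_vec ` frame)" using frame(3) v by blast
  then obtain q where "rat_vec v = (\<Sum>b\<in>rat_vec ` frame. fscale (q b) b)"
    unfolding fv.span_finite[OF finite_imageI[OF finite_frame]] by blast
  then have q: "rat_vec v = (\<Sum>u\<in>frame. fscale (q (rat_vec u)) (rat_vec u))"
    using inj_rat_vec by (subst (asm) sum.reindex) (auto simp: inj_on_def inj_def)
  obtain N :: int where N: "N > 0" "\<forall>r\<in>(\<lambda>u. q (rat_vec u)) ` frame. \<exists>z. of_int N * r = of_int z"
    using common_denominator[of "(\<lambda>u. q (rat_vec u)) ` frame"] finite_frame by auto
  then have "\<forall>u. u \<in> frame \<longrightarrow> (\<exists>z. of_int N * q (rat_vec u) = of_int z)" by auto
  then obtain z :: "(nat \<Rightarrow> int) \<Rightarrow> int" where z: "\<And>u. u \<in> frame \<Longrightarrow> of_int N * q (rat_vec u) = of_int (z u)" by metis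
  have rel: "N * v i = (\<Sum>u\<in>frame. z u * u i)" for i
  proof -
    have "of_int (N * v i) = of_int N * rat_vec v i" by (simp add: rat_vec_def)
    also have "\<dots> = (\<Sum>u\<in>frame. of_int N * q (rat_vec u) * rat_vec u i)"
      unfolding q by (simp add: fun_simps sum_distrib_left mult_ac)
    also have "\<dots> = of_int (\<Sum>u\<in>frame. z u * u i)"
      unfolding of_int_sum
    proof (rule sum.cong[OF refl])
      fix u assume "u \<in> frame"
      from z[OF this] show "of_int N * q (rat_vec u) * rat_vec u i = of_int (z u * u i)"
        by (simp only: of_int_mult) (simp add: rat_vec_def)
    qed
    finally show ?thesis by (simp only: of_int_eq_iff)
  qed
  \<comment> \<open>Each coefficient \<open>z u\<close> is split into its positive and negative
    parts, so that both sides are sums within \<open>S\<close>.\<close>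
  have "nsc (nat N) v + (\<Sum>u\<in>frame. nsc (nat (- z u)) u) = (\<Sum>u\<in>frame. nsc (nat (z u)) u)"
  proof (rule ext)
    fix i
    have "N * v i + (\<Sum>u\<in>frame. int (nat (- z u)) * u i) = (\<Sum>u\<in>frame. int (nat (z u)) * u i)"
      unfolding rel sum.distrib[symmetric] distrib_right[symmetric] by (intro sum.cong) auto
    then show "(nsc (nat N) v + (\<Sum>u\<in>frame. nsc (nat (- z u)) u)) i = (\<Sum>u\<in>frame. nsc (nat (z u)) u) i"
      using N(1) by (simp add: fun_simps nsc_def)
  qed
  then have "l (nsc (nat N) v + (\<Sum>u\<in>frame. nsc (nat (- z u)) u)) = 0"
    using lsum[OF finite_frame subset_refl, of "\<lambda>u. nat (z u)"] by simp
  moreover have vS: "v \<in> S" using v wt_S by blast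
  moreover have "(\<Sum>u\<in>frame. nsc (nat (- z u)) u) \<in> S"
    by (rule sum_nsc_S[OF finite_frame]) (use frame_S in blast)
  ultimately have "l (nsc (nat N) v) + l (\<Sum>u\<in>frame. nsc (nat (- z u)) u) = 0"
    using add[OF nsc_S[OF vS]] by simp
  then have "of_nat (nat N) * l v = 0"
    using lsum[OF finite_frame subset_refl, of "\<lambda>u. nat (- z u)"] ln[OF vS] by simp
  then show ?thesis using N(1) by simp
qed

lemma finite_slice:
  assumes rigid: "rigid X"
  shows "finite slice"
proof (rule ccontr)
  assume inf: "infinite slice"
  define e where "e = (\<lambda>x\<in>X. x)"
  have "\<exists>\<delta>. (\<forall>f g. \<delta> (f + g) = \<delta> f + \<delta> g) \<and> (\<forall>k f. \<delta> (fscale k f) = k * \<delta> f) \<and>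
    (\<forall>f. (\<forall>g\<in>slice. f g = 0) \<longrightarrow> \<delta> f = 0) \<and> (\<forall>k. \<delta> (\<lambda>_. k) = 0) \<and>
    (\<forall>f g. regular_on slice coeffs f \<longrightarrow> regular_on slice coeffs g \<longrightarrow> \<delta> (f * g) = f e * \<delta> g + g e * \<delta> f) \<and>
    (\<exists>c\<in>coeffs. \<delta> c \<noteq> 0)"
    unfolding e_def by (rule finite_or_tangent_vector[OF finite_coeffs id_slice coeffs_separate coeffs_translate inf])
  then obtain \<delta> where \<delta>': "(\<forall>f g. \<delta> (f + g) = \<delta> f + \<delta> g) \<and> (\<forall>k f. \<delta> (fscale k f) = k * \<delta> f) \<and>
    (\<forall>f. (\<forall>g\<in>slice. f g = 0) \<longrightarrow> \<delta> f = 0) \<and> (\<forall>k. \<delta> (\<lambda>_. k) = 0) \<and>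
    (\<forall>f g. regular_on slice coeffs f \<longrightarrow> regular_on slice coeffs g \<longrightarrow> \<delta> (f * g) = f e * \<delta> g + g e * \<delta> f) \<and>
    (\<exists>c\<in>coeffs. \<delta> c \<noteq> 0)" by (elim exE)
  then have \<delta>: "\<And>f g. \<delta> (f + g) = \<delta> f + \<delta> g" "\<And>k f. \<delta> (fscale k f) = k * \<delta> f"
    "\<And>f. (\<forall>g\<in>slice. f g = 0) \<Longrightarrow> \<delta> f = 0" "\<And>k. \<delta> (\<lambda>_. k) = 0"
    "\<And>f g. regular_on slice coeffs f \<Longrightarrow> regular_on slice coeffs g \<Longrightarrow> \<delta> (f * g) = f e * \<delta> g + g e * \<delta> f"
    by (simp_all only: simp_thms)
  obtain c where c: "c \<in> coeffs" "\<delta> c \<noteq> 0" using \<delta>' by (elim conjE bexE)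
  \<comment> \<open>The tangent vector depends only on values on the slice.\<close>
  have cong: "\<delta> f = \<delta> h" if fh: "\<And>g. g \<in> slice \<Longrightarrow> f g = h g" for f h
  proof -
    have "\<delta> (f - h) = 0" by (rule \<delta>(3)) (simp add: fh fun_simps)
    moreover have "f = (f - h) + h" by simp
    ultimately show ?thesis using \<delta>(1)[of "f - h" h] by simp
  qed
  have \<delta>0: "\<delta> 0 = 0" by (rule \<delta>(3)) (simp add: fun_simps)
  have \<delta>sum: "\<delta> (\<Sum>i\<in>I. f i) = (\<Sum>i\<in>I. \<delta> (f i))" for f and I :: "'i set"
    by (induction I rule: infinite_finite_induct) (simp_all only: sum.infinite sum.empty sum.insert \<delta>0 \<delta>(1) not_False_eq_True)
  \<comment> \<open>The vector field of the tangent vector: for each \<open>x\<close>, the function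
    \<open>g \<mapsto> f (g x)\<close> is differentiated at the identity.\<close>
  define D where "D f x = (if x \<in> X then \<delta> (\<lambda>g. f (g x)) else 0)" for f :: "'a ^ 'n \<Rightarrow> 'a" and x
  have D_add: "D (f + h) = D f + D h" for f h
  proof (rule ext)
    fix x :: "'a ^ 'n"
    have eq: "(\<lambda>g. (f + h) (g x)) = (\<lambda>g. f (g x)) + (\<lambda>g. h (g x))" by (simp add: fun_eq_iff fun_simps)
    have "\<delta> (\<lambda>g. (f + h) (g x)) = \<delta> (\<lambda>g. f (g x)) + \<delta> (\<lambda>g. h (g x))" unfolding eq by (rule \<delta>(1))
    then show "D (f + h) x = (D f + D h) x" by (simp add: D_def fun_simps)
  qed
  have D_scale: "D (fscale k f) = fscale k (D f)" for k f
  proof (rule ext)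
    fix x :: "'a ^ 'n"
    have eq: "(\<lambda>g. (fscale k f) (g x)) = fscale k (\<lambda>g. f (g x))" by (simp add: fun_eq_iff fun_simps)
    have "\<delta> (\<lambda>g. (fscale k f) (g x)) = k * \<delta> (\<lambda>g. f (g x))" unfolding eq by (rule \<delta>(2))
    then show "D (fscale k f) x = fscale k (D f) x" by (simp add: D_def fun_simps)
  qed
  have ev: "f (g x) = (\<Sum>j<dm u. coord u j (pull X g f) * (basis u ! j) x)"
    if f: "f \<in> W u" and g: "g \<in> slice" and x: "x \<in> X" for f u g x
  proof -
    have "pull X g f x = (\<Sum>j<dm u. fscale (coord u j (pull X g f)) (basis u ! j)) x"
      using fun_cong[OF basis_expand[OF stab_W[OF slice_stab[OF g] f]], of x] .
    then show ?thesis using x by (simp add: pull_def fun_simps)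
  qed
  \<comment> \<open>\<open>\<delta>\<close> passes to the coordinates with respect to a basis of
    \<open>W u\<close>; this shows that \<open>D f\<close> is again a regular function and of the
    same weight.\<close>
  have D_W: "D f = (\<Sum>j<dm u. fscale (\<delta> (\<lambda>g. coord u j (pull X g f))) (basis u ! j))" if f: "f \<in> W u" for f u
  proof (rule ext)
    fix x
    show "D f x = (\<Sum>j<dm u. fscale (\<delta> (\<lambda>g. coord u j (pull X g f))) (basis u ! j)) x"
    proof (cases "x \<in> X")
      case True
      have "\<delta> (\<lambda>g. f (g x)) = \<delta> (\<Sum>j<dm u. fscale ((basis u ! j) x) (\<lambda>g. coord u j (pull X g f)))"
        by (rule cong) (simp add: ev[OF f _ True] fun_simps mult.commute)
      then show ?thesis using True by (simp add: D_def \<delta>sum \<delta>(2) fun_simps mult.commute)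
    next
      case False
      have "(basis u ! j) x = 0" if "j < dm u" for j using regular_ring_off[OF W_R[OF basis_W[OF that]] False] .
      then show ?thesis using False by (simp add: D_def fun_simps)
    qed
  qed
  have DW: "D f \<in> W u" if "f \<in> W u" for f u
    unfolding D_W[OF that] by (intro fv.subspace_sum[OF subspace_W] fv.subspace_scale[OF subspace_W] basis_W) simp
  have DR: "D f \<in> R" if "f \<in> R" for f
  proof (rule direct_sum_induct[OF direct_sum_W that _ _ subspace_regular_ring])
    show "D f \<in> R" if "f \<in> W u" for f u using DW[OF that] W_R by blast
    show "D (f + g) \<in> R" if "D f \<in> R" "D g \<in> R" for f g unfolding D_add using that by (rule regular_ring_add)
  qed
  \<comment> \<open>The product rule of \<open>\<delta>\<close> covers only polynomials in the
    matrix entries. For a generator \<open>y\<close>, the function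
    \<open>g \<mapsto> y (g x)\<close> is even linear in them.\<close>
  have regY: "regular_on slice coeffs (\<lambda>g. y (g x))" if y: "y \<in> Y" and x: "x \<in> X" for y x
  proof -
    let ?u = "wt y"
    have "regular_on slice coeffs (\<lambda>g. \<Sum>i<dm ?u. coord ?u i y * (\<Sum>j<dm ?u. (basis ?u ! j) x * cf ?u i j g))"
      by (intro regular_on_sum regular_on_scale regular_on_generator cf_coeffs imageI y) simp_all
    then show ?thesis
    proof (rule regular_on_cong[rotated])
      fix g assume g: "g \<in> slice"
      have "y (g x) = (\<Sum>i<dm ?u. fscale (coord ?u i y) (basis ?u ! i)) (g x)"
        using fun_cong[OF basis_expand[OF Y_W[OF y]], of "g x"] .
      also have "\<dots> = (\<Sum>i<dm ?u. coord ?u i y * (basis ?u ! i) (g x))" by (simp add: fun_simps)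
      also have "\<dots> = (\<Sum>i<dm ?u. coord ?u i y * (\<Sum>j<dm ?u. (basis ?u ! j) x * cf ?u i j g))"
        by (intro sum.cong refl) (simp add: ev[OF basis_W g x] cf_def mult.commute)
      finally show "(\<Sum>i<dm ?u. coord ?u i y * (\<Sum>j<dm ?u. (basis ?u ! j) x * cf ?u i j g)) = y (g x)" by simp
    qed
  qed
  have reg: "regular_on slice coeffs (\<lambda>g. f (g x))" if f: "f \<in> R" and x: "x \<in> X" for f x
    by (rule regular_on_comp[OF gen[OF f]])
      (use regY x automorphism_mem[OF stab_automorphism[OF slice_stab]] in auto)
  have D_mult: "D (f * h) = D f * h + f * D h" if f: "f \<in> R" and h: "h \<in> R" for f h
  proof (rule ext)
    fix x :: "'a ^ 'n"
    show "D (f * h) x = (D f * h + f * D h) x"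
    proof (cases "x \<in> X")
      case True
      have eq: "(\<lambda>g. (f * h) (g x)) = (\<lambda>g. f (g x)) * (\<lambda>g. h (g x))" by (simp add: fun_eq_iff fun_simps)
      have "\<delta> (\<lambda>g. (f * h) (g x)) = f x * \<delta> (\<lambda>g. h (g x)) + h x * \<delta> (\<lambda>g. f (g x))"
        unfolding eq using \<delta>(5)[OF reg[OF f True] reg[OF h True]] True by (simp add: e_def)
      then show ?thesis using True by (simp add: D_def fun_simps mult.commute add.commute)
    qed (simp add: D_def fun_simps regular_ring_off[OF f] regular_ring_off[OF h])
  qed
  have deriv: "derivation_on X D"
    unfolding derivation_on_def using DR D_add D_mult D_scale by simp
  have TW: "\<exists>k. \<forall>f\<in>W u. \<forall>x\<in>X. f (t x) = k * f x" if t: "t \<in> T" for t u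
  proof -
    obtain t' where t': "t' \<in> TT" "t = \<phi> t'" using t \<phi>_image by blast
    have "\<forall>f\<in>W u. \<forall>x\<in>X. f (t x) = tmonom s u t' * f x" unfolding t'(2) by (intro ballI W_apply t'(1))
    then show ?thesis by (rule exI)
  qed
  have "\<exists>k. \<forall>f\<in>W u. D f = fscale k f" for u
    by (rule derivation_scalar_on_weight_spaces[OF closed rigid maximal deriv direct_sum_W W_finite_dim DW TW])
  then have "\<exists>l. \<forall>u. \<forall>f\<in>W u. D f = fscale (l u) f" by (intro choice allI)
  then obtain l where l: "\<And>u f. f \<in> W u \<Longrightarrow> D f = fscale (l u) f" by blast
  \<comment> \<open>As \<open>D\<close> is the scalar \<open>l u\<close> on \<open>W u\<close>, the
    tangent vector, read as a matrix on this space, is \<open>l u\<close> times the identity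
    matrix.\<close>
  have \<delta>cf: "\<delta> (cf u i j) = (if i = j then l u else 0)" if ij: "i < dm u" "j < dm u" for u i j
  proof -
    have "(\<Sum>j<dm u. fscale (\<delta> (cf u i j)) (basis u ! j)) = D (basis u ! i)"
      unfolding D_W[OF basis_W[OF ij(1)]] cf_def[abs_def] ..
    also have "\<dots> = fscale (l u) (basis u ! i)" by (rule l[OF basis_W[OF ij(1)]])
    also have "\<dots> = (\<Sum>j<dm u. if i = j then fscale (l u) (basis u ! j) else 0)" using ij(1) by simp
    also have "\<dots> = (\<Sum>j<dm u. fscale (if i = j then l u else 0) (basis u ! j))" by (intro sum.cong) auto
    finally show ?thesis by (rule basis_unique[OF _ ij(2)])
  qed
  have \<delta>prod: "\<delta> (\<lambda>g. \<Prod>i\<in>I. f i g) = (\<Sum>i\<in>I. \<delta> (f i) * (\<Prod>k\<in>I - {i}. f k e))"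
    if "finite I" "\<And>i. i \<in> I \<Longrightarrow> regular_on slice coeffs (f i)" for I :: "nat set" and f
    using that
  proof (induction I rule: finite_induct)
    case empty
    show ?case using \<delta>(4)[of 1] by simp
  next
    case (insert k I)
    have "regular_on slice coeffs (\<lambda>g. \<Prod>i\<in>I. f i g)" by (rule regular_on_prod) (use insert.prems in blast)
    moreover have "(\<lambda>g. \<Prod>i\<in>insert k I. f i g) = f k * (\<lambda>g. \<Prod>i\<in>I. f i g)"
      using insert.hyps by (simp add: fun_eq_iff fun_simps)
    ultimately have "\<delta> (\<lambda>g. \<Prod>i\<in>insert k I. f i g) =
        f k e * (\<Sum>i\<in>I. \<delta> (f i) * (\<Prod>k\<in>I - {i}. f k e)) + (\<Prod>i\<in>I. f i e) * \<delta> (f k)"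
      using \<delta>(5)[of "f k" "\<lambda>g. \<Prod>i\<in>I. f i g"] insert by simp
    also have "f k e * (\<Sum>i\<in>I. \<delta> (f i) * (\<Prod>k\<in>I - {i}. f k e)) = (\<Sum>i\<in>I. \<delta> (f i) * (\<Prod>j\<in>insert k I - {i}. f j e))"
      unfolding sum_distrib_left
    proof (rule sum.cong[OF refl])
      fix i assume i: "i \<in> I"
      then have "insert k I - {i} = insert k (I - {i})" using insert.hyps by auto
      then show "f k e * (\<delta> (f i) * (\<Prod>k\<in>I - {i}. f k e)) = \<delta> (f i) * (\<Prod>j\<in>insert k I - {i}. f j e)"
        using insert.hyps by (simp add: mult_ac)
    qed
    also have "(\<Prod>i\<in>I. f i e) * \<delta> (f k) = \<delta> (f k) * (\<Prod>j\<in>insert k I - {k}. f j e)"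
      using insert.hyps by (simp add: mult.commute)
    finally show ?case using insert.hyps by (simp add: add.commute)
  qed
  have l_frame: "l u = 0" if u: "u \<in> frame" for u
  proof -
    let ?P = "{p. p permutes {0..<dm u}}"
    have uY: "u \<in> wt ` Y" using u frame(1) by blast
    have det: "det_on u g = (\<Sum>p\<in>?P. signof p * (\<Prod>i = 0..<dm u. cf u i (p i) g))" for g
      unfolding det_on_def Determinant.det_def
      by (auto intro!: sum.cong prod.cong simp: permutes_in_image)
    \<comment> \<open>A permutation other than \<open>id\<close> contributes nothing: the
      differentiated entry is off the diagonal, where \<open>\<delta>\<close> vanishes, or some
      remaining factor is an off-diagonal entry of the identity matrix. The identity permutation
      yields the trace.\<close>
    have summand: "\<delta> (\<lambda>g. \<Prod>i = 0..<dm u. cf u i (p i) g) = (if p = id then of_nat (dm u) * l u else 0)" if p: "p \<in> ?P" for p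
    proof -
      have pd: "p i < dm u" if "i < dm u" for i using p permutes_in_image[of p "{0..<dm u}" i] that by auto
      have "\<delta> (\<lambda>g. \<Prod>i = 0..<dm u. cf u i (p i) g) =
          (\<Sum>i = 0..<dm u. \<delta> (cf u i (p i)) * (\<Prod>k\<in>{0..<dm u} - {i}. cf u k (p k) e))"
        by (rule \<delta>prod) (auto intro!: regular_on_generator cf_coeffs uY pd)
      also have "\<dots> = (\<Sum>i = 0..<dm u. if p = id then l u else 0)"
      proof (rule sum.cong[OF refl])
        fix i assume "i \<in> {0..<dm u}"
        then have i: "i < dm u" by simp
        show "\<delta> (cf u i (p i)) * (\<Prod>k\<in>{0..<dm u} - {i}. cf u k (p k) e) = (if p = id then l u else 0)"
        proof (cases "p = id")
          case True
          then show ?thesis using \<delta>cf[OF i i] by (simp add: cf_id e_def)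
        next
          case False
          show ?thesis
          proof (cases "p i = i")
            case True
            obtain k where k: "p k \<noteq> k" using False by (auto simp: fun_eq_iff)
            then have kd: "k < dm u" using p by (auto simp: permutes_def)
            have "k \<in> {0..<dm u} - {i}" using kd k True by auto
            moreover have "cf u k (p k) e = 0" using cf_id[OF kd pd[OF kd]] k by (simp add: e_def)
            ultimately have "(\<Prod>k\<in>{0..<dm u} - {i}. cf u k (p k) e) = 0" by (intro prod_zero) auto
            then show ?thesis using False by simp
          next
            case False': False
            then show ?thesis using \<delta>cf[OF i pd[OF i]] False by simp
          qed
        qed
      qed
      also have "\<dots> = (if p = id then of_nat (dm u) * l u else 0)" by simp
      finally show ?thesis .
    qed
    \<comment> \<open>The determinant is constantly 1 on the slice, so its derivative is that of a
      constant.\<close>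
    have "0 = \<delta> (\<lambda>g. 1)" using \<delta>(4)[of 1] by simp
    also have "\<dots> = \<delta> (\<Sum>p\<in>?P. fscale (signof p) (\<lambda>g. \<Prod>i = 0..<dm u. cf u i (p i) g))"
    proof (rule cong)
      fix g assume "g \<in> slice"
      then have "det_on u g = 1" using u by (simp add: slice_def)
      then show "1 = (\<Sum>p\<in>?P. fscale (signof p) (\<lambda>g. \<Prod>i = 0..<dm u. cf u i (p i) g)) g"
        unfolding det by (simp add: fun_simps)
    qed
    also have "\<dots> = (\<Sum>p\<in>?P. signof p * \<delta> (\<lambda>g. \<Prod>i = 0..<dm u. cf u i (p i) g))" by (simp only: \<delta>sum \<delta>(2))
    also have "\<dots> = (\<Sum>p\<in>?P. if p = id then of_nat (dm u) * l u else 0)"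
      by (intro sum.cong refl) (simp add: summand)
    also have "\<dots> = of_nat (dm u) * l u"
      using finite_permutations[of "{0..<dm u}"] permutes_id[of "{0..<dm u}"] by (simp add: sum.delta')
    finally show ?thesis using dm_pos[OF frame_S[OF u]] by simp
  qed
  \<comment> \<open>The product rule on a product of nonzero functions of weights \<open>u\<close>
    and \<open>v\<close>, which is nonzero because the ring is a domain.\<close>
  have l_add: "l (u + v) = l u + l v" if uv: "u \<in> S" "v \<in> S" for u v
  proof -
    obtain f h where fh: "f \<in> W u" "f \<noteq> 0" "h \<in> W v" "h \<noteq> 0" using uv unfolding S_iff by blast
    have nz: "f * h \<noteq> 0" using R_domain W_R fh by blast
    have "fscale (l (u + v)) (f * h) = D (f * h)" by (rule l[OF W_mult[OF fh(1,3)], symmetric])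
    also have "\<dots> = fscale (l u) f * h + f * fscale (l v) h"
      unfolding D_mult[OF W_R[OF fh(1)] W_R[OF fh(3)]] l[OF fh(1)] l[OF fh(3)] ..
    also have "\<dots> = fscale (l u + l v) (f * h)"
      by (simp add: fscale_mult_left fscale_mult_right fv.scale_left_distrib)
    finally show ?thesis using nz by (simp only: fv.scale_cancel_right simp_thms)
  qed
  obtain u i j where uij: "u \<in> wt ` Y" "i < dm u" "j < dm u" "c = cf u i j" using c(1) unfolding coeffs_def by auto
  have "l u = 0" by (rule additive_zero_on_frame[OF l_add l_frame uij(1)])
  then have "\<delta> c = 0" using \<delta>cf[OF uij(2,3)] uij(4) by simp
  then show False using c(2) by simp
qed

text \<open>Every automorphism factors as a torus element, an element of the slice and one of
  finitely many representatives; the torus factor is absorbed by the coset.\<close>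

lemma finite_quotient:
  assumes rigid: "rigid X" shows "finite (carrier (Aut X Mod T))"
proof -
  interpret A: group "Aut X" by (rule group_Aut)
  obtain Q where Q: "finite Q" "Q \<subseteq> automorphisms X" 
    "\<forall>g\<in>automorphisms X. \<exists>q\<in>Q. \<exists>k\<in>stab. g = compose X k q" using stab_finite_index by blast
  have "T #>\<^bsub>Aut X\<^esub> g \<in> (\<lambda>(h, q). T #>\<^bsub>Aut X\<^esub> (compose X h q)) ` (slice \<times> Q)" if g: "g \<in> automorphisms X" for g
  proof -
    obtain q k where qk: "q \<in> Q" "k \<in> stab" "g = compose X k q" using Q(3) g by blast
    obtain t h where th: "t \<in> TT" "h \<in> slice" "k = compose X (\<phi> t) h" using stab_decompose[OF qk(2)] by blast
    have m: "q \<in> automorphisms X" "k \<in> automorphisms X" "h \<in> automorphisms X" "\<phi> t \<in> automorphisms X"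
      using qk th Q(2) stab_automorphism slice_stab \<phi>_automorphism by blast+
    have hq: "compose X h q \<in> automorphisms X" by (rule compose_automorphisms[OF m(3,1)])
    have "g = \<phi> t \<otimes>\<^bsub>Aut X\<^esub> compose X h q"
    proof -
      have "g = (\<phi> t \<otimes>\<^bsub>Aut X\<^esub> h) \<otimes>\<^bsub>Aut X\<^esub> q" 
        using m compose_automorphisms[OF m(4,3)] by (simp add: qk(3) th(3) mult_Aut)
      also have "\<dots> = \<phi> t \<otimes>\<^bsub>Aut X\<^esub> (h \<otimes>\<^bsub>Aut X\<^esub> q)" by (rule A.m_assoc) (simp_all add: carrier_Aut m)
      finally show ?thesis by (simp add: mult_Aut m)
    qed
    then have "g \<in> T #>\<^bsub>Aut X\<^esub> compose X h q" using \<phi>_mem[OF th(1)] by (auto simp: r_coset_def)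
    then have "T #>\<^bsub>Aut X\<^esub> compose X h q = T #>\<^bsub>Aut X\<^esub> g"
      by (rule A.repr_independence[OF _ _ subgroup_T]) (simp add: carrier_Aut hq)
    then show ?thesis using th(2) qk(1) by force
  qed
  then have "carrier (Aut X Mod T) \<subseteq> (\<lambda>(h, q). T #>\<^bsub>Aut X\<^esub> (compose X h q)) ` (slice \<times> Q)"
    by (auto simp: carrier_FactGroup carrier_Aut)
  then show ?thesis using finite_slice[OF rigid] Q(1) finite_subset by blast
qed

end

theorem proposition1:
  fixes X :: "('a::{alg_closed_field, field_char_0} ^ 'n::finite) set"
    and T :: "('a ^ 'n \<Rightarrow> 'a ^ 'n) set"
    and s :: nat
    and \<phi> :: "(nat \<Rightarrow> 'a) \<Rightarrow> 'a ^ 'n \<Rightarrow> 'a ^ 'n"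
  assumes "irreducible_affine_variety X"
    and "rigid X"
    and "maximal_torus X T"
    and "torus_structure X T s \<phi>"
    and "pointed_grading (character_lattice X T s \<phi>) X (canonical_grading X T)"
  shows "T \<lhd> Aut X \<and> finite (carrier (Aut X Mod T))"
proof -
  interpret pointed_torus X T s \<phi> by unfold_locales fact+
  obtain Y wt where Y: "finite Y" "\<And>y. y \<in> Y \<Longrightarrow> y \<in> W (wt y)" "\<And>y. y \<in> Y \<Longrightarrow> y \<noteq> 0" "\<And>y. y \<in> Y \<Longrightarrow> wt y \<noteq> 0"
    "\<And>f. f \<in> R \<Longrightarrow> regular_on X Y f" using homogeneous_generators by metis
  interpret maximal_torus_setup X T s \<phi> Y wt by unfold_locales (fact Y assms(3))+
  show ?thesis using maximal_torus_normal[OF assms(3)] finite_quotient[OF assms(2)] by blast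
qed

end
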